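(* Let $\theta>0$. Let $(Y_i)_{i\in\mathbb{N}}$ be independent non-negative random variables with $\mathbb{E}[Y_i]=1$ and $\operatorname{Var}(Y_i)=\sigma_i^2<\infty$. Let $S_n^Y=\sum_{i=1}^nY_i$, and define $W_{n,k}=\frac{1}{Z_n}\sum_{i=1}^kY_i$, $1\le k\le n$, where either $Z_n=n$ (Model A) or $Z_n=S_n^Y$ (Model B). Let $X_k\sim\mathrm{Poi}(\theta/k)$, $k\in\mathbb{N}$, be independent of each other and of $(Y_i)_{i\in\mathbb{N}}$, and let $S_n=\sum_{k=1}^nW_{n,k}X_k$. Then, in both models, there exists a constant $C\in(0,\infty)$ depending only on $\theta$ such that for all $n\in\mathbb{N}$, $$d_K(S_n,D_\theta)\le C\Bigg(\frac{\log n}{n^2}\sum_{i=1}^n\sigma_i^2+\frac1n\Big(1+\sum_{i=1}^n\sigma_i^2\Big)^{1/2}+\frac1n\sum_{j=1}^n\frac1j\Big(\sum_{i=1}^j\sigma_i^2\Big)^{1/2}\Bigg)^{\min\{1,\theta\}}.$$ Moreover, there exists a constant $C'\in(0,\infty)$ depending only on $\theta$ such that for all $n\in\mathbb{N}$, $$d_{1,1}(S_n,D_\theta)\le C'\Bigg(1+\frac1n\Big(\sum_{i=1}^n\sigma_i^2\Big)^{1/2}\Bigg)\Bigg(\frac{\log n}{n^2}\sum_{i=1}^n\sigma_i^2+\frac1n\Big(1+\sum_{i=1}^n\sigma_i^2\Big)^{1/2}+\frac1n\sum_{j=1}^n\frac1j\Big(\sum_{i=1}^j\sigma_i^2\Bi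g)^{1/2}\Bigg).$$
   Context: $D_\theta$ has the generalized Dickman distribution with mean $\theta$: the unique non-negative solution (in law) of $D\stackrel{d}{=}U^{1/\theta}(D+1)$ with $U$ uniform on $[0,1]$ independent of $D$. $d_K(X,Y)=\sup_{t\ge0}|\mathbb{P}(X\le t)-\mathbb{P}(Y\le t)|$. $d_{1,1}(X,Y)=\sup_h|\mathbb{E}h(X)-\mathbb{E}h(Y)|$ over differentiable $h:\mathbb{R}\to\mathbb{R}$ with $h$ and $h'$ both Lipschitz with constant at most $1$. In Model B it is understood that $S_n^Y>0$ almost surely, so that the weights are well defined (and $W_{n,n}=1$). $\mathrm{Poi}(\lambda)$ is the Poisson distribution with mean $\lambda$. *)

theory Defs
  imports "HOL-Probability.Probability"
begin

(* Distances between random variables depend only on their laws, so both are defined on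
   probability measures on the Borel sets of the reals. *)

definition kolmogorov_dist :: "real measure \<Rightarrow> real measure \<Rightarrow> real" where
  "kolmogorov_dist \<mu> \<nu> = (SUP t\<in>{0..}. \<bar>cdf \<mu> t - cdf \<nu> t\<bar>)"

definition test_functions_11 :: "(real \<Rightarrow> real) set" where
  "test_functions_11 =
     {h. (\<forall>x. h differentiable (at x)) \<and> 1-lipschitz_on UNIV h \<and> 1-lipschitz_on UNIV (deriv h)}"

(* Extended-real valued, so that an unbounded supremum is infinite instead of unspecified. *)
definition d11_dist :: "real measure \<Rightarrow> real measure \<Rightarrow> ereal" where
  "d11_dist \<mu> \<nu> = (SUP h\<in>test_functions_11. ereal \<bar>integral\<^sup>L \<mu> h - integral\<^sup>L \<nu> h\<bar>)"

(* D is the law of a non-negative solution of D = U^(1/theta) (D + 1) in distribution, with U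
   uniform on [0,1] independent of D. Such a law is unique; results are stated for every D
   satisfying this predicate. *)
definition dickman_law :: "real \<Rightarrow> real measure \<Rightarrow> bool" where
  "dickman_law \<theta> D \<longleftrightarrow>
     prob_space D \<and> sets D = sets borel \<and> (AE x in D. 0 \<le> x) \<and>
     D = distr (uniform_measure lborel {0..1} \<Otimes>\<^sub>M D) borel (\<lambda>(u, d). u powr (1 / \<theta>) * (d + 1))"

(* Both sequences are indexed from 1. The single joint independence condition, over the disjoint
   union of two copies of the index set, says that the Y i are independent, the X k are
   independent, and the two families are independent of each other. *)
locale weighted_poisson = prob_space M
  for M :: "'a measure" +
  fixes \<theta> :: real
    and Y :: "nat \<Rightarrow> 'a \<Rightarrow> real"
    and X :: "nat \<Rightarrow> 'a \<Rightarrow> nat"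
    and \<sigma> :: "nat \<Rightarrow> real"
  assumes indep: "indep_vars (\<lambda>_. borel) (case_sum Y (\<lambda>k \<omega>. real (X k \<omega>))) ({1..} <+> {1..})"
    and Y_nonneg: "\<And>i. 1 \<le> i \<Longrightarrow> AE \<omega> in M. 0 \<le> Y i \<omega>"
    and Y_integrable: "\<And>i. 1 \<le> i \<Longrightarrow> integrable M (Y i)"
    and Y_mean: "\<And>i. 1 \<le> i \<Longrightarrow> expectation (Y i) = 1"
    and Y_square_integrable: "\<And>i. 1 \<le> i \<Longrightarrow> integrable M (\<lambda>\<omega>. (Y i \<omega>)\<^sup>2)"
    and Y_variance: "\<And>i. 1 \<le> i \<Longrightarrow> variance (Y i) = (\<sigma> i)\<^sup>2"
    and X_poisson: "\<And>k. 1 \<le> k \<Longrightarrow>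
           distr M (count_space UNIV) (X k) = measure_pmf (poisson_pmf (\<theta> / real k))"

datatype weight_model = Model_A | Model_B

definition partial_sum :: "(nat \<Rightarrow> 'a \<Rightarrow> real) \<Rightarrow> nat \<Rightarrow> 'a \<Rightarrow> real" where
  "partial_sum Y n \<omega> = (\<Sum>i=1..n. Y i \<omega>)"

definition normalizer :: "weight_model \<Rightarrow> (nat \<Rightarrow> 'a \<Rightarrow> real) \<Rightarrow> nat \<Rightarrow> 'a \<Rightarrow> real" where
  "normalizer m Y n \<omega> = (case m of Model_A \<Rightarrow> real n | Model_B \<Rightarrow> partial_sum Y n \<omega>)"

definition weight :: "weight_model \<Rightarrow> (nat \<Rightarrow> 'a \<Rightarrow> real) \<Rightarrow> nat \<Rightarrow> nat \<Rightarrow> 'a \<Rightarrow> real" where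
  "weight m Y n k \<omega> = 1 / normalizer m Y n \<omega> * partial_sum Y k \<omega>"

definition weighted_sum ::
    "weight_model \<Rightarrow> (nat \<Rightarrow> 'a \<Rightarrow> real) \<Rightarrow> (nat \<Rightarrow> 'a \<Rightarrow> nat) \<Rightarrow> nat \<Rightarrow> 'a \<Rightarrow> real" where
  "weighted_sum m Y X n \<omega> = (\<Sum>k=1..n. weight m Y n k \<omega> * real (X k \<omega>))"

definition error_term :: "(nat \<Rightarrow> real) \<Rightarrow> nat \<Rightarrow> real" where
  "error_term \<sigma> n =
     ln (real n) / (real n)\<^sup>2 * (\<Sum>i=1..n. (\<sigma> i)\<^sup>2)
     + 1 / real n * sqrt (1 + (\<Sum>i=1..n. (\<sigma> i)\<^sup>2))
     + 1 / real n * (\<Sum>j=1..n. 1 / real j * sqrt (\<Sum>i=1..j. (\<sigma> i)\<^sup>2))"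

(* C is an admissible constant in the respective estimate, simultaneously for both models, all
   random variables on all probability spaces with underlying type 'a, and all n. In Model B
   positivity of the partial sum is only required for the n under consideration. *)

definition kolmogorov_rate :: "'a itself \<Rightarrow> real \<Rightarrow> real \<Rightarrow> bool" where
  "kolmogorov_rate (T :: 'a itself) \<theta> C \<longleftrightarrow>
     (\<forall>(M :: 'a measure) Y X \<sigma> D m n.
        weighted_poisson M \<theta> Y X \<sigma> \<longrightarrow> dickman_law \<theta> D \<longrightarrow> 1 \<le> n \<longrightarrow>
        (m = Model_B \<longrightarrow> (AE \<omega> in M. 0 < partial_sum Y n \<omega>)) \<longrightarrow>
        kolmogorov_dist (distr M borel (weighted_sum m Y X n)) D
          \<le> C * error_term \<sigma> n powr min 1 \<theta>)"

definition d11_rate :: "'a itself \<Rightarrow> real \<Rightarrow> real \<Rightarrow> bool" where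
  "d11_rate (T :: 'a itself) \<theta> C \<longleftrightarrow>
     (\<forall>(M :: 'a measure) Y X \<sigma> D m n.
        weighted_poisson M \<theta> Y X \<sigma> \<longrightarrow> dickman_law \<theta> D \<longrightarrow> 1 \<le> n \<longrightarrow>
        (m = Model_B \<longrightarrow> (AE \<omega> in M. 0 < partial_sum Y n \<omega>)) \<longrightarrow>
        d11_dist (distr M borel (weighted_sum m Y X n)) D
          \<le> ereal (C * (1 + 1 / real n * sqrt (\<Sum>i=1..n. (\<sigma> i)\<^sup>2)) * error_term \<sigma> n))"

(* A HOL formula cannot quantify over types, so an existential statement for a type variable 'a
   alone would let the constant depend on the type underlying the sample space. To express that
   it depends only on theta, existence is asserted for one fixed type, nat => real, which is rich
   enough to carry the joint law of the two sequences, and every constant admissible for that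
   type is asserted to be admissible for every type 'a. *)

end

(* Write V = U^(1/theta), H(x) = E h(V x) and (A h)(x) = H(x + 1), so that E h(D) = E (A h)(D).
   For a sum T = sum a_k X_k with fixed weights, the Poisson size-bias identity expresses the
   defect E h(T) - E (A h)(T) through f = H'/theta as theta times the expectation of
     sum (a_k / k - 1 / n) f(T + a_k) + (1/n sum f(T + a_k) - int_0^1 f(T + u) du),
   where the last bracket is a quadrature error, controlled by max |a_k - k / n| as soon as f is
   Lipschitz or a difference of monotone functions.  A contracts by E V = theta / (theta + 1) both
   the class of C^{1,1} test functions and the convex hull of the hinges x -> max 0 (s - x);
   summing the defects along the iterates of A gives the d_{1,1} bound and a bound for hinges.
   For h = 1_{x <= t} the function f jumps by 1 / t at t; this is compensated by
   P(T <= t) = O(t^theta), whence the exponent min 1 theta, and A h is a combination of a hinge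
   and an image of a hinge under A.  Random weights enter only through the expectation of the
   deviations of the partial sums, which Doob's maximal inequality bounds. *)
theory Submission
  imports Defs
begin

text \<open>Differentiating \<open>u * h (u powr (1 / \<theta>) * x)\<close> in \<open>u\<close>
  gives h(x) = H(x) + x f(x), and H(x + 1) - H(x) is \<theta> times the integral of f over
  [x, x + 1]. Hence h - A h = x f(x) - \<theta> int_0^1 f(x + u) du, and it is the term x f(x) that
  Poisson size bias rewrites. The obstacle is the Kolmogorov distance: A maps an indicator to a
  mixture of indicators of total mass 1, so nothing is gained by iterating. A hinge is homogeneous,
  so its image is a mixture of hinges of total mass E V < 1. The indicator therefore undergoes a
  single step, after which only hinges are iterated. The iteration is carried out as an inequality S
  \<le> \<kappa> + \<rho> S for the supremum S over the test class, which says something only when S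
  is finite. This is why the mean of the Dickman law has to be proved finite first. All defects are
  bounded for fixed weights and then averaged over the weights. The bound is the error to a power at
  most 1, so by concavity the average is controlled by the mean error.\<close>

section \<open>Integration against the uniform law on the unit interval\<close>

abbreviation unif01 :: "real measure" where
  "unif01 \<equiv> uniform_measure lborel {0..1}"

lemma sets_unif01 [measurable_cong]: "sets unif01 = sets borel"
  by simp

interpretation unif01: prob_space unif01
  by (rule prob_space_uniform_measure) auto

lemma measure_unif01_UNIV [simp]: "measure unif01 UNIV = 1"
  using unif01.prob_space by simp

lemma unif01_eq_density: "unif01 = density lborel (\<lambda>x. ennreal (indicator {0..1} x))"
  unfolding uniform_measure_def by (intro density_cong) (auto simp: indicator_def)

lemma integral_unif01:
  fixes f :: "real \<Rightarrow> real"
  assumes [measurable]: "f \<in> borel_measurable borel"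
  shows "(\<integral>u. f u \<partial>unif01) = (\<integral>u. indicator {0..1} u * f u \<partial>lborel)"
  unfolding unif01_eq_density by (subst integral_real_density) auto

lemma AE_unif01: "AE u in unif01. 0 < u \<and> u < 1"
proof -
  have "AE u in lborel. u \<noteq> (0::real)" "AE u in lborel. u \<noteq> (1::real)"
    by (auto intro: AE_lborel_singleton)
  then show ?thesis
    by (subst AE_uniform_measure) (auto elim!: eventually_elim2)
qed

lemma integrable_unif01_bounded:
  fixes f :: "real \<Rightarrow> real"
  assumes "f \<in> borel_measurable borel" "\<And>u. 0 < u \<Longrightarrow> u < 1 \<Longrightarrow> \<bar>f u\<bar> \<le> B"
  shows "integrable unif01 f"
  using assms by (intro unif01.integrable_const_bound[where B=B] eventually_mono[OF AE_unif01]) auto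

lemma integral_unif01_mono:
  fixes f g :: "real \<Rightarrow> real"
  assumes "integrable unif01 f" "integrable unif01 g" "\<And>u. 0 < u \<Longrightarrow> u < 1 \<Longrightarrow> f u \<le> g u"
  shows "(\<integral>u. f u \<partial>unif01) \<le> (\<integral>u. g u \<partial>unif01)"
  using assms by (intro integral_mono_AE eventually_mono[OF AE_unif01]) auto

lemma integral_unif01_cong:
  fixes f g :: "real \<Rightarrow> real"
  assumes "f \<in> borel_measurable borel" "g \<in> borel_measurable borel"
    "\<And>u. 0 < u \<Longrightarrow> u < 1 \<Longrightarrow> f u = g u"
  shows "(\<integral>u. f u \<partial>unif01) = (\<integral>u. g u \<partial>unif01)"
  using assms by (intro integral_cong_AE eventually_mono[OF AE_unif01]) auto

text \<open>Boundedness makes the Lebesgue integral agree with the gauge integral, whose fundamental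
  theorem lets a continuous primitive fail to be differentiable at finitely many points. Such points
  arise from the kink of a hinge and from the edge of an indicator.\<close>

lemma integral_unif01_FTC:
  fixes f F :: "real \<Rightarrow> real"
  assumes f: "f \<in> borel_measurable borel" and bnd: "\<And>u. 0 < u \<Longrightarrow> u < 1 \<Longrightarrow> \<bar>f u\<bar> \<le> B"
    and S: "finite S" and F: "\<And>u. 0 < u \<Longrightarrow> u < 1 \<Longrightarrow> u \<notin> S \<Longrightarrow> (F has_real_derivative f u) (at u)"
    and cont: "continuous_on {0..1} F"
  shows "(\<integral>u. f u \<partial>unif01) = F 1 - F 0"
proof -
  \<comment> \<open>The values at the end points are cut off because \<open>f\<close> is bounded
    only on the open interval.\<close>
  define g where "g u = f u * indicator {0<..<1} u" for u
  have g[measurable]: "g \<in> borel_measurable borel" unfolding g_def using f by measurable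
  have "set_integrable lborel {0..1} g"
    unfolding set_integrable_def
  proof (rule integrableI_bounded_set[where A="{0..1}" and B="\<bar>B\<bar>"])
    show "AE x in lborel. x \<in> {0..1} \<longrightarrow> norm (indicator {0..1} x *\<^sub>R g x) \<le> \<bar>B\<bar>"
      using bnd by (intro AE_I2) (auto simp: g_def indicator_def intro: order_trans[OF _ abs_ge_self])
  qed auto
  from set_borel_integral_eq_integral[OF this]
  have *: "(\<integral>u. indicator {0..1} u * g u \<partial>lborel) = integral {0..1} g"
    by (simp add: set_lebesgue_integral_def)
  have "(g has_integral (F 1 - F 0)) {0..1}"
  proof (rule fundamental_theorem_of_calculus_interior_strong[OF S _ _ cont])
    fix x :: real assume "x \<in> {0<..<1} - S"
    then show "(F has_vector_derivative g x) (at x)"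
      using F[of x] by (auto simp: g_def has_real_derivative_iff_has_vector_derivative)
  qed auto
  then have "integral {0..1} g = F 1 - F 0" by blast
  moreover have "(\<integral>u. f u \<partial>unif01) = (\<integral>u. g u \<partial>unif01)"
    using f by (intro integral_unif01_cong) (auto simp: g_def)
  ultimately show ?thesis using * integral_unif01[OF g] by simp
qed

lemma measure_unif01_atMost: "0 \<le> c \<Longrightarrow> c \<le> 1 \<Longrightarrow> measure unif01 {..c} = c"
proof -
  assume c: "0 \<le> c" "c \<le> 1"
  then have "{0..1} \<inter> {..c} = {0..c}" by auto
  then show ?thesis using c by (subst measure_uniform_measure) auto
qed

section \<open>The averaging operator and its Stein pairs\<close>

text \<open>The law of \<open>u powr (1 / \<theta>)\<close> under \<open>unif01\<close> is that of the multiplier \<open>U\<^sup>1\<^sup>/\<^sup>\<theta>\<close>.\<close>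

definition dickman_avg :: "real \<Rightarrow> (real \<Rightarrow> real) \<Rightarrow> real \<Rightarrow> real" where
  "dickman_avg \<theta> h x = (\<integral>u. h (u powr (1 / \<theta>) * x) \<partial>unif01)"

abbreviation dickman_step :: "real \<Rightarrow> (real \<Rightarrow> real) \<Rightarrow> real \<Rightarrow> real" where
  "dickman_step \<theta> h x \<equiv> dickman_avg \<theta> h (x + 1)"

lemma dickman_avg_measurable [measurable]:
  assumes [measurable]: "h \<in> borel_measurable borel"
  shows "dickman_avg \<theta> h \<in> borel_measurable borel"
  unfolding dickman_avg_def by measurable

lemma powr_inverse_bounds:
  fixes u \<theta> :: real
  assumes "\<theta> > 0" "0 < u" "u < 1"
  shows "0 < u powr (1 / \<theta>)" "u powr (1 / \<theta>) \<le> 1"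
  using assms by (auto simp: powr_le_one_le powr_le1)

text \<open>This mean of the multiplier is the contraction factor, both for smooth tests and for
  hinges.\<close>

lemma integral_unif01_powr:
  fixes \<theta> :: real
  assumes \<theta>: "\<theta> > 0"
  shows "(\<integral>u. u powr (1 / \<theta>) \<partial>unif01) = \<theta> / (\<theta> + 1)"
proof -
  have c: "\<theta> / (\<theta> + 1) * (1 / \<theta> + 1) = 1"
    using \<theta> by (simp add: divide_simps)
  have "(\<integral>u. u powr (1 / \<theta>) \<partial>unif01) =
      (\<lambda>u. \<theta> / (\<theta> + 1) * u powr (1 / \<theta> + 1)) 1 - (\<lambda>u. \<theta> / (\<theta> + 1) * u powr (1 / \<theta> + 1)) 0"
  proof (rule integral_unif01_FTC[where B=1 and S="{}"])
    fix u :: real assume u: "0 < u" "u < 1"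
    show "((\<lambda>u. \<theta> / (\<theta> + 1) * u powr (1 / \<theta> + 1)) has_real_derivative u powr (1 / \<theta>)) (at u)"
      using u c by (auto intro!: derivative_eq_intros simp: mult.assoc[symmetric])
    show "\<bar>u powr (1 / \<theta>)\<bar> \<le> 1" using powr_inverse_bounds[OF \<theta> u] by auto
  next
    show "continuous_on {0..1} (\<lambda>u. \<theta> / (\<theta> + 1) * u powr (1 / \<theta> + 1))"
      using \<theta> by (intro continuous_intros continuous_on_powr') (auto simp: add_pos_pos)
  qed auto
  then show ?thesis by simp
qed

text \<open>Here \<open>f\<close> plays the role of the derivative of \<open>dickman_avg \<theta> h\<close> divided by \<open>\<theta>\<close>, which need not
  exist everywhere.\<close>

definition stein_pair :: "real \<Rightarrow> (real \<Rightarrow> real) \<Rightarrow> (real \<Rightarrow> real) \<Rightarrow> bool" where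
  "stein_pair \<theta> h f \<longleftrightarrow>
     f \<in> borel_measurable borel \<and> h \<in> borel_measurable borel \<and> (\<exists>B. \<forall>x. \<bar>f x\<bar> \<le> B) \<and>
     (\<forall>x\<ge>0. h x = dickman_avg \<theta> h x + x * f x) \<and>
     (\<forall>x\<ge>0. dickman_avg \<theta> h (x + 1) - dickman_avg \<theta> h x = \<theta> * (\<integral>u. f (x + u) \<partial>unif01))"

text \<open>Both identities are instances of the fundamental theorem: in the uniform variable
  \<open>u\<close> for the first, in the position \<open>w\<close> followed by Fubini for the
  second. Finitely many kinks are allowed so that hinges are covered together with smooth
  functions.\<close>

lemma stein_pair_lipschitz:
  fixes h h' :: "real \<Rightarrow> real"
  assumes \<theta>: "\<theta> > 0" and cont: "continuous_on UNIV h" and S: "finite S"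
    and deriv: "\<And>x. x \<notin> S \<Longrightarrow> (h has_real_derivative h' x) (at x)"
    and h'[measurable]: "h' \<in> borel_measurable borel" and bnd: "\<And>x. \<bar>h' x\<bar> \<le> 1"
  shows "stein_pair \<theta> h (\<lambda>x. 1 / \<theta> * (\<integral>u. u powr (1 / \<theta>) * h' (u powr (1 / \<theta>) * x) \<partial>unif01))"
proof -
  let ?f = "\<lambda>x. 1 / \<theta> * (\<integral>u. u powr (1 / \<theta>) * h' (u powr (1 / \<theta>) * x) \<partial>unif01)"
  have h[measurable]: "h \<in> borel_measurable borel"
    using cont by (simp add: borel_measurable_continuous_onI)
  have b1: "\<bar>u powr (1 / \<theta>) * h' y\<bar> \<le> 1" if "0 < u" "u < 1" for u y
    using powr_inverse_bounds[OF \<theta> that] bnd[of y] by (simp add: abs_mult mult_le_one)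
  have f_meas: "?f \<in> borel_measurable borel" by measurable
  have int1: "integrable unif01 (\<lambda>u. u powr (1 / \<theta>) * h' (u powr (1 / \<theta>) * x))" for x
    by (rule integrable_unif01_bounded[where B=1]) (use b1 in auto)
  have f_bound: "\<bar>?f x\<bar> \<le> 1 / \<theta>" for x
  proof -
    have "\<bar>\<integral>u. u powr (1 / \<theta>) * h' (u powr (1 / \<theta>) * x) \<partial>unif01\<bar>
        \<le> (\<integral>u. \<bar>u powr (1 / \<theta>) * h' (u powr (1 / \<theta>) * x)\<bar> \<partial>unif01)"
      by (rule integral_abs_bound)
    also have "\<dots> \<le> (\<integral>u. 1 \<partial>unif01)"
      by (rule integral_unif01_mono) (use int1 b1 in auto)
    finally have "\<bar>\<integral>u. u powr (1 / \<theta>) * h' (u powr (1 / \<theta>) * x) \<partial>unif01\<bar> \<le> 1"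
      by simp
    then show ?thesis using \<theta> by (simp add: abs_mult divide_simps)
  qed
  have "\<exists>B. \<forall>y\<in>{- \<bar>x\<bar>..\<bar>x\<bar>}. \<bar>h y\<bar> \<le> B" for x
  proof -
    have "compact (h ` {- \<bar>x\<bar>..\<bar>x\<bar>})"
      by (intro compact_continuous_image continuous_on_subset[OF cont]) auto
    then have "bounded (h ` {- \<bar>x\<bar>..\<bar>x\<bar>})" by (rule compact_imp_bounded)
    then show ?thesis by (auto simp: bounded_iff)
  qed
  then obtain K where K: "\<And>x y. y \<in> {- \<bar>x\<bar>..\<bar>x\<bar>} \<Longrightarrow> \<bar>h y\<bar> \<le> K x" by metis
  have b2: "\<bar>h (u powr (1 / \<theta>) * x)\<bar> \<le> K x" if "0 < u" "u < 1" for u x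
  proof -
    have "\<bar>u powr (1 / \<theta>) * x\<bar> \<le> \<bar>x\<bar>"
      using powr_inverse_bounds[OF \<theta> that] by (simp add: abs_mult mult_left_le_one_le)
    then show ?thesis by (intro K) auto
  qed
  have int2: "integrable unif01 (\<lambda>u. h (u powr (1 / \<theta>) * x))" for x
    by (rule integrable_unif01_bounded[where B="K x"]) (use b2 in auto)
  have eq1: "h x = dickman_avg \<theta> h x + x * ?f x" if x: "x \<ge> 0" for x
  proof (cases "x = 0")
    case True
    then show ?thesis by (simp add: dickman_avg_def)
  next
    case False
    with x have x: "x > 0" by simp
    \<comment> \<open>The integrand is the derivative of
      \<open>u * h (u powr (1 / \<theta>) * x)\<close>, which is 0 at \<open>u = 0\<close> and
      \<open>h x\<close> at \<open>u = 1\<close>.\<close>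
    have "(\<integral>u. h (u powr (1 / \<theta>) * x) + x / \<theta> * (u powr (1 / \<theta>) * h' (u powr (1 / \<theta>) * x)) \<partial>unif01)
      = (\<lambda>u. u * h (u powr (1 / \<theta>) * x)) 1 - (\<lambda>u. u * h (u powr (1 / \<theta>) * x)) 0"
    proof (rule integral_unif01_FTC[where B="K x + x / \<theta>"])
      \<comment> \<open>\<open>u powr (1 / \<theta>) * x = s\<close> forces
        \<open>u = (s / x) powr \<theta>\<close>, so finitely many kinks of \<open>h\<close> yield
        finitely many exceptional \<open>u\<close>.\<close>
      show "finite ((\<lambda>s. (s / x) powr \<theta>) ` S)" using S by simp
    next
      fix u :: real assume u: "0 < u" "u < 1"
      show "\<bar>h (u powr (1 / \<theta>) * x) + x / \<theta> * (u powr (1 / \<theta>) * h' (u powr (1 / \<theta>) * x))\<bar> \<le> K x + x / \<theta>"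
        using b2[OF u, of x] mult_left_mono[OF b1[OF u, of "u powr (1 / \<theta>) * x"], of "x / \<theta>"] x \<theta>
        by (intro order_trans[OF abs_triangle_ineq]) (simp add: abs_mult)
      assume "u \<notin> (\<lambda>s. (s / x) powr \<theta>) ` S"
      then have "u powr (1 / \<theta>) * x \<notin> S"
        using x u \<theta> by (auto simp: image_iff powr_powr elim!: ballE[where x="u powr (1 / \<theta>) * x"])
      from deriv[OF this]
      have d: "((\<lambda>u. h (u powr (1 / \<theta>) * x)) has_real_derivative
          h' (u powr (1 / \<theta>) * x) * (1 / \<theta> * u powr (1 / \<theta> - 1) * x)) (at u)"
        using u by (intro DERIV_chain2[where g="\<lambda>u. u powr (1 / \<theta>) * x" and f=h])
          (auto intro!: derivative_eq_intros)
      have "u * u powr (1 / \<theta> - 1) = u powr (1 / \<theta>)"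
        using u by (simp add: powr_diff)
      then have e: "u * (h' (u powr (1 / \<theta>) * x) * (1 / \<theta> * u powr (1 / \<theta> - 1) * x))
         = x / \<theta> * (u powr (1 / \<theta>) * h' (u powr (1 / \<theta>) * x))"
        by (simp add: algebra_simps)
      show "((\<lambda>u. u * h (u powr (1 / \<theta>) * x)) has_real_derivative
        h (u powr (1 / \<theta>) * x) + x / \<theta> * (u powr (1 / \<theta>) * h' (u powr (1 / \<theta>) * x))) (at u)"
        unfolding e[symmetric] by (rule DERIV_cong[OF DERIV_mult[OF DERIV_ident d]]) (simp add: mult.commute)
    next
      show "continuous_on {0..1} (\<lambda>u. u * h (u powr (1 / \<theta>) * x))"
        using \<theta> by (intro continuous_intros continuous_on_compose2[OF cont] continuous_on_powr') auto
    qed measurable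
    also have "\<dots> = h x" by simp
    finally have "h x = (\<integral>u. h (u powr (1 / \<theta>) * x) \<partial>unif01)
        + x / \<theta> * (\<integral>u. u powr (1 / \<theta>) * h' (u powr (1 / \<theta>) * x) \<partial>unif01)"
      using int1[of x] int2[of x] by simp
    then show ?thesis by (simp add: dickman_avg_def)
  qed
  have eq2: "dickman_avg \<theta> h (x + 1) - dickman_avg \<theta> h x = \<theta> * (\<integral>w. ?f (x + w) \<partial>unif01)"
    if x: "x \<ge> 0" for x
  proof -
    interpret pair_prob_space unif01 unif01 ..
    \<comment> \<open>For each fixed multiplier the increment of \<open>h\<close> is an integral
      over \<open>w\<close>; exchanging the two integrals then produces \<open>f\<close>.\<close>
    have "dickman_avg \<theta> h (x + 1) - dickman_avg \<theta> h x
       = (\<integral>u. h (u powr (1 / \<theta>) * (x + 1)) - h (u powr (1 / \<theta>) * x) \<partial>unif01)"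
      unfolding dickman_avg_def using int2[of "x + 1"] int2[of x] by simp
    also have "\<dots> = (\<integral>u. (\<integral>w. u powr (1 / \<theta>) * h' (u powr (1 / \<theta>) * (x + w)) \<partial>unif01) \<partial>unif01)"
    proof (rule integral_unif01_cong)
      fix u :: real assume u: "0 < u" "u < 1"
      let ?v = "u powr (1 / \<theta>)"
      have v: "?v > 0" using u by simp
      have "(\<integral>w. ?v * h' (?v * (x + w)) \<partial>unif01)
          = (\<lambda>w. h (?v * (x + w))) 1 - (\<lambda>w. h (?v * (x + w))) 0"
      proof (rule integral_unif01_FTC[where B=1])
        show "finite ((\<lambda>s. s / ?v - x) ` S)" using S by simp
      next
        fix w :: real assume w: "0 < w" "w < 1"
        show "\<bar>?v * h' (?v * (x + w))\<bar> \<le> 1" using b1[OF u] .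
        assume "w \<notin> (\<lambda>s. s / ?v - x) ` S"
        then have "?v * (x + w) \<notin> S" using v by (auto simp: image_iff)
        from deriv[OF this]
        have "((\<lambda>w. h (?v * (x + w))) has_real_derivative h' (?v * (x + w)) * ?v) (at w)"
          by (intro DERIV_chain2[where g="\<lambda>w. ?v * (x + w)" and f=h])
            (auto intro!: derivative_eq_intros)
        then show "((\<lambda>w. h (?v * (x + w))) has_real_derivative ?v * h' (?v * (x + w))) (at w)"
          by (simp add: mult.commute)
      next
        show "continuous_on {0..1} (\<lambda>w. h (?v * (x + w)))"
          by (intro continuous_intros continuous_on_compose2[OF cont]) auto
      qed measurable
      then show "h (?v * (x + 1)) - h (?v * x) = (\<integral>w. ?v * h' (?v * (x + w)) \<partial>unif01)" by simp
    qed measurable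
    also have "\<dots> = (\<integral>w. (\<integral>u. u powr (1 / \<theta>) * h' (u powr (1 / \<theta>) * (x + w)) \<partial>unif01) \<partial>unif01)"
    proof (rule Fubini_integral[symmetric])
      have ae: "AE p in unif01 \<Otimes>\<^sub>M unif01. 0 < fst p \<and> fst p < 1"
      proof (rule AE_pair_measure)
        show "{p \<in> space (unif01 \<Otimes>\<^sub>M unif01). 0 < fst p \<and> fst p < 1} \<in> sets (unif01 \<Otimes>\<^sub>M unif01)"
          by measurable
      qed (auto intro!: eventually_mono[OF AE_unif01])
      have "AE p in unif01 \<Otimes>\<^sub>M unif01. norm (case p of (u, w) \<Rightarrow>
          u powr (1 / \<theta>) * h' (u powr (1 / \<theta>) * (x + w))) \<le> 1"
        by (rule eventually_mono[OF ae]) (use b1 in auto)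
      then show "integrable (unif01 \<Otimes>\<^sub>M unif01) (\<lambda>(u, w). u powr (1 / \<theta>) * h' (u powr (1 / \<theta>) * (x + w)))"
        by (intro integrable_const_bound[where B=1]) auto
    qed
    finally show ?thesis using \<theta> by simp
  qed
  show ?thesis
    unfolding stein_pair_def using f_meas h f_bound eq1 eq2 by blast
qed

subsection \<open>Quadrature with perturbed nodes\<close>

text \<open>An average over nodes becomes the integral of a step function against the same measure
  as the limit, so that quadrature errors can be estimated pointwise under one integral.\<close>

lemma step_sum_eq_integral:
  fixes c :: "nat \<Rightarrow> real"
  assumes n: "n \<ge> 1"
  shows "1 / real n * (\<Sum>k=1..n. c k) = (\<integral>u. c (nat \<lfloor>real n * u\<rfloor> + 1) \<partial>unif01)"
proof -
  let ?I = "\<lambda>k::nat. {(real k - 1) / n ..< real k / n}"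
  have meas: "measure unif01 (?I k) = 1 / n" if "k \<in> {1..n}" for k
  proof -
    have "0 \<le> (real k - 1) / n" "real k / n \<le> 1" using that n by (auto simp: field_simps)
    then have "{0..1} \<inter> ?I k = ?I k" by auto
    then show ?thesis
      using n by (subst measure_uniform_measure) (auto simp: divide_simps)
  qed
  have floor_iff: "nat \<lfloor>real n * u\<rfloor> + 1 = k \<longleftrightarrow> u \<in> ?I k" if "k \<in> {1..n}" "0 < u" "u < 1" for u k
  proof -
    have "nat \<lfloor>real n * u\<rfloor> + 1 = k \<longleftrightarrow> \<lfloor>real n * u\<rfloor> = int k - 1"
      using that by (auto simp: nat_eq_iff)
    also have "\<dots> \<longleftrightarrow> real k - 1 \<le> real n * u \<and> real n * u < real k"
      by (auto simp: floor_eq_iff)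
    also have "\<dots> \<longleftrightarrow> u \<in> ?I k" using n by (auto simp: field_simps)
    finally show ?thesis .
  qed
  have range: "nat \<lfloor>real n * u\<rfloor> + 1 \<in> {1..n}" if "0 < u" "u < 1" for u
  proof -
    have "real n * u < real n" using that n by simp
    then have "\<lfloor>real n * u\<rfloor> < int n" by (simp add: floor_less_iff)
    moreover have "0 \<le> \<lfloor>real n * u\<rfloor>" using that by simp
    ultimately show ?thesis by (simp add: nat_less_iff Suc_le_eq)
  qed
  have ii: "integrable unif01 (indicator (?I k) :: real \<Rightarrow> real)" for k
    by (rule integrable_unif01_bounded[where B=1]) (auto simp: indicator_def)
  have "(\<integral>u. c (nat \<lfloor>real n * u\<rfloor> + 1) \<partial>unif01) = (\<integral>u. (\<Sum>k=1..n. c k * indicator (?I k) u) \<partial>unif01)"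
  proof (rule integral_unif01_cong)
    fix u :: real assume u: "0 < u" "u < 1"
    have "(\<Sum>k=1..n. c k * indicator (?I k) u)
        = (\<Sum>k\<in>{1..n}. if k = nat \<lfloor>real n * u\<rfloor> + 1 then c k else 0)"
    proof (intro sum.cong refl)
      fix k assume "k \<in> {1..n}"
      then have eq: "k = nat \<lfloor>real n * u\<rfloor> + 1 \<longleftrightarrow> u \<in> ?I k" using floor_iff[OF _ u] by metis
      show "c k * indicator (?I k) u = (if k = nat \<lfloor>real n * u\<rfloor> + 1 then c k else 0)"
        unfolding eq by (simp only: indicator_def) simp
    qed
    also have "\<dots> = c (nat \<lfloor>real n * u\<rfloor> + 1)"
      using range[OF u] by (subst sum.delta) auto
    finally show "c (nat \<lfloor>real n * u\<rfloor> + 1) = (\<Sum>k=1..n. c k * indicator (?I k) u)" ..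
  qed measurable
  also have "\<dots> = (\<Sum>k=1..n. c k * measure unif01 (?I k))"
    using ii by (subst Bochner_Integration.integral_sum) auto
  also have "\<dots> = (\<Sum>k=1..n. c k * (1 / n))"
    using meas by (intro sum.cong) auto
  finally show ?thesis by (simp add: sum_distrib_left mult.commute)
qed

text \<open>\<open>u\<close> lies in the cell of length \<open>1 / n\<close> ending at
  \<open>k / n\<close>, which costs \<open>1 / n\<close>; the displacement of the node costs
  \<open>d\<close>.\<close>

lemma quantile_index_bounds:
  fixes a :: "nat \<Rightarrow> real"
  assumes n: "n \<ge> 1" and a: "\<And>k. k \<in> {1..n} \<Longrightarrow> \<bar>a k - real k / n\<bar> \<le> d"
    and u: "0 < u" "u < 1"
  shows "\<bar>a (nat \<lfloor>real n * u\<rfloor> + 1) - u\<bar> \<le> d + 1 / n"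
    and "nat \<lfloor>real n * u\<rfloor> + 1 \<in> {1..n}"
proof -
  let ?k = "nat \<lfloor>real n * u\<rfloor> + 1"
  have "real n * u < real n" using u n by simp
  then have "\<lfloor>real n * u\<rfloor> < int n" by (simp add: floor_less_iff)
  moreover have 0: "0 \<le> \<lfloor>real n * u\<rfloor>" using u by simp
  ultimately show k: "?k \<in> {1..n}" by (simp add: nat_less_iff Suc_le_eq)
  from 0 have "real ?k = of_int \<lfloor>real n * u\<rfloor> + 1" by simp
  then have "real n * u \<le> real ?k" "real ?k \<le> real n * u + 1" by linarith+
  then have "u \<le> real ?k / n" "real ?k / n \<le> u + 1 / n"
    using n by (auto simp: field_simps)
  then show "\<bar>a ?k - u\<bar> \<le> d + 1 / n" using a[OF k] by linarith
qed

lemma discrepancy_lipschitz: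
  fixes a :: "nat \<Rightarrow> real" and \<phi> :: "real \<Rightarrow> real"
  assumes n: "n \<ge> 1" and a: "\<And>k. k \<in> {1..n} \<Longrightarrow> \<bar>a k - real k / n\<bar> \<le> d"
    and a_nonneg: "\<And>k. k \<in> {1..n} \<Longrightarrow> 0 \<le> a k"
    and [measurable]: "\<phi> \<in> borel_measurable borel" and bnd: "\<And>x. 0 \<le> x \<Longrightarrow> \<bar>\<phi> x\<bar> \<le> B"
    and lip: "\<And>x y. 0 \<le> x \<Longrightarrow> 0 \<le> y \<Longrightarrow> \<bar>\<phi> x - \<phi> y\<bar> \<le> L * \<bar>x - y\<bar>" and L: "L \<ge> 0"
  shows "\<bar>1 / real n * (\<Sum>k=1..n. \<phi> (a k)) - (\<integral>u. \<phi> u \<partial>unif01)\<bar> \<le> L * (d + 1 / n)"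
proof -
  let ?a = "\<lambda>u. a (nat \<lfloor>real n * u\<rfloor> + 1)"
  note q = quantile_index_bounds[of n a d, OF n a]
  have i1: "integrable unif01 (\<lambda>u. \<phi> (?a u))"
    by (rule integrable_unif01_bounded[where B=B]) (use q bnd a_nonneg in auto)
  have i2: "integrable unif01 \<phi>"
    by (rule integrable_unif01_bounded[where B=B]) (use bnd in auto)
  have "\<bar>1 / real n * (\<Sum>k=1..n. \<phi> (a k)) - (\<integral>u. \<phi> u \<partial>unif01)\<bar> = \<bar>\<integral>u. \<phi> (?a u) - \<phi> u \<partial>unif01\<bar>"
    unfolding step_sum_eq_integral[OF n] using i1 i2 by simp
  also have "\<dots> \<le> (\<integral>u. \<bar>\<phi> (?a u) - \<phi> u\<bar> \<partial>unif01)" by (rule integral_abs_bound)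
  also have "\<dots> \<le> (\<integral>u. L * (d + 1 / n) \<partial>unif01)"
  proof (rule integral_unif01_mono)
    fix u :: real assume u: "0 < u" "u < 1"
    have "\<bar>\<phi> (?a u) - \<phi> u\<bar> \<le> L * \<bar>?a u - u\<bar>"
      by (rule lip) (use u q(2)[OF _ u] a_nonneg in auto)
    also have "\<dots> \<le> L * (d + 1 / n)" using q(1)[OF _ u] L by (intro mult_left_mono) auto
    finally show "\<bar>\<phi> (?a u) - \<phi> u\<bar> \<le> L * (d + 1 / n)" .
  qed (use i1 i2 in auto)
  finally show ?thesis by simp
qed

text \<open>Monotonicity replaces continuity: the node function is within
  \<open>e = d + 1 / n\<close> of the identity, so its composition with \<phi> lies between two
  translates of \<phi>. Translating a nonnegative decreasing function by \<open>e\<close> changes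
  its integral over the unit interval by at most \<open>e * \<phi> 0\<close>. This covers integrands
  with jumps.\<close>

lemma discrepancy_antimono:
  fixes a :: "nat \<Rightarrow> real" and \<phi> :: "real \<Rightarrow> real"
  assumes n: "n \<ge> 1" and a: "\<And>k. k \<in> {1..n} \<Longrightarrow> \<bar>a k - real k / n\<bar> \<le> d"
    and a_nonneg: "\<And>k. k \<in> {1..n} \<Longrightarrow> 0 \<le> a k"
    and [measurable]: "\<phi> \<in> borel_measurable borel"
    and nonneg: "\<And>x. 0 \<le> x \<Longrightarrow> 0 \<le> \<phi> x"
    and anti: "\<And>x y. 0 \<le> x \<Longrightarrow> x \<le> y \<Longrightarrow> \<phi> y \<le> \<phi> x"
  shows "\<bar>1 / real n * (\<Sum>k=1..n. \<phi> (a k)) - (\<integral>u. \<phi> u \<partial>unif01)\<bar> \<le> \<phi> 0 * (d + 1 / n)"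
proof -
  let ?a = "\<lambda>u. a (nat \<lfloor>real n * u\<rfloor> + 1)"
  define e where "e = d + 1 / n"
  have "d \<ge> 0" using a[of 1] n by force
  then have e: "e > 0" using n by (auto simp: e_def intro: add_nonneg_pos)
  note q = quantile_index_bounds[of n a d, OF n a]
  have bnd: "\<bar>\<phi> x\<bar> \<le> \<phi> 0" if "x \<ge> 0" for x using nonneg[OF that] anti[of 0 x] that by auto
  have i1: "integrable unif01 (\<lambda>u. \<phi> (?a u))"
    by (rule integrable_unif01_bounded[where B="\<phi> 0"]) (use q bnd a_nonneg in auto)
  have i3: "integrable unif01 (\<lambda>u. \<phi> (u + e))"
    by (rule integrable_unif01_bounded[where B="\<phi> 0"]) (use bnd e in auto)
  have i4: "integrable unif01 (\<lambda>u. \<phi> (max 0 (u - e)))"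
    by (rule integrable_unif01_bounded[where B="\<phi> 0"]) (use bnd in auto)
  have lb: "set_integrable lborel A (\<lambda>u. \<phi> (g u))"
    if "A \<in> sets borel" "emeasure lborel A < \<infinity>" "g \<in> borel_measurable borel" "\<And>u. u \<in> A \<Longrightarrow> g u \<ge> 0" for A g
    unfolding set_integrable_def using that bnd
    by (intro integrableI_bounded_set[where A=A and B="\<phi> 0"]) (auto simp: indicator_def)
  \<comment> \<open>The translate integrates \<phi> over the window from \<open>e\<close> to
    \<open>1 + e\<close>; only the piece from 0 to \<open>e\<close> is lost.\<close>
  have lower: "(\<integral>u. \<phi> u \<partial>unif01) - e * \<phi> 0 \<le> (\<integral>u. \<phi> (u + e) \<partial>unif01)"
  proof -
    have "(\<integral>u. \<phi> (u + e) \<partial>unif01) = (\<integral>u. indicator {0..1} u * \<phi> (u + e) \<partial>lborel)"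
      by (rule integral_unif01) measurable
    also have "\<dots> = (\<integral>u. indicator {e..1 + e} u * \<phi> u \<partial>lborel)"
      by (subst (2) lborel_integral_real_affine[where c=1 and t=e])
        (auto intro!: Bochner_Integration.integral_cong simp: indicator_def add.commute)
    finally have 1: "(\<integral>u. \<phi> (u + e) \<partial>unif01) = (\<integral>u. indicator {e..1 + e} u * \<phi> u \<partial>lborel)" .
    have "(\<integral>u. \<phi> u \<partial>unif01) = (\<integral>u. indicator {0..1} u * \<phi> u \<partial>lborel)"
      by (rule integral_unif01) measurable
    also have "\<dots> \<le> (\<integral>u. indicator {e..1 + e} u * \<phi> u + indicator {0..e} u * \<phi> 0 \<partial>lborel)"
    proof (rule integral_mono)
      show "integrable lborel (\<lambda>u. indicator {0..1} u * \<phi> u)"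
        using lb[of "{0..1}" "\<lambda>u. u"] by (simp add: set_integrable_def)
      show "integrable lborel (\<lambda>u. indicator {e..1 + e} u * \<phi> u + indicator {0..e} u * \<phi> 0)"
        using lb[of "{e..1+e}" "\<lambda>u. u"] e by (intro Bochner_Integration.integrable_add) (auto simp: set_integrable_def)
      show "indicator {0..1} u * \<phi> u \<le> indicator {e..1 + e} u * \<phi> u + indicator {0..e} u * \<phi> 0" for u
        using nonneg[of u] nonneg[of 0] anti[of 0 u] e by (auto simp: indicator_def)
    qed
    also have "\<dots> = (\<integral>u. indicator {e..1 + e} u * \<phi> u \<partial>lborel) + e * \<phi> 0"
      using lb[of "{e..1+e}" "\<lambda>u. u"] e by (subst Bochner_Integration.integral_add) (auto simp: set_integrable_def)
    finally show ?thesis using 1 by simp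
  qed
  \<comment> \<open>The truncation at 0 keeps the argument where \<phi> is known to be decreasing;
    it is active only for \<open>u\<close> below \<open>e\<close>, where the value is
    \<open>\<phi> 0\<close>.\<close>
  have upper: "(\<integral>u. \<phi> (max 0 (u - e)) \<partial>unif01) \<le> (\<integral>u. \<phi> u \<partial>unif01) + e * \<phi> 0"
  proof -
    have "(\<integral>u. \<phi> (max 0 (u - e)) \<partial>unif01) = (\<integral>u. indicator {0..1} u * \<phi> (max 0 (u - e)) \<partial>lborel)"
      by (rule integral_unif01) measurable
    also have "\<dots> \<le> (\<integral>u. indicator {0..1} (u - e) * \<phi> (max 0 (u - e)) + indicator {0..e} u * \<phi> 0 \<partial>lborel)"
    proof (rule integral_mono)
      show "integrable lborel (\<lambda>u. indicator {0..1} u * \<phi> (max 0 (u - e)))"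
        using lb[of "{0..1}" "\<lambda>u. max 0 (u - e)"] by (simp add: set_integrable_def)
      have "(\<lambda>u. indicator {0..1} (u - e) :: real) = indicator {e..1 + e}" by (auto simp: indicator_def fun_eq_iff)
      then show "integrable lborel (\<lambda>u. indicator {0..1} (u - e) * \<phi> (max 0 (u - e)) + indicator {0..e} u * \<phi> 0)"
        using lb[of "{e..1+e}" "\<lambda>u. max 0 (u - e)"] e
        by (intro Bochner_Integration.integrable_add) (auto simp: set_integrable_def fun_eq_iff)
      show "indicator {0..1} u * \<phi> (max 0 (u - e))
          \<le> indicator {0..1} (u - e) * \<phi> (max 0 (u - e)) + indicator {0..e} u * \<phi> 0" for u
        using nonneg[of "max 0 (u - e)"] nonneg[of 0] anti[of 0 "max 0 (u - e)"] e by (auto simp: indicator_def)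
    qed
    also have "\<dots> = (\<integral>u. indicator {0..1} (u - e) * \<phi> (max 0 (u - e)) \<partial>lborel) + e * \<phi> 0"
    proof -
      have "(\<lambda>u. indicator {0..1} (u - e) :: real) = indicator {e..1 + e}" by (auto simp: indicator_def fun_eq_iff)
      then show ?thesis
        using lb[of "{e..1+e}" "\<lambda>u. max 0 (u - e)"] e
        by (subst Bochner_Integration.integral_add) (auto simp: set_integrable_def fun_eq_iff)
    qed
    also have "(\<integral>u. indicator {0..1} (u - e) * \<phi> (max 0 (u - e)) \<partial>lborel) = (\<integral>u. indicator {0..1} u * \<phi> u \<partial>lborel)"
      by (subst lborel_integral_real_affine[where c=1 and t=e])
        (auto intro!: Bochner_Integration.integral_cong simp: indicator_def)
    also have "\<dots> = (\<integral>u. \<phi> u \<partial>unif01)" by (rule integral_unif01[symmetric]) measurable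
    finally show ?thesis .
  qed
  have "(\<integral>u. \<phi> (u + e) \<partial>unif01) \<le> (\<integral>u. \<phi> (?a u) \<partial>unif01)"
  proof (rule integral_unif01_mono[OF i3 i1])
    fix u :: real assume u: "0 < u" "u < 1"
    then show "\<phi> (u + e) \<le> \<phi> (?a u)"
      using q(1)[OF _ u] q(2)[OF _ u] a_nonneg by (intro anti) (auto simp: e_def)
  qed
  moreover have "(\<integral>u. \<phi> (?a u) \<partial>unif01) \<le> (\<integral>u. \<phi> (max 0 (u - e)) \<partial>unif01)"
  proof (rule integral_unif01_mono[OF i1 i4])
    fix u :: real assume u: "0 < u" "u < 1"
    then show "\<phi> (?a u) \<le> \<phi> (max 0 (u - e))"
      using q(1)[OF _ u] q(2)[OF _ u] a_nonneg by (intro anti) (auto simp: e_def)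
  qed
  ultimately show ?thesis
    unfolding step_sum_eq_integral[OF n] using lower upper
    by (simp add: e_def[symmetric] mult.commute abs_le_iff) 
qed

subsection \<open>Weighted Poisson sums with deterministic weights\<close>

text \<open>The Stein-Chen identity: (k + 1) p(k + 1) = r p(k), so after dropping the zero term at k
  = 0 the summation index shifts by one.\<close>

lemma poisson_pmf_size_bias:
  fixes g :: "nat \<Rightarrow> real"
  assumes r: "r > 0" and bnd: "\<And>k. \<bar>g k\<bar> \<le> B"
  shows "integrable (measure_pmf (poisson_pmf r)) (\<lambda>k. real k * g k)"
    and "(\<integral>k. real k * g k \<partial>measure_pmf (poisson_pmf r)) = r * (\<integral>k. g (k + 1) \<partial>measure_pmf (poisson_pmf r))"
proof -
  let ?p = "pmf (poisson_pmf r)"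
  have shift: "?p (Suc k) * real (Suc k) = r * ?p k" for k
  proof -
    have "r ^ Suc k / fact (Suc k) * real (Suc k) = r * (r ^ k / fact k)"
      by (simp add: divide_simps del: of_nat_Suc)
    moreover have "?p (Suc k) * real (Suc k) = r ^ Suc k / fact (Suc k) * real (Suc k) * exp (- r)"
      by (simp only: pmf_poisson[OF r] ac_simps)
    ultimately show ?thesis by (simp add: pmf_poisson[OF r] del: of_nat_Suc fact_Suc power_Suc)
  qed
  have sum_p: "summable ?p"
    using integrable_pmf[of UNIV "poisson_pmf r"] by (simp add: integrable_count_space_nat_iff)
  have 1: "summable (\<lambda>k. norm (?p k * g (k + 1)))"
  proof (rule summable_comparison_test'[where N=0])
    show "summable (\<lambda>k. ?p k * B)" using sum_p by (rule summable_mult2)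
    show "norm (norm (?p n * g (n + 1))) \<le> ?p n * B" for n
      using bnd by (auto simp: abs_mult intro!: mult_left_mono)
  qed
  have eq: "?p (Suc k) * (real (Suc k) * g (Suc k)) = r * (?p k * g (k + 1))" for k
    using shift[of k] by (simp add: mult.assoc[symmetric])
  have 2: "summable (\<lambda>k. norm (?p k * (real k * g k)))"
  proof (subst summable_Suc_iff[symmetric])
    have "(\<lambda>k. norm (?p (Suc k) * (real (Suc k) * g (Suc k)))) = (\<lambda>k. \<bar>r\<bar> * norm (?p k * g (k + 1)))"
      unfolding eq by (simp add: abs_mult)
    then show "summable (\<lambda>k. norm (?p (Suc k) * (real (Suc k) * g (Suc k))))"
      using summable_mult[OF 1, of "\<bar>r\<bar>"] by simp
  qed
  have int: "integrable (measure_pmf (poisson_pmf r)) f \<longleftrightarrow> summable (\<lambda>k. norm (?p k * f k))" for f :: "nat \<Rightarrow> real"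
    unfolding measure_pmf_eq_density
    by (subst integrable_density) (auto simp: integrable_count_space_nat_iff)
  have val: "(\<integral>k. f k \<partial>measure_pmf (poisson_pmf r)) = (\<Sum>k. ?p k * f k)"
    if "summable (\<lambda>k. norm (?p k * f k))" for f :: "nat \<Rightarrow> real"
    unfolding measure_pmf_eq_density using that
    by (subst integral_density) (auto simp: integral_count_space_nat integrable_count_space_nat_iff)
  show "integrable (measure_pmf (poisson_pmf r)) (\<lambda>k. real k * g k)"
    using 2 by (simp add: int)
  have "(\<integral>k. real k * g k \<partial>measure_pmf (poisson_pmf r)) = (\<Sum>k. ?p k * (real k * g k))"
    by (rule val[OF 2])
  also have "\<dots> = (\<Sum>k. ?p (Suc k) * (real (Suc k) * g (Suc k)))"
    using suminf_split_head[OF summable_norm_cancel[OF 2]] by simp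
  also have "\<dots> = r * (\<Sum>k. ?p k * g (k + 1))"
    unfolding eq by (rule suminf_mult[OF summable_norm_cancel[OF 1]])
  also have "(\<Sum>k. ?p k * g (k + 1)) = (\<integral>k. g (k + 1) \<partial>measure_pmf (poisson_pmf r))"
    by (rule val[OF 1, symmetric])
  finally show "(\<integral>k. real k * g k \<partial>measure_pmf (poisson_pmf r)) = r * (\<integral>k. g (k + 1) \<partial>measure_pmf (poisson_pmf r))" .
qed

text \<open>Fubini for a product law, phrased on the original sample space as freezing one of two
  independent variables. It serves twice: to isolate one count from the other summands, and to
  isolate the counts from the weights.\<close>

lemma (in prob_space) expectation_indep_var:
  fixes F :: "'b \<times> 'b \<Rightarrow> real"
  assumes indep: "indep_var S A T B" and F[measurable]: "F \<in> borel_measurable (S \<Otimes>\<^sub>M T)"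
    and int: "integrable M (\<lambda>\<omega>. F (A \<omega>, B \<omega>))"
  shows "expectation (\<lambda>\<omega>. F (A \<omega>, B \<omega>)) = expectation (\<lambda>\<omega>'. expectation (\<lambda>\<omega>. F (A \<omega>, B \<omega>')))"
    and "integrable M (\<lambda>\<omega>'. expectation (\<lambda>\<omega>. F (A \<omega>, B \<omega>')))"
proof -
  note eq = indep[unfolded indep_var_distribution_eq]
  have [measurable]: "random_variable S A" "random_variable T B" using eq by auto
  interpret PA: prob_space "distr M S A" by (rule prob_space_distr) simp
  interpret PB: prob_space "distr M T B" by (rule prob_space_distr) simp
  interpret P: pair_prob_space "distr M S A" "distr M T B" ..
  have int': "integrable (distr M S A \<Otimes>\<^sub>M distr M T B) (case_prod (\<lambda>a b. F (a, b)))"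
    using eq int by (simp add: integrable_distr_eq)
  have inner: "(\<integral>a. F (a, b) \<partial>distr M S A) = expectation (\<lambda>\<omega>. F (A \<omega>, b))" if "b \<in> space T" for b
    using that by (intro integral_distr) auto
  have sp: "B \<omega> \<in> space T" if "\<omega> \<in> space M" for \<omega>
    using that by (auto dest: measurable_space[OF \<open>random_variable T B\<close>])
  have "expectation (\<lambda>\<omega>. F (A \<omega>, B \<omega>)) = (\<integral>p. F p \<partial>(distr M S A \<Otimes>\<^sub>M distr M T B))"
    using eq by (simp add: integral_distr)
  also have "\<dots> = (\<integral>b. (\<integral>a. F (a, b) \<partial>distr M S A) \<partial>distr M T B)"
    using P.integral_snd[OF int'] by (simp add: case_prod_eta)
  also have "\<dots> = expectation (\<lambda>\<omega>'. \<integral>a. F (a, B \<omega>') \<partial>distr M S A)"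
    by (rule integral_distr) measurable
  also have "\<dots> = expectation (\<lambda>\<omega>'. expectation (\<lambda>\<omega>. F (A \<omega>, B \<omega>')))"
    using sp inner by (intro Bochner_Integration.integral_cong) auto
  finally show "expectation (\<lambda>\<omega>. F (A \<omega>, B \<omega>)) = expectation (\<lambda>\<omega>'. expectation (\<lambda>\<omega>. F (A \<omega>, B \<omega>')))" .
  have "integrable (distr M T B) (\<lambda>b. \<integral>a. F (a, b) \<partial>distr M S A)"
    using P.integrable_snd[OF int'] by simp
  then have "integrable M (\<lambda>\<omega>'. \<integral>a. F (a, B \<omega>') \<partial>distr M S A)"
    by (subst (asm) integrable_distr_eq) measurable
  then show "integrable M (\<lambda>\<omega>'. expectation (\<lambda>\<omega>. F (A \<omega>, B \<omega>')))"
    by (subst Bochner_Integration.integrable_cong[OF refl, where g="\<lambda>\<omega>'. \<integral>a. F (a, B \<omega>') \<partial>distr M S A"])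
      (use sp inner in auto)
qed

text \<open>The counts alone. The weights occur below only as a fixed sequence \<open>a\<close>,
  which is later a realization of the random weights.\<close>

locale poisson_array = prob_space M
  for M :: "'a measure" +
  fixes \<theta> :: real and n :: nat and X :: "nat \<Rightarrow> 'a \<Rightarrow> nat"
  assumes theta: "\<theta> > 0" and n: "n \<ge> 1"
    and X_indep: "indep_vars (\<lambda>_. borel) (\<lambda>k \<omega>. real (X k \<omega>)) {1..n}"
    and X_law: "\<And>k. k \<in> {1..n} \<Longrightarrow> distr M (count_space UNIV) (X k) = measure_pmf (poisson_pmf (\<theta> / real k))"
begin

definition wsum :: "(nat \<Rightarrow> real) \<Rightarrow> 'a \<Rightarrow> real" where
  "wsum a \<omega> = (\<Sum>k=1..n. a k * real (X k \<omega>))"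

lemma X_real_measurable: "k \<in> {1..n} \<Longrightarrow> (\<lambda>\<omega>. real (X k \<omega>)) \<in> borel_measurable M"
  using X_indep by (auto simp: indep_vars_def)

lemma X_measurable: "k \<in> {1..n} \<Longrightarrow> X k \<in> measurable M (count_space UNIV)"
proof -
  assume "k \<in> {1..n}"
  note [measurable] = X_real_measurable[OF this]
  have "(\<lambda>\<omega>. nat \<lfloor>real (X k \<omega>)\<rfloor>) \<in> measurable M (count_space UNIV)" by measurable
  then show ?thesis by simp
qed

lemma wsum_measurable [measurable]: "wsum a \<in> borel_measurable M"
  unfolding wsum_def[abs_def] by (intro borel_measurable_sum borel_measurable_times X_real_measurable) auto

lemma wsum_nonneg: "(\<And>k. k \<in> {1..n} \<Longrightarrow> 0 \<le> a k) \<Longrightarrow> 0 \<le> wsum a \<omega>"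
  unfolding wsum_def by (intro sum_nonneg mult_nonneg_nonneg) auto

lemma X_expectation:
  fixes g :: "nat \<Rightarrow> real"
  assumes k: "k \<in> {1..n}"
  shows "expectation (\<lambda>\<omega>. g (X k \<omega>)) = (\<integral>j. g j \<partial>measure_pmf (poisson_pmf (\<theta> / real k)))"
    and "integrable M (\<lambda>\<omega>. g (X k \<omega>)) \<longleftrightarrow> integrable (measure_pmf (poisson_pmf (\<theta> / real k))) g"
  unfolding X_law[OF k, symmetric]
  by (auto simp: integral_distr[OF X_measurable[OF k]] integrable_distr_eq[OF X_measurable[OF k]])

lemma X_size_bias:
  fixes g :: "nat \<Rightarrow> real"
  assumes k: "k \<in> {1..n}" and bnd: "\<And>j. \<bar>g j\<bar> \<le> B"
  shows "integrable M (\<lambda>\<omega>. real (X k \<omega>) * g (X k \<omega>))"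
    and "expectation (\<lambda>\<omega>. real (X k \<omega>) * g (X k \<omega>)) = \<theta> / real k * expectation (\<lambda>\<omega>. g (X k \<omega> + 1))"
proof -
  have "\<theta> / real k > 0" using theta k by simp
  note * = poisson_pmf_size_bias[OF this, of g B, OF bnd]
  show "integrable M (\<lambda>\<omega>. real (X k \<omega>) * g (X k \<omega>))"
    using X_expectation(2)[OF k, of "\<lambda>j. real j * g j"] *(1) by simp
  show "expectation (\<lambda>\<omega>. real (X k \<omega>) * g (X k \<omega>)) = \<theta> / real k * expectation (\<lambda>\<omega>. g (X k \<omega> + 1))"
    using X_expectation(1)[OF k, of "\<lambda>j. real j * g j"] X_expectation(1)[OF k, of "\<lambda>j. g (j + 1)"] *(2) by simp
qed

lemma X_integrable: "k \<in> {1..n} \<Longrightarrow> integrable M (\<lambda>\<omega>. real (X k \<omega>))"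
  using X_size_bias(1)[of k "\<lambda>_. 1" 1] by simp

lemma wsum_integrable: "integrable M (wsum a)"
  unfolding wsum_def[abs_def] by (intro Bochner_Integration.integrable_sum integrable_mult_right X_integrable) auto

text \<open>Size bias replaces \<open>X k\<close> by \<open>X k + 1\<close>, which moves the whole
  sum by \<open>a k\<close> while the other summands stay frozen.\<close>

lemma wsum_size_bias:
  fixes f :: "real \<Rightarrow> real"
  assumes f[measurable]: "f \<in> borel_measurable borel" and bnd: "\<And>x. \<bar>f x\<bar> \<le> B"
  shows "expectation (\<lambda>\<omega>. wsum a \<omega> * f (wsum a \<omega>)) = (\<Sum>k=1..n. \<theta> / real k * a k * expectation (\<lambda>\<omega>. f (wsum a \<omega> + a k)))"
    and "integrable M (\<lambda>\<omega>. wsum a \<omega> * f (wsum a \<omega>))"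
proof -
  have B: "B \<ge> 0" using bnd[of 0] by linarith
  have int: "integrable M (\<lambda>\<omega>. real (X k \<omega>) * f (wsum a \<omega>))" if k: "k \<in> {1..n}" for k
  proof (rule Bochner_Integration.integrable_bound[where f="\<lambda>\<omega>. real (X k \<omega>) * B"])
    show "(\<lambda>\<omega>. real (X k \<omega>) * f (wsum a \<omega>)) \<in> borel_measurable M"
      using X_real_measurable[OF k] by measurable
    show "AE \<omega> in M. norm (real (X k \<omega>) * f (wsum a \<omega>)) \<le> norm (real (X k \<omega>) * B)"
      using bnd B by (intro AE_I2) (auto simp: abs_mult intro!: mult_left_mono)
  qed (use X_integrable[OF k] in auto)
  have main: "expectation (\<lambda>\<omega>. real (X k \<omega>) * f (wsum a \<omega>)) = \<theta> / real k * expectation (\<lambda>\<omega>. f (wsum a \<omega> + a k))"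
    if k: "k \<in> {1..n}" for k
  proof -
    \<comment> \<open>The part of the sum that does not involve \<open>X k\<close>, hence
      independent of it.\<close>
    define R where "R \<omega> = (\<Sum>j\<in>{1..n} - {k}. a j * real (X j \<omega>))" for \<omega>
    have wR: "wsum a \<omega> = a k * real (X k \<omega>) + R \<omega>" for \<omega>
      unfolding wsum_def R_def using k by (subst sum.remove[of _ k]) auto
    have "indep_var borel ((\<lambda>v. v k) \<circ> (\<lambda>\<omega>. restrict (\<lambda>i. real (X i \<omega>)) {k})) borel
       ((\<lambda>v. \<Sum>j\<in>{1..n} - {k}. a j * v j) \<circ> (\<lambda>\<omega>. restrict (\<lambda>i. real (X i \<omega>)) ({1..n} - {k})))"
      using k by (intro indep_var_compose[OF indep_var_restrict[OF X_indep]]) auto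
    also have "(\<lambda>v. v k) \<circ> (\<lambda>\<omega>. restrict (\<lambda>i. real (X i \<omega>)) {k}) = (\<lambda>\<omega>. real (X k \<omega>))" by auto
    also have "(\<lambda>v. \<Sum>j\<in>{1..n} - {k}. a j * v j) \<circ> (\<lambda>\<omega>. restrict (\<lambda>i. real (X i \<omega>)) ({1..n} - {k})) = R"
      by (auto simp: R_def fun_eq_iff)
    finally have ind: "indep_var borel (\<lambda>\<omega>. real (X k \<omega>)) borel R" .
    have [measurable]: "(\<lambda>\<omega>. real (X k \<omega>)) \<in> borel_measurable M" using X_real_measurable[OF k] .
    have [measurable]: "R \<in> borel_measurable M" using ind indep_var_rv2 by blast
    have i2: "integrable M (\<lambda>\<omega>. f (a k * (real (X k \<omega>) + 1) + R \<omega>))"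
      by (rule integrable_const_bound[where B=B]) (use bnd in auto)
    have 1: "expectation (\<lambda>\<omega>. real (X k \<omega>) * f (a k * real (X k \<omega>) + r))
        = \<theta> / real k * expectation (\<lambda>\<omega>. f (a k * (real (X k \<omega>) + 1) + r))" for r
      using X_size_bias(2)[OF k, of "\<lambda>j. f (a k * real j + r)" B] bnd by (simp add: add.commute)
    have "expectation (\<lambda>\<omega>. real (X k \<omega>) * f (wsum a \<omega>))
        = expectation (\<lambda>\<omega>'. expectation (\<lambda>\<omega>. real (X k \<omega>) * f (a k * real (X k \<omega>) + R \<omega>')))"
      using expectation_indep_var(1)[OF ind, of "\<lambda>(x, r). x * f (a k * x + r)"] int[OF k] by (simp add: wR)
    also have "\<dots> = \<theta> / real k * expectation (\<lambda>\<omega>'. expectation (\<lambda>\<omega>. f (a k * (real (X k \<omega>) + 1) + R \<omega>')))"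
      unfolding 1 by simp
    also have "expectation (\<lambda>\<omega>'. expectation (\<lambda>\<omega>. f (a k * (real (X k \<omega>) + 1) + R \<omega>')))
        = expectation (\<lambda>\<omega>. f (a k * (real (X k \<omega>) + 1) + R \<omega>))"
      using expectation_indep_var(1)[OF ind, of "\<lambda>(x, r). f (a k * (x + 1) + r)"] i2 by simp
    also have "\<dots> = expectation (\<lambda>\<omega>. f (wsum a \<omega> + a k))" by (simp add: wR algebra_simps)
    finally show ?thesis .
  qed
  have eq: "wsum a \<omega> * f (wsum a \<omega>) = (\<Sum>k=1..n. a k * (real (X k \<omega>) * f (wsum a \<omega>)))" for \<omega>
    by (subst (1) wsum_def) (simp add: sum_distrib_right mult.assoc)
  show "integrable M (\<lambda>\<omega>. wsum a \<omega> * f (wsum a \<omega>))"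
    unfolding eq by (intro Bochner_Integration.integrable_sum integrable_mult_right int) auto
  show "expectation (\<lambda>\<omega>. wsum a \<omega> * f (wsum a \<omega>)) = (\<Sum>k=1..n. \<theta> / real k * a k * expectation (\<lambda>\<omega>. f (wsum a \<omega> + a k)))"
    unfolding eq using int main
    by (subst Bochner_Integration.integral_sum) (auto intro!: sum.cong)
qed

end

section \<open>Probability that the weighted sum is small\<close>

text \<open>The comparison of the harmonic sum with the logarithm, in multiplicative form:
  \<open>exp (- \<theta> / k)\<close> is at most \<open>(k / (k + 1)) powr \<theta>\<close>, and
  these factors telescope.\<close>

lemma prod_exp_le_powr:
  fixes \<theta> :: real
  assumes "\<theta> > 0" "N \<le> m"
  shows "(\<Prod>k=N+1..m. exp (- \<theta> / real k)) \<le> (real (N + 1) / real (m + 1)) powr \<theta>"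
  using assms(2)
proof (induction m rule: dec_induct)
  case base
  then show ?case by simp
next
  case (step m)
  have "ln (real (m + 2) / real (m + 1)) \<le> real (m + 2) / real (m + 1) - 1"
    by (rule ln_le_minus_one) simp
  also have "\<dots> = 1 / real (Suc m)" by (simp add: field_simps)
  finally have "\<theta> * ln (real (m + 2) / real (m + 1)) \<le> \<theta> * (1 / real (Suc m))"
    using assms(1) by (intro mult_left_mono) auto
  then have "- \<theta> / real (Suc m) \<le> \<theta> * ln (real (m + 1) / real (m + 2))"
    by (simp add: ln_div algebra_simps)
  then have e: "exp (- \<theta> / real (Suc m)) \<le> (real (m + 1) / real (m + 2)) powr \<theta>"
    by (simp add: powr_def)
  have "(\<Prod>k=N+1..Suc m. exp (- \<theta> / real k)) = (\<Prod>k=N+1..m. exp (- \<theta> / real k)) * exp (- \<theta> / real (Suc m))"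
    using step by simp
  also have "\<dots> \<le> (real (N + 1) / real (m + 1)) powr \<theta> * (real (m + 1) / real (m + 2)) powr \<theta>"
    by (intro mult_mono step.IH e) auto
  also have "\<dots> = (real (N + 1) / real (Suc m + 1)) powr \<theta>"
  proof -
    have "real (N + 1) / real (m + 1) * (real (m + 1) / real (m + 2)) = real (N + 1) / real (Suc m + 1)"
      by (simp del: of_nat_add of_nat_Suc)
    then show ?thesis by (subst powr_mult[symmetric]) auto
  qed
  finally show ?case .
qed

context poisson_array
begin

text \<open>A sum at most \<open>s\<close> forces \<open>X k = 0\<close> whenever
  \<open>a k > s\<close>, which includes every \<open>k > n * (s + d)\<close>. The probability that
  all these counts vanish is a product of factors \<open>exp (- \<theta> / k)\<close>.\<close>

lemma small_wsum_prob:
  assumes a: "\<And>k. k \<in> {1..n} \<Longrightarrow> \<bar>a k - real k / n\<bar> \<le> d"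
    and a_nonneg: "\<And>k. k \<in> {1..n} \<Longrightarrow> 0 \<le> a k" and s: "s \<ge> 0"
  shows "prob {\<omega> \<in> space M. wsum a \<omega> \<le> s} \<le> (s + d + 2 / n) powr \<theta>"
proof -
  have d: "d \<ge> 0" using a[of 1] n by force
  \<comment> \<open>The last index whose count may be nonzero. Rounding up gives
    \<open>N + 1 < n * (s + d) + 2\<close>, the origin of the summand \<open>2 / n\<close>.\<close>
  define N where "N = nat \<lceil>n * (s + d)\<rceil>"
  have N: "n * (s + d) \<le> N" "N < n * (s + d) + 1"
    using s d by (auto simp: N_def of_nat_nat intro!: mult_nonneg_nonneg) linarith+
  show ?thesis
  proof (cases "N < n")
    \<comment> \<open>No count is forced to vanish, but then the claimed bound is at least
      1.\<close>
    case False
    then have "real n - 1 < n * (s + d)" using N by linarith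
    then have "1 \<le> s + d + 2 / n" using n by (simp add: field_simps)
    then have "1 \<le> (s + d + 2 / n) powr \<theta>" using theta by (simp add: ge_one_powr_ge_zero)
    then show ?thesis using prob_le_1 order_trans by blast
  next
    case True
    have zero: "X k \<omega> = 0" if "k \<in> {N+1..n}" "wsum a \<omega> \<le> s" for k \<omega>
    proof (rule ccontr)
      assume "X k \<omega> \<noteq> 0"
      have k: "k \<in> {1..n}" using that by auto
      have "n * (s + d) < k" using N that by auto
      then have "s + d < real k / n" using n by (simp add: field_simps)
      then have "s < a k" using a[OF k] by linarith
      also have "a k \<le> a k * real (X k \<omega>)"
        using \<open>X k \<omega> \<noteq> 0\<close> a_nonneg[OF k] by (simp add: mult_le_cancel_left1 Suc_le_eq)
      also have "\<dots> \<le> wsum a \<omega>"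
        unfolding wsum_def using k a_nonneg by (intro member_le_sum) auto
      finally show False using that by simp
    qed
    have "prob {\<omega> \<in> space M. wsum a \<omega> \<le> s} \<le> prob (\<Inter>k\<in>{N+1..n}. (\<lambda>\<omega>. real (X k \<omega>)) -` {0} \<inter> space M)"
    proof (rule finite_measure_mono)
      show "{\<omega> \<in> space M. wsum a \<omega> \<le> s} \<subseteq> (\<Inter>k\<in>{N+1..n}. (\<lambda>\<omega>. real (X k \<omega>)) -` {0} \<inter> space M)"
        using zero by auto
      show "(\<Inter>k\<in>{N+1..n}. (\<lambda>\<omega>. real (X k \<omega>)) -` {0} \<inter> space M) \<in> events"
        using True by (intro sets.finite_INT measurable_sets[OF X_real_measurable]) auto
    qed
    also have "\<dots> = (\<Prod>k\<in>{N+1..n}. prob ((\<lambda>\<omega>. real (X k \<omega>)) -` {0} \<inter> space M))"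
      using True by (intro indep_varsD[OF X_indep]) auto
    also have "\<dots> = (\<Prod>k=N+1..n. exp (- \<theta> / real k))"
    proof (intro prod.cong refl)
      fix k assume "k \<in> {N+1..n}"
      then have k: "k \<in> {1..n}" by auto
      have "(\<lambda>\<omega>. real (X k \<omega>)) -` {0} \<inter> space M = X k -` {0} \<inter> space M" by auto
      then have "prob ((\<lambda>\<omega>. real (X k \<omega>)) -` {0} \<inter> space M) = measure (distr M (count_space UNIV) (X k)) {0}"
        by (simp add: measure_distr[OF X_measurable[OF k]])
      also have "\<dots> = pmf (poisson_pmf (\<theta> / real k)) 0"
        unfolding X_law[OF k] by (simp add: measure_pmf_single)
      also have "\<dots> = exp (- \<theta> / real k)" using theta k by simp
      finally show "prob ((\<lambda>\<omega>. real (X k \<omega>)) -` {0} \<inter> space M) = exp (- \<theta> / real k)" .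
    qed
    also have "\<dots> \<le> (real (N + 1) / real (n + 1)) powr \<theta>"
      using True theta by (intro prod_exp_le_powr) auto
    also have "\<dots> \<le> (s + d + 2 / n) powr \<theta>"
    proof (rule powr_mono2)
      have "real (N + 1) / real (n + 1) \<le> (n * (s + d) + 2) / n"
        using N n s d by (intro frac_le) auto
      also have "\<dots> = s + d + 2 / n" using n by (simp add: field_simps)
      finally show "real (N + 1) / real (n + 1) \<le> s + d + 2 / n" .
    qed (use theta in auto)
    finally show ?thesis .
  qed
qed

end

text \<open>Beyond \<open>t\<close> the average of \<open>indicator {..t}\<close> is
  \<open>(t / x) powr \<theta>\<close>, whose derivative is \<open>- \<theta> / t\<close> times this
  function. The constant continuation below \<open>t\<close> makes the whole function decreasing;
  for \<open>t > 0\<close> it is the survival function of a Pareto law with index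
  \<open>\<theta> + 1\<close>.\<close>

definition pareto_tail :: "real \<Rightarrow> real \<Rightarrow> real \<Rightarrow> real" where
  "pareto_tail \<theta> t x = (if x \<le> t then 1 else (t / x) powr (\<theta> + 1))"

lemma pareto_tail_measurable [measurable]: "pareto_tail \<theta> t \<in> borel_measurable borel"
  unfolding pareto_tail_def[abs_def] by measurable

lemma pareto_tail_nonneg: "0 \<le> pareto_tail \<theta> t x"
  by (simp add: pareto_tail_def)

lemma pareto_tail_antimono:
  assumes "\<theta> > 0" "t \<ge> 0" "x \<le> y"
  shows "pareto_tail \<theta> t y \<le> pareto_tail \<theta> t x"
  using assms unfolding pareto_tail_def
  by (auto intro!: powr_le1 powr_mono2 divide_left_mono mult_pos_pos)

lemma pareto_tail_le_1: "\<theta> > 0 \<Longrightarrow> t \<ge> 0 \<Longrightarrow> pareto_tail \<theta> t x \<le> 1"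
  unfolding pareto_tail_def by (auto intro!: powr_le1)

text \<open>Beyond \<open>2 ^ J * t\<close> the tail is at most the last summand, and each further
  layer refines this remainder. The step function on the right reduces expectations of the tail to
  probabilities of small values.\<close>

lemma pareto_tail_dyadic:
  assumes \<theta>: "\<theta> > 0" and t: "t > 0"
  shows "pareto_tail \<theta> t x \<le> (\<Sum>j<J. (1 / 2 ^ j) powr (\<theta> + 1) * indicator {..2 ^ (j + 1) * t} x) + (1 / 2 ^ J) powr (\<theta> + 1)"
proof (induction J)
  case 0
  show ?case using pareto_tail_le_1[OF \<theta>] t by simp
next
  case (Suc J)
  show ?case
  proof (cases "x \<le> 2 ^ (J + 1) * t")
    case True
    then show ?thesis using Suc by (simp add: add_increasing2)
  next
    case False
    then have x: "x > 2 ^ (J + 1) * t" by simp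
    have "(1::real) \<le> 2 ^ (J + 1)" by (rule one_le_power) simp
    then have "t \<le> 2 ^ (J + 1) * t" using t by simp
    then have xt: "x > t" using x by linarith
    then have "pareto_tail \<theta> t x = (t / x) powr (\<theta> + 1)" by (simp add: pareto_tail_def)
    also have "\<dots> \<le> (1 / 2 ^ Suc J) powr (\<theta> + 1)"
      using x xt t \<theta> by (intro powr_mono2) (auto simp: field_simps)
    finally show ?thesis by (intro order_trans[OF _ add_increasing[OF sum_nonneg order_refl]]) auto
  qed
qed

context poisson_array
begin

text \<open>The layer \<open>j\<close> has weight 2^(-j(\<theta> + 1)) and probability at most (2^j
  * 3t)^\<theta>, hence contributes 2^(-j) (3t)^\<theta>. The one extra power of decay makes the
  series geometric with sum at most 2. The factor 3 absorbs \<open>d + 2 / n \<le> t\<close> into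
  \<open>2 ^ (j + 1) * t\<close>.\<close>

lemma pareto_tail_wsum:
  assumes a: "\<And>k. k \<in> {1..n} \<Longrightarrow> \<bar>a k - real k / n\<bar> \<le> d"
    and a_nonneg: "\<And>k. k \<in> {1..n} \<Longrightarrow> 0 \<le> a k" and t: "t \<ge> d + 2 / n"
  shows "expectation (\<lambda>\<omega>. pareto_tail \<theta> t (wsum a \<omega>)) \<le> 2 * (3 * t) powr \<theta>"
proof -
  have d: "d \<ge> 0" using a[of 1] n by force
  have "2 / real n > 0" using n by simp
  with d t have t0: "t > 0" by linarith
  have ind: "expectation (\<lambda>\<omega>. indicator {..s} (wsum a \<omega>)) = prob {\<omega> \<in> space M. wsum a \<omega> \<le> s}" for s
  proof -
    have "expectation (\<lambda>\<omega>. indicator {..s} (wsum a \<omega>)) = expectation (indicator {\<omega> \<in> space M. wsum a \<omega> \<le> s} :: 'a \<Rightarrow> real)"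
      by (intro Bochner_Integration.integral_cong) (auto simp: indicator_def)
    then show ?thesis by simp
  qed
  have iI: "integrable M (\<lambda>\<omega>. indicator {..s} (wsum a \<omega>) :: real)" for s
    by (rule integrable_const_bound[where B=1]) (auto simp: indicator_def)
  have bound: "expectation (\<lambda>\<omega>. pareto_tail \<theta> t (wsum a \<omega>)) \<le> 2 * (3 * t) powr \<theta> + (1 / 2) ^ J" for J
  proof -
    have "expectation (\<lambda>\<omega>. pareto_tail \<theta> t (wsum a \<omega>))
       \<le> expectation (\<lambda>\<omega>. (\<Sum>j<J. (1 / 2 ^ j) powr (\<theta> + 1) * indicator {..2 ^ (j + 1) * t} (wsum a \<omega>)) + (1 / 2 ^ J) powr (\<theta> + 1))"
    proof (rule integral_mono)
      show "integrable M (\<lambda>\<omega>. pareto_tail \<theta> t (wsum a \<omega>))"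
        using pareto_tail_nonneg pareto_tail_le_1[OF theta] t0
        by (intro integrable_const_bound[where B=1]) auto
      show "integrable M (\<lambda>\<omega>. (\<Sum>j<J. (1 / 2 ^ j) powr (\<theta> + 1) * indicator {..2 ^ (j + 1) * t} (wsum a \<omega>)) + (1 / 2 ^ J) powr (\<theta> + 1))"
        by (intro Bochner_Integration.integrable_add Bochner_Integration.integrable_sum integrable_mult_right iI) auto
    qed (rule pareto_tail_dyadic[OF theta t0])
    also have "\<dots> = (\<Sum>j<J. (1 / 2 ^ j) powr (\<theta> + 1) * prob {\<omega> \<in> space M. wsum a \<omega> \<le> 2 ^ (j + 1) * t}) + (1 / 2 ^ J) powr (\<theta> + 1)"
    proof -
      let ?g = "\<lambda>j \<omega>. (1 / 2 ^ j) powr (\<theta> + 1) * indicator {..2 ^ (j + 1) * t} (wsum a \<omega>)"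
      have "expectation (\<lambda>\<omega>. \<Sum>j<J. ?g j \<omega>) = (\<Sum>j<J. expectation (?g j))"
        by (rule Bochner_Integration.integral_sum) (intro integrable_mult_right iI)
      moreover have "expectation (?g j) = (1 / 2 ^ j) powr (\<theta> + 1) * prob {\<omega> \<in> space M. wsum a \<omega> \<le> 2 ^ (j + 1) * t}" for j
        by (simp only: integral_mult_right_zero ind)
      moreover have "integrable M (\<lambda>\<omega>. \<Sum>j<J. ?g j \<omega>)"
        by (intro Bochner_Integration.integrable_sum integrable_mult_right iI)
      ultimately show ?thesis
        by (subst Bochner_Integration.integral_add) (simp_all add: prob_space del: mult_indicator_subset sum.inter_filter)
    qed
    also have "\<dots> \<le> (\<Sum>j<J. (3 * t) powr \<theta> * (1 / 2) ^ j) + (1 / 2) ^ J"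
    proof (intro add_mono sum_mono)
      have p: "(1 / 2 ^ j) powr (\<theta> + 1) = (1 / 2 ^ j) powr \<theta> * (1 / 2) ^ j" for j :: nat
        by (simp add: powr_add power_one_over)
      fix j
      have "prob {\<omega> \<in> space M. wsum a \<omega> \<le> 2 ^ (j + 1) * t} \<le> (2 ^ (j + 1) * t + d + 2 / n) powr \<theta>"
        using t0 by (intro small_wsum_prob a a_nonneg) auto
      also have "\<dots> \<le> (2 ^ j * (3 * t)) powr \<theta>"
      proof (rule powr_mono2)
        have "t \<le> 2 ^ j * t" using t0 by simp
        then show "2 ^ (j + 1) * t + d + 2 / n \<le> 2 ^ j * (3 * t)" using t by (simp add: algebra_simps)
      qed (use theta d t0 in auto)
      finally have "(1 / 2 ^ j) powr (\<theta> + 1) * prob {\<omega> \<in> space M. wsum a \<omega> \<le> 2 ^ (j + 1) * t}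
        \<le> (1 / 2 ^ j) powr (\<theta> + 1) * (2 ^ j * (3 * t)) powr \<theta>"
        by (intro mult_left_mono) auto
      also have "\<dots> = ((1 / 2 ^ j) * (2 ^ j * (3 * t))) powr \<theta> * (1 / 2) ^ j"
      proof -
        have "((1 / 2 ^ j) * (2 ^ j * (3 * t))) powr \<theta> = (1 / 2 ^ j) powr \<theta> * (2 ^ j * (3 * t)) powr \<theta>"
          by (subst powr_mult) (use t0 in auto)
        then show ?thesis unfolding p by (simp only: ac_simps)
      qed
      also have "(1 / 2 ^ j) * (2 ^ j * (3 * t)) = 3 * t" by simp
      finally show "(1 / 2 ^ j) powr (\<theta> + 1) * prob {\<omega> \<in> space M. wsum a \<omega> \<le> 2 ^ (j + 1) * t}
        \<le> (3 * t) powr \<theta> * (1 / 2) ^ j" .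
      have "(1 / 2 ^ J) powr \<theta> \<le> 1" using theta by (intro powr_le1) auto
      then show "(1 / 2 ^ J) powr (\<theta> + 1) \<le> (1 / 2) ^ J" unfolding p by (simp add: mult_left_le_one_le)
    qed
    also have "(\<Sum>j<J. (3 * t) powr \<theta> * (1 / 2) ^ j) \<le> (3 * t) powr \<theta> * 2"
    proof -
      have "(\<Sum>j<J. (1 / 2 :: real) ^ j) = 2 - 2 * (1 / 2) ^ J" by (simp add: geometric_sum)
      then show ?thesis unfolding sum_distrib_left[symmetric] by (intro mult_left_mono) auto
    qed
    finally show ?thesis by (simp add: mult.commute)
  qed
  \<comment> \<open>The remainder beyond the last layer disappears as the number of layers
    grows.\<close>
  have "(\<lambda>J. 2 * (3 * t) powr \<theta> + (1 / 2) ^ J) \<longlonglongrightarrow> 2 * (3 * t) powr \<theta> + 0"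
    by (intro tendsto_intros LIMSEQ_realpow_zero) auto
  from LIMSEQ_le_const[OF this] bound show ?thesis by auto
qed

section \<open>From a Stein pair to a bound on its defect\<close>

text \<open>Size bias shifts the sum by \<open>a k\<close> with mass proportional to
  \<open>a k / k\<close>, whereas the Dickman law asks for a uniform shift, that is mass
  \<open>1 / n\<close> at each node. This is the l1 distance of the two.\<close>

definition weight_dev :: "(nat \<Rightarrow> real) \<Rightarrow> real" where
  "weight_dev a = (\<Sum>k=1..n. \<bar>a k / k - 1 / n\<bar>)"

text \<open>The envelope \<open>G\<close> dominates \<open>f\<close> everywhere to the right of its
  argument, so the shifts by \<open>a k \<ge> 0\<close> cost nothing. Lipschitz tests take
  \<open>G = 1\<close>; for indicators \<open>G\<close> retains the decay of \<open>f\<close>, which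
  a supremum bound would throw away.\<close>

lemma stein_defect_bound:
  assumes pair: "stein_pair \<theta> h f" and int: "integrable M (\<lambda>\<omega>. h (wsum a \<omega>))"
    and a_nonneg: "\<And>k. k \<in> {1..n} \<Longrightarrow> 0 \<le> a k"
    and G: "integrable M (\<lambda>\<omega>. G (wsum a \<omega>))"
    and fG: "\<And>x y. 0 \<le> x \<Longrightarrow> x \<le> y \<Longrightarrow> \<bar>f y\<bar> \<le> G x"
    and disc: "\<And>x. 0 \<le> x \<Longrightarrow> \<bar>1 / n * (\<Sum>k=1..n. f (x + a k)) - (\<integral>u. f (x + u) \<partial>unif01)\<bar> \<le> G x * e"
  shows "\<bar>expectation (\<lambda>\<omega>. h (wsum a \<omega>)) - expectation (\<lambda>\<omega>. dickman_step \<theta> h (wsum a \<omega>))\<bar>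
      \<le> \<theta> * (weight_dev a + e) * expectation (\<lambda>\<omega>. G (wsum a \<omega>))"
proof -
  obtain B where B: "\<And>x. \<bar>f x\<bar> \<le> B" and f[measurable]: "f \<in> borel_measurable borel"
    and h[measurable]: "h \<in> borel_measurable borel"
    and e1: "\<And>x. x \<ge> 0 \<Longrightarrow> h x = dickman_avg \<theta> h x + x * f x"
    and e2: "\<And>x. x \<ge> 0 \<Longrightarrow> dickman_step \<theta> h x - dickman_avg \<theta> h x = \<theta> * (\<integral>u. f (x + u) \<partial>unif01)"
    using pair unfolding stein_pair_def by blast
  let ?T = "wsum a"
  have T: "?T \<omega> \<ge> 0" for \<omega> using a_nonneg by (rule wsum_nonneg)
  define I where "I x = (\<integral>u. f (x + u) \<partial>unif01)" for x
  have [measurable]: "I \<in> borel_measurable borel" unfolding I_def by measurable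
  have IB: "\<bar>I x\<bar> \<le> B" for x
  proof -
    have "\<bar>I x\<bar> \<le> (\<integral>u. \<bar>f (x + u)\<bar> \<partial>unif01)" unfolding I_def by (rule integral_abs_bound)
    also have "\<dots> \<le> (\<integral>u. B \<partial>unif01)"
      using B by (intro integral_unif01_mono integrable_unif01_bounded[where B="\<bar>B\<bar>"])
        (auto intro: order_trans[OF _ abs_ge_self])
    finally show ?thesis by simp
  qed
  have intI: "integrable M (\<lambda>\<omega>. I (?T \<omega>))"
    using IB by (intro integrable_const_bound[where B=B]) auto
  have intf: "integrable M (\<lambda>\<omega>. f (?T \<omega> + c))" for c
    using B by (intro integrable_const_bound[where B=B]) auto
  note sb = wsum_size_bias[of f B a, OF f B]
  have "expectation (\<lambda>\<omega>. h (?T \<omega>)) - expectation (\<lambda>\<omega>. dickman_step \<theta> h (?T \<omega>))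
    = expectation (\<lambda>\<omega>. ?T \<omega> * f (?T \<omega>) - \<theta> * I (?T \<omega>))"
  proof -
    \<comment> \<open>Combining the two identities of a Stein pair eliminates the unshifted
      average.\<close>
    have eq: "dickman_step \<theta> h (?T \<omega>) = h (?T \<omega>) - (?T \<omega> * f (?T \<omega>) - \<theta> * I (?T \<omega>))" for \<omega>
      using e1[OF T[of \<omega>]] e2[OF T[of \<omega>]] by (simp add: I_def)
    show ?thesis unfolding eq using int sb(2) intI by simp
  qed
  also have "\<dots> = (\<Sum>k=1..n. \<theta> / real k * a k * expectation (\<lambda>\<omega>. f (?T \<omega> + a k))) - expectation (\<lambda>\<omega>. \<theta> * I (?T \<omega>))"
    using sb intI by simp
  also have "\<dots> = expectation (\<lambda>\<omega>. (\<Sum>k=1..n. \<theta> / real k * a k * f (?T \<omega> + a k)) - \<theta> * I (?T \<omega>))"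
    using intf intI by (simp add: Bochner_Integration.integral_sum)
  finally have eq: "expectation (\<lambda>\<omega>. h (?T \<omega>)) - expectation (\<lambda>\<omega>. dickman_step \<theta> h (?T \<omega>))
    = expectation (\<lambda>\<omega>. (\<Sum>k=1..n. \<theta> / real k * a k * f (?T \<omega> + a k)) - \<theta> * I (?T \<omega>))" .
  have "\<bar>expectation (\<lambda>\<omega>. (\<Sum>k=1..n. \<theta> / real k * a k * f (?T \<omega> + a k)) - \<theta> * I (?T \<omega>))\<bar>
    \<le> expectation (\<lambda>\<omega>. \<bar>(\<Sum>k=1..n. \<theta> / real k * a k * f (?T \<omega> + a k)) - \<theta> * I (?T \<omega>)\<bar>)"
    by (rule integral_abs_bound)
  also have "\<dots> \<le> expectation (\<lambda>\<omega>. \<theta> * (weight_dev a + e) * G (?T \<omega>))"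
  proof (rule integral_mono)
    show "integrable M (\<lambda>\<omega>. \<bar>(\<Sum>k=1..n. \<theta> / real k * a k * f (?T \<omega> + a k)) - \<theta> * I (?T \<omega>)\<bar>)"
      using intf intI by (intro integrable_abs Bochner_Integration.integrable_diff
        Bochner_Integration.integrable_sum integrable_mult_right) auto
    show "integrable M (\<lambda>\<omega>. \<theta> * (weight_dev a + e) * G (?T \<omega>))" using G by simp
    fix \<omega>
    let ?x = "?T \<omega>"
    \<comment> \<open>Writing \<open>a k / k\<close> as \<open>(a k / k - 1 / n) + 1 / n\<close>
      separates wrong masses from wrong nodes; the second part is a pure quadrature error.\<close>
    have "(\<Sum>k=1..n. \<theta> / real k * a k * f (?x + a k)) - \<theta> * I ?x
      = \<theta> * ((\<Sum>k=1..n. (a k / k - 1 / n) * f (?x + a k)) + (1 / n * (\<Sum>k=1..n. f (?x + a k)) - I ?x))"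
      by (simp add: algebra_simps sum_subtractf sum_distrib_left sum_divide_distrib)
    also have "\<bar>\<dots>\<bar> \<le> \<theta> * (weight_dev a * G ?x + G ?x * e)"
    proof -
      have "\<bar>\<Sum>k=1..n. (a k / k - 1 / n) * f (?x + a k)\<bar> \<le> (\<Sum>k=1..n. \<bar>(a k / k - 1 / n) * f (?x + a k)\<bar>)"
        by (rule sum_abs)
      also have "\<dots> \<le> (\<Sum>k=1..n. \<bar>a k / k - 1 / n\<bar> * G ?x)"
        unfolding abs_mult using T a_nonneg by (intro sum_mono mult_left_mono fG) auto
      also have "\<dots> = weight_dev a * G ?x" by (simp add: weight_dev_def sum_distrib_right)
      finally have 1: "\<bar>\<Sum>k=1..n. (a k / k - 1 / n) * f (?x + a k)\<bar> \<le> weight_dev a * G ?x" .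
      have "\<bar>1 / n * (\<Sum>k=1..n. f (?x + a k)) - I ?x\<bar> \<le> G ?x * e" unfolding I_def by (rule disc[OF T])
      with 1 show ?thesis using theta unfolding abs_mult
        by (intro mult_mono) (auto simp: abs_le_iff)
    qed
    finally show "\<bar>(\<Sum>k=1..n. \<theta> / real k * a k * f (?x + a k)) - \<theta> * I ?x\<bar> \<le> \<theta> * (weight_dev a + e) * G ?x"
      by (simp add: algebra_simps)
  qed
  also have "\<dots> = \<theta> * (weight_dev a + e) * expectation (\<lambda>\<omega>. G (wsum a \<omega>))" by simp
  finally show ?thesis unfolding eq .
qed

end

section \<open>Indicators, hinges and smooth functions as tests\<close>

lemma dickman_avg_atMost:
  assumes \<theta>: "\<theta> > 0" and t: "t \<ge> 0" and x: "x \<ge> 0"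
  shows "dickman_avg \<theta> (indicator {..t}) x = (if x \<le> t then 1 else (t / x) powr \<theta>)"
proof (cases "x \<le> t")
  case True
  have "dickman_avg \<theta> (indicator {..t}) x = (\<integral>u. 1 \<partial>unif01)"
    unfolding dickman_avg_def
  proof (rule integral_unif01_cong)
    fix u :: real assume "0 < u" "u < 1"
    then have "u powr (1 / \<theta>) * x \<le> 1 * x"
      using powr_inverse_bounds[OF \<theta>, of u] x by (intro mult_right_mono) auto
    then show "indicator {..t} (u powr (1 / \<theta>) * x) = (1::real)" using True by simp
  qed measurable
  then show ?thesis using True by simp
next
  case False
  let ?c = "(t / x) powr \<theta>"
  have "dickman_avg \<theta> (indicator {..t}) x = (\<integral>u. indicator {..?c} u \<partial>unif01)"
    unfolding dickman_avg_def
  proof (rule integral_unif01_cong)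
    fix u :: real assume u: "0 < u" "u < 1"
    have "u powr (1 / \<theta>) * x \<le> t \<longleftrightarrow> u powr (1 / \<theta>) \<le> t / x"
      using False t by (simp add: field_simps)
    also have "\<dots> \<longleftrightarrow> u \<le> ?c"
    proof
      assume "u powr (1 / \<theta>) \<le> t / x"
      then have "(u powr (1 / \<theta>)) powr \<theta> \<le> ?c" using \<theta> by (intro powr_mono2) auto
      then show "u \<le> ?c" using u \<theta> by (simp add: powr_powr)
    next
      assume "u \<le> ?c"
      then have "u powr (1 / \<theta>) \<le> ?c powr (1 / \<theta>)" using u \<theta> by (intro powr_mono2) auto
      then show "u powr (1 / \<theta>) \<le> t / x" using t False \<theta> by (simp add: powr_powr)
    qed
    finally show "indicator {..t} (u powr (1 / \<theta>) * x) = (indicator {..?c} u :: real)"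
      by (simp add: indicator_def)
  qed measurable
  also have "\<dots> = measure unif01 {..?c}" by simp
  also have "\<dots> = ?c" using \<theta> t False by (intro measure_unif01_atMost) (auto intro!: powr_le1)
  finally show ?thesis using False by simp
qed

text \<open>Here \<open>f\<close> is 0 up to \<open>t\<close> and minus the Pareto tail over
  \<open>t\<close> beyond. It is written as a difference of two decreasing functions because its
  jump at \<open>t\<close> rules out a Lipschitz estimate.\<close>

lemma stein_pair_atMost:
  assumes \<theta>: "\<theta> > 0" and t: "t > 0"
  shows "stein_pair \<theta> (indicator {..t}) (\<lambda>x. 1 / t * (indicator {..t} x - pareto_tail \<theta> t x))"
proof -
  let ?f = "\<lambda>x. 1 / t * (indicator {..t} x - pareto_tail \<theta> t x)"
  \<comment> \<open>The maximum merges both branches of the average into one visibly continuous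
    formula, differentiable away from \<open>t\<close>.\<close>
  define H where "H y = (t / max y t) powr \<theta>" for y
  have H: "dickman_avg \<theta> (indicator {..t}) y = H y" if "y \<ge> 0" for y
    using dickman_avg_atMost[OF \<theta> _ that, of t] t by (auto simp: H_def max_def)
  have fB: "\<bar>?f y\<bar> \<le> 1 / t" for y
  proof -
    have "\<bar>indicator {..t} y - pareto_tail \<theta> t y\<bar> \<le> 1"
      using pareto_tail_nonneg[of \<theta> t y] pareto_tail_le_1[OF \<theta>, of t y] t by (auto simp: indicator_def abs_le_iff)
    then show ?thesis using t by (simp add: abs_mult divide_right_mono)
  qed
  have e1: "indicator {..t} x = dickman_avg \<theta> (indicator {..t}) x + x * ?f x" if x: "x \<ge> 0" for x
  proof (cases "x \<le> t")
    case True
    then show ?thesis using t by (simp add: H[OF x] H_def pareto_tail_def max_def)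
  next
    case False
    then have "x * ((t / x) powr (\<theta> + 1) / t) = (t / x) powr \<theta>"
      using t by (simp add: powr_add)
    then show ?thesis using t False by (simp add: H[OF x] H_def pareto_tail_def max_def)
  qed
  have e2: "dickman_avg \<theta> (indicator {..t}) (x + 1) - dickman_avg \<theta> (indicator {..t}) x = \<theta> * (\<integral>u. ?f (x + u) \<partial>unif01)"
    if x: "x \<ge> 0" for x
  proof -
    have dH: "(H has_real_derivative \<theta> * ?f y) (at y)" if y: "y > 0" "y \<noteq> t" for y
    proof (cases "y < t")
      case True
      have "((\<lambda>_. 1) has_real_derivative \<theta> * ?f y) (at y)"
        using True by (auto simp: pareto_tail_def)
      then show ?thesis
        by (rule has_field_derivative_transform_within_open[where S="{..<t}"]) (use True t in \<open>auto simp: H_def max_def\<close>)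
    next
      case False
      with y have ty: "y > t" by simp
      have "((\<lambda>y. (t / y) powr \<theta>) has_real_derivative \<theta> * ?f y) (at y)"
        using ty t y \<theta>
        by (auto intro!: derivative_eq_intros simp: pareto_tail_def powr_add powr_diff divide_simps power2_eq_square)
      then show ?thesis
        by (rule has_field_derivative_transform_within_open[where S="{t<..}"]) (use ty t in \<open>auto simp: H_def max_def\<close>)
    qed
    have "(\<integral>u. \<theta> * ?f (x + u) \<partial>unif01) = (\<lambda>u. H (x + u)) 1 - (\<lambda>u. H (x + u)) 0"
    proof (rule integral_unif01_FTC[where B="\<theta> / t" and S="{t - x}"])
      fix u :: real assume u: "0 < u" "u < 1"
      show "\<bar>\<theta> * ?f (x + u)\<bar> \<le> \<theta> / t"
        using mult_left_mono[OF fB[of "x + u"], of \<theta>] \<theta> by (simp add: abs_mult)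
      assume "u \<notin> {t - x}"
      then have "(H has_real_derivative \<theta> * ?f (x + u)) (at (x + u))" using u x by (intro dH) auto
      then show "((\<lambda>u. H (x + u)) has_real_derivative \<theta> * ?f (x + u)) (at u)"
        by (simp add: DERIV_shift add.commute)
    next
      have "max (x + u) t \<noteq> 0" for u using t by (simp add: max_def)
      moreover have "t / max (x + u) t > 0" for u using t by (auto simp: max_def)
      ultimately show "continuous_on {0..1} (\<lambda>u. H (x + u))"
        unfolding H_def by (intro continuous_intros continuous_on_powr) (auto simp: less_imp_neq[symmetric])
    qed auto
    then show ?thesis using x by (simp add: H)
  qed
  show ?thesis
    unfolding stein_pair_def using fB e1 e2 by (intro conjI exI[of _ "1 / t"]) auto
qed

text \<open>Homogeneous of degree one in \<open>s\<close> and \<open>x\<close> jointly; this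
  homogeneity is the source of the contraction factor.\<close>

definition hinge :: "real \<Rightarrow> real \<Rightarrow> real" where
  "hinge s x = max 0 (s - x)"

lemma hinge_measurable [measurable]: "hinge s \<in> borel_measurable borel"
  unfolding hinge_def[abs_def] by measurable

text \<open>The mean of \<open>u powr (1 / \<theta>)\<close> is
  \<open>\<theta> / (\<theta> + 1)\<close>, so the prefactor \<open>1 / \<theta>\<close> still
  leaves \<open>K / (\<theta> + 1)\<close>.\<close>

lemma abs_integral_powr_le:
  assumes \<theta>: "\<theta> > 0" and [measurable]: "g \<in> borel_measurable borel"
    and g: "\<And>u. 0 < u \<Longrightarrow> u < 1 \<Longrightarrow> \<bar>g u\<bar> \<le> K"
  shows "\<bar>1 / \<theta> * (\<integral>u. u powr (1 / \<theta>) * g u \<partial>unif01)\<bar> \<le> K"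
    and "integrable unif01 (\<lambda>u. u powr (1 / \<theta>) * g u)"
proof -
  have "\<bar>g (1/2)\<bar> \<le> K" by (rule g) auto
  then have K: "K \<ge> 0" by linarith
  have b: "\<bar>u powr (1 / \<theta>) * g u\<bar> \<le> u powr (1 / \<theta>) * K" "u powr (1 / \<theta>) * K \<le> K" if u: "0 < u" "u < 1" for u
    using powr_inverse_bounds[OF \<theta> u] g[OF u] K by (auto simp: abs_mult mult_left_le_one_le intro!: mult_left_mono)
  show i: "integrable unif01 (\<lambda>u. u powr (1 / \<theta>) * g u)"
    by (rule integrable_unif01_bounded[where B=K]) (use b in \<open>auto intro: order_trans\<close>)
  have "\<bar>\<integral>u. u powr (1 / \<theta>) * g u \<partial>unif01\<bar> \<le> (\<integral>u. \<bar>u powr (1 / \<theta>) * g u\<bar> \<partial>unif01)"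
    by (rule integral_abs_bound)
  also have "\<dots> \<le> (\<integral>u. u powr (1 / \<theta>) * K \<partial>unif01)"
  proof (rule integral_unif01_mono)
    show "integrable unif01 (\<lambda>u. u powr (1 / \<theta>) * K)"
      by (rule integrable_unif01_bounded[where B=K]) (use b(2) K in \<open>auto simp: abs_mult\<close>)
  qed (use i b in auto)
  also have "\<dots> = \<theta> / (\<theta> + 1) * K" by (simp add: integral_unif01_powr[OF \<theta>])
  finally have "\<bar>1 / \<theta> * (\<integral>u. u powr (1 / \<theta>) * g u \<partial>unif01)\<bar> \<le> 1 / \<theta> * (\<theta> / (\<theta> + 1) * K)"
    unfolding abs_mult using \<theta> by (intro mult_mono) auto
  also have "\<dots> = K / (\<theta> + 1)" using \<theta> by simp
  also have "\<dots> \<le> K" using \<theta> K by (simp add: divide_le_eq mult_left_mono_neg algebra_simps)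
  finally show "\<bar>1 / \<theta> * (\<integral>u. u powr (1 / \<theta>) * g u \<partial>unif01)\<bar> \<le> K" .
qed

text \<open>The derivative is an argument of its own, so that stability under the averaging step can
  be shown by exhibiting the new derivative.\<close>

definition smooth_test :: "(real \<Rightarrow> real) \<Rightarrow> (real \<Rightarrow> real) \<Rightarrow> bool" where
  "smooth_test h h' \<longleftrightarrow> (\<forall>x. (h has_real_derivative h' x) (at x)) \<and> (\<forall>x. \<bar>h' x\<bar> \<le> 1) \<and>
     (\<forall>x y. \<bar>h' x - h' y\<bar> \<le> \<bar>x - y\<bar>)"

lemma smooth_test_continuous:
  assumes "smooth_test h h'"
  shows "continuous_on UNIV h" "continuous_on UNIV h'"
    "h \<in> borel_measurable borel" "h' \<in> borel_measurable borel"
    "\<bar>h x - h y\<bar> \<le> \<bar>x - y\<bar>"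
proof -
  show c: "continuous_on UNIV h"
    using assms by (auto simp: smooth_test_def intro!: continuous_at_imp_continuous_on DERIV_isCont)
  have "1-lipschitz_on UNIV h'"
    using assms by (intro lipschitz_onI) (auto simp: smooth_test_def dist_real_def)
  then show c': "continuous_on UNIV h'" by (rule lipschitz_on_continuous_on)
  show "h \<in> borel_measurable borel" "h' \<in> borel_measurable borel"
    using c c' by (simp_all add: borel_measurable_continuous_onI)
  have "norm (h x - h y) \<le> 1 * norm (x - y)"
    using assms by (intro field_differentiable_bound[where S=UNIV and f'=h'])
      (auto simp: smooth_test_def)
  then show "\<bar>h x - h y\<bar> \<le> \<bar>x - y\<bar>" by simp
qed

section \<open>Defects of the three kinds of tests, for fixed weights\<close>

context poisson_array
begin

text \<open>Both decreasing parts of \<open>f\<close> have a quadrature error proportional to their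
  value at the left end, and the Pareto tail bounds both values. Two such errors explain the factor
  2 before \<open>d + 1 / n\<close>.\<close>

lemma defect_atMost_raw:
  assumes a: "\<And>k. k \<in> {1..n} \<Longrightarrow> \<bar>a k - real k / n\<bar> \<le> d"
    and a_nonneg: "\<And>k. k \<in> {1..n} \<Longrightarrow> 0 \<le> a k" and t: "t > 0"
  shows "\<bar>expectation (\<lambda>\<omega>. indicator {..t} (wsum a \<omega>)) - expectation (\<lambda>\<omega>. dickman_step \<theta> (indicator {..t}) (wsum a \<omega>))\<bar>
    \<le> \<theta> * (weight_dev a + 2 * (d + 1 / n)) * (1 / t * expectation (\<lambda>\<omega>. pareto_tail \<theta> t (wsum a \<omega>)))"
proof -
  let ?f = "\<lambda>x. 1 / t * (indicator {..t} x - pareto_tail \<theta> t x)"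
  let ?G = "\<lambda>x. 1 / t * pareto_tail \<theta> t x"
  have "\<bar>expectation (\<lambda>\<omega>. indicator {..t} (wsum a \<omega>)) - expectation (\<lambda>\<omega>. dickman_step \<theta> (indicator {..t}) (wsum a \<omega>))\<bar>
    \<le> \<theta> * (weight_dev a + 2 * (d + 1 / n)) * expectation (\<lambda>\<omega>. ?G (wsum a \<omega>))"
  proof (rule stein_defect_bound[OF stein_pair_atMost[OF theta t] _ a_nonneg])
    show "integrable M (\<lambda>\<omega>. indicator {..t} (wsum a \<omega>) :: real)"
      by (rule integrable_const_bound[where B=1]) (auto simp: indicator_def)
    show "integrable M (\<lambda>\<omega>. ?G (wsum a \<omega>))"
      using pareto_tail_nonneg pareto_tail_le_1[OF theta] t
      by (intro integrable_mult_right integrable_const_bound[where B=1]) auto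
    fix x :: real assume x: "0 \<le> x"
    show "\<bar>?f y\<bar> \<le> ?G x" if "x \<le> y" for y
    proof -
      have "\<bar>indicator {..t} y - pareto_tail \<theta> t y\<bar> \<le> pareto_tail \<theta> t y"
        by (auto simp: pareto_tail_def)
      also have "\<dots> \<le> pareto_tail \<theta> t x" using theta t that by (intro pareto_tail_antimono) auto
      finally show ?thesis using t by (simp add: abs_mult divide_right_mono)
    qed
    have d1: "\<bar>1 / real n * (\<Sum>k=1..n. pareto_tail \<theta> t (x + a k)) - (\<integral>u. pareto_tail \<theta> t (x + u) \<partial>unif01)\<bar>
       \<le> pareto_tail \<theta> t (x + 0) * (d + 1 / n)"
      using theta t by (intro discrepancy_antimono n a a_nonneg pareto_tail_nonneg pareto_tail_antimono) auto
    have d2: "\<bar>1 / real n * (\<Sum>k=1..n. indicator {..t} (x + a k)) - (\<integral>u. indicator {..t} (x + u) \<partial>unif01)\<bar>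
       \<le> indicator {..t} (x + 0) * (d + 1 / n)"
      by (intro discrepancy_antimono n a a_nonneg) (auto simp: indicator_def)
    have d: "0 \<le> d" using a[of 1] n by force
    have "indicator {..t} x * (d + 1 / n) \<le> pareto_tail \<theta> t x * (d + 1 / n)"
      using d by (intro mult_right_mono) (auto simp: pareto_tail_def)
    then have d3: "\<bar>(1 / real n * (\<Sum>k=1..n. indicator {..t} (x + a k)) - (\<integral>u. indicator {..t} (x + u) \<partial>unif01))
        - (1 / real n * (\<Sum>k=1..n. pareto_tail \<theta> t (x + a k)) - (\<integral>u. pareto_tail \<theta> t (x + u) \<partial>unif01))\<bar>
      \<le> pareto_tail \<theta> t x * (d + 1 / n) + pareto_tail \<theta> t x * (d + 1 / n)"
      using d1 d2 unfolding add_0_right by linarith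
    have i1: "integrable unif01 (\<lambda>u. pareto_tail \<theta> t (x + u))" "integrable unif01 (\<lambda>u. indicator {..t} (x + u) :: real)"
      using pareto_tail_nonneg pareto_tail_le_1[OF theta] t
      by (auto intro!: integrable_unif01_bounded[where B=1] simp: indicator_def)
    have "1 / n * (\<Sum>k=1..n. ?f (x + a k)) - (\<integral>u. ?f (x + u) \<partial>unif01)
      = 1 / t * ((1 / real n * (\<Sum>k=1..n. indicator {..t} (x + a k)) - (\<integral>u. indicator {..t} (x + u) \<partial>unif01))
        - (1 / real n * (\<Sum>k=1..n. pareto_tail \<theta> t (x + a k)) - (\<integral>u. pareto_tail \<theta> t (x + u) \<partial>unif01)))"
      unfolding integral_mult_right_zero Bochner_Integration.integral_diff[OF i1(2,1)]
      by (simp only: sum_distrib_left[symmetric] sum_subtractf) (simp add: algebra_simps)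
    also have "\<bar>\<dots>\<bar> \<le> 1 / t * (pareto_tail \<theta> t x * (d + 1 / n) + pareto_tail \<theta> t x * (d + 1 / n))"
      unfolding abs_mult using t d3 by (intro mult_mono) auto
    finally show "\<bar>1 / n * (\<Sum>k=1..n. ?f (x + a k)) - (\<integral>u. ?f (x + u) \<partial>unif01)\<bar> \<le> ?G x * (2 * (d + 1 / n))"
      by (simp add: algebra_simps)
  qed
  then show ?thesis by simp
qed

text \<open>The function \<open>f\<close> of a hinge is Lipschitz only with a constant of order
  \<open>1 / s\<close>, which is useless uniformly in \<open>s\<close>. Its derivative
  \<open>h'\<close> is increasing and nonpositive, however, so \<open>- f\<close> is nonnegative and
  decreasing and the monotone quadrature bound applies.\<close>

lemma defect_hinge:
  assumes a: "\<And>k. k \<in> {1..n} \<Longrightarrow> \<bar>a k - real k / n\<bar> \<le> d"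
    and a_nonneg: "\<And>k. k \<in> {1..n} \<Longrightarrow> 0 \<le> a k"
  shows "\<bar>expectation (\<lambda>\<omega>. hinge s (wsum a \<omega>)) - expectation (\<lambda>\<omega>. dickman_step \<theta> (hinge s) (wsum a \<omega>))\<bar>
    \<le> \<theta> * (weight_dev a + (d + 1 / n))"
proof -
  define h' :: "real \<Rightarrow> real" where "h' x = - indicator {..s} x" for x
  have [measurable]: "h' \<in> borel_measurable borel" unfolding h'_def[abs_def] by measurable
  let ?f = "\<lambda>x. 1 / \<theta> * (\<integral>u. u powr (1 / \<theta>) * h' (u powr (1 / \<theta>) * x) \<partial>unif01)"
  have fm: "?f \<in> borel_measurable borel" by measurable
  have d: "0 \<le> d" using a[of 1] n by force
  have pair: "stein_pair \<theta> (hinge s) ?f"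
  proof (rule stein_pair_lipschitz[OF theta, where S="{s}"])
    show "continuous_on UNIV (hinge s)" unfolding hinge_def[abs_def] by (intro continuous_intros)
    fix x assume "x \<notin> {s}"
    then consider "x < s" | "x > s" by force
    then show "(hinge s has_real_derivative h' x) (at x)"
    proof cases
      case 1
      have "((\<lambda>x. s - x) has_real_derivative h' x) (at x)"
        using 1 by (auto intro!: derivative_eq_intros simp: h'_def)
      then show ?thesis
        by (rule has_field_derivative_transform_within_open[where S="{..<s}"]) (use 1 in \<open>auto simp: hinge_def\<close>)
    next
      case 2
      have "((\<lambda>x. 0) has_real_derivative h' x) (at x)" using 2 by (auto simp: h'_def)
      then show ?thesis
        by (rule has_field_derivative_transform_within_open[where S="{s<..}"]) (use 2 in \<open>auto simp: hinge_def\<close>)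
    qed
  qed (auto simp: h'_def indicator_def)
  have f1: "\<bar>?f y\<bar> \<le> 1" for y
    by (rule abs_integral_powr_le(1)[OF theta]) (auto simp: h'_def indicator_def)
  have fi: "integrable unif01 (\<lambda>u. u powr (1 / \<theta>) * h' (u powr (1 / \<theta>) * y))" for y
    by (rule abs_integral_powr_le(2)[OF theta, where K=1]) (auto simp: h'_def indicator_def)
  have disc: "\<bar>1 / real n * (\<Sum>k=1..n. ?f (x + a k)) - (\<integral>w. ?f (x + w) \<partial>unif01)\<bar> \<le> 1 * (d + 1 / n)"
    if x: "x \<ge> 0" for x
  proof -
    have "\<bar>1 / real n * (\<Sum>k=1..n. - ?f (x + a k)) - (\<integral>w. - ?f (x + w) \<partial>unif01)\<bar> \<le> - ?f (x + 0) * (d + 1 / n)"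
    proof (rule discrepancy_antimono[OF n a a_nonneg])
      show "(\<lambda>w. - ?f (x + w)) \<in> borel_measurable borel" using fm by measurable
      show "0 \<le> - ?f (x + w)" for w
      proof -
        have "(\<integral>u. u powr (1 / \<theta>) * h' (u powr (1 / \<theta>) * (x + w)) \<partial>unif01) \<le> (\<integral>u. 0 \<partial>unif01)"
          by (rule integral_unif01_mono[OF fi]) (auto simp: h'_def)
        then show ?thesis using theta by (simp add: divide_nonpos_pos)
      qed
      show "- ?f (x + w') \<le> - ?f (x + w)" if "0 \<le> w" "w \<le> w'" for w w'
      proof -
        have "(\<integral>u. u powr (1 / \<theta>) * h' (u powr (1 / \<theta>) * (x + w)) \<partial>unif01)
          \<le> (\<integral>u. u powr (1 / \<theta>) * h' (u powr (1 / \<theta>) * (x + w')) \<partial>unif01)"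
        proof (rule integral_unif01_mono[OF fi fi])
          fix u :: real assume u: "0 < u" "u < 1"
          have "u powr (1 / \<theta>) * (x + w) \<le> u powr (1 / \<theta>) * (x + w')"
            using that by (intro mult_left_mono) auto
          then have "h' (u powr (1 / \<theta>) * (x + w)) \<le> h' (u powr (1 / \<theta>) * (x + w'))"
            by (auto simp: h'_def indicator_def)
          then show "u powr (1 / \<theta>) * h' (u powr (1 / \<theta>) * (x + w)) \<le> u powr (1 / \<theta>) * h' (u powr (1 / \<theta>) * (x + w'))"
            by (intro mult_left_mono) auto
        qed
        then show ?thesis using theta by (simp add: divide_right_mono)
      qed
    qed
    also have "\<dots> \<le> 1 * (d + 1 / n)" using abs_le_D2[OF f1[of "x + 0"]] d by (intro mult_right_mono) auto
    finally show ?thesis by (simp only: sum_negf Bochner_Integration.integral_minus)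
  qed
  have "\<bar>expectation (\<lambda>\<omega>. hinge s (wsum a \<omega>)) - expectation (\<lambda>\<omega>. dickman_step \<theta> (hinge s) (wsum a \<omega>))\<bar>
    \<le> \<theta> * (weight_dev a + (d + 1 / n)) * expectation (\<lambda>\<omega>. 1)"
  proof (rule stein_defect_bound[OF pair _ a_nonneg _ f1 disc])
    show "integrable M (\<lambda>\<omega>. hinge s (wsum a \<omega>))"
    proof (rule integrable_const_bound[where B="\<bar>s\<bar>"])
      show "AE \<omega> in M. norm (hinge s (wsum a \<omega>)) \<le> \<bar>s\<bar>"
      proof (rule AE_I2)
        fix \<omega>
        have "0 \<le> wsum a \<omega>" using a_nonneg by (rule wsum_nonneg)
        then show "norm (hinge s (wsum a \<omega>)) \<le> \<bar>s\<bar>" by (auto simp: hinge_def)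
      qed
    qed measurable
  qed auto
  then show ?thesis by (simp add: prob_space)
qed

lemma defect_smooth:
  assumes a: "\<And>k. k \<in> {1..n} \<Longrightarrow> \<bar>a k - real k / n\<bar> \<le> d"
    and a_nonneg: "\<And>k. k \<in> {1..n} \<Longrightarrow> 0 \<le> a k" and h: "smooth_test h h'"
  shows "\<bar>expectation (\<lambda>\<omega>. h (wsum a \<omega>)) - expectation (\<lambda>\<omega>. dickman_step \<theta> h (wsum a \<omega>))\<bar>
    \<le> \<theta> * (weight_dev a + (d + 1 / n))"
proof -
  note hc = smooth_test_continuous[OF h]
  note [measurable] = hc(3,4)
  let ?f = "\<lambda>x. 1 / \<theta> * (\<integral>u. u powr (1 / \<theta>) * h' (u powr (1 / \<theta>) * x) \<partial>unif01)"
  have fm: "?f \<in> borel_measurable borel" by measurable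
  have h1: "\<bar>h' x\<bar> \<le> 1" "\<bar>h' x - h' y\<bar> \<le> \<bar>x - y\<bar>" for x y using h by (auto simp: smooth_test_def)
  have pair: "stein_pair \<theta> h ?f"
    using h hc by (intro stein_pair_lipschitz[OF theta, where S="{}"]) (auto simp: smooth_test_def)
  have f1: "\<bar>?f y\<bar> \<le> 1" for y
    by (rule abs_integral_powr_le(1)[OF theta]) (use h1 in auto)
  have fi: "integrable unif01 (\<lambda>u. u powr (1 / \<theta>) * h' (u powr (1 / \<theta>) * y))" for y
    by (rule abs_integral_powr_le(2)[OF theta, where K=1]) (use h1 in auto)
  have fl: "\<bar>?f y - ?f z\<bar> \<le> 1 * \<bar>y - z\<bar>" for y z
  proof -
    have "?f y - ?f z = 1 / \<theta> * (\<integral>u. u powr (1 / \<theta>) * (h' (u powr (1 / \<theta>) * y) - h' (u powr (1 / \<theta>) * z)) \<partial>unif01)"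
      unfolding right_diff_distrib using fi by (simp add: diff_divide_distrib)
    also have "\<bar>\<dots>\<bar> \<le> \<bar>y - z\<bar>"
    proof (rule abs_integral_powr_le(1)[OF theta])
      fix u :: real assume u: "0 < u" "u < 1"
      have "\<bar>h' (u powr (1 / \<theta>) * y) - h' (u powr (1 / \<theta>) * z)\<bar> \<le> \<bar>u powr (1 / \<theta>) * (y - z)\<bar>"
        using h1(2) by (simp add: right_diff_distrib)
      also have "\<dots> \<le> \<bar>y - z\<bar>"
        using powr_inverse_bounds[OF theta u] by (simp add: abs_mult mult_left_le_one_le)
      finally show "\<bar>h' (u powr (1 / \<theta>) * y) - h' (u powr (1 / \<theta>) * z)\<bar> \<le> \<bar>y - z\<bar>" .
    qed measurable
    finally show ?thesis by simp
  qed
  have disc: "\<bar>1 / real n * (\<Sum>k=1..n. ?f (x + a k)) - (\<integral>w. ?f (x + w) \<partial>unif01)\<bar> \<le> 1 * (d + 1 / n)" for x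
  proof (rule discrepancy_lipschitz[OF n a a_nonneg])
    show "(\<lambda>w. ?f (x + w)) \<in> borel_measurable borel" using fm by measurable
    show "\<bar>?f (x + y) - ?f (x + z)\<bar> \<le> 1 * \<bar>y - z\<bar>" for y z using fl[of "x + y" "x + z"] by simp
  qed (use f1 in auto)
  have "\<bar>expectation (\<lambda>\<omega>. h (wsum a \<omega>)) - expectation (\<lambda>\<omega>. dickman_step \<theta> h (wsum a \<omega>))\<bar>
    \<le> \<theta> * (weight_dev a + (d + 1 / n)) * expectation (\<lambda>\<omega>. 1)"
  proof (rule stein_defect_bound[OF pair _ a_nonneg _ f1 disc])
    show "integrable M (\<lambda>\<omega>. h (wsum a \<omega>))"
    proof (rule Bochner_Integration.integrable_bound[where f="\<lambda>\<omega>. \<bar>h 0\<bar> + \<bar>wsum a \<omega>\<bar>"])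
      show "AE \<omega> in M. norm (h (wsum a \<omega>)) \<le> norm (\<bar>h 0\<bar> + \<bar>wsum a \<omega>\<bar>)"
        using hc(5)[of "wsum a _" 0] by (intro AE_I2) (simp add: abs_le_iff, smt (verit))
    qed (use wsum_integrable in auto)
  qed auto
  then show ?thesis by (simp add: prob_space)
qed

end

text \<open>For \<open>\<theta> > 1\<close>: below 1 a larger exponent gives a smaller power, and
  from 1 on the right-hand side is at least 1.\<close>

lemma powr_min_one_cases:
  fixes x \<theta> :: real
  assumes "x > 0" "\<theta> > 0"
  shows "min 1 (x powr \<theta>) \<le> x powr min 1 \<theta>"
proof (cases "\<theta> \<le> 1")
  case False
  then show ?thesis
  proof (cases "x \<ge> 1")
    case f: False
    have "x powr \<theta> \<le> x powr 1" using assms False f by (intro powr_mono') auto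
    then show ?thesis using assms False by (simp add: min_def)
  qed (use False assms in \<open>simp add: min_def\<close>)
qed (simp add: min_def)

context poisson_array
begin

text \<open>Write \<open>D\<close> for the error on the right. For \<open>t < D\<close> no
  cancellation is used: each expectation is separately at most
  \<open>min 1 ((2 * D) powr \<theta>)\<close>, which gives the summand 2 of the constant. For
  \<open>t \<ge> D\<close> the raw bound is of order \<open>D * t powr (\<theta> - 1)\<close>, which
  yields the remaining summand.\<close>

lemma defect_atMost:
  assumes a: "\<And>k. k \<in> {1..n} \<Longrightarrow> \<bar>a k - real k / n\<bar> \<le> d"
    and a_nonneg: "\<And>k. k \<in> {1..n} \<Longrightarrow> 0 \<le> a k" and t: "t \<ge> 0"
  shows "\<bar>expectation (\<lambda>\<omega>. indicator {..t} (wsum a \<omega>)) - expectation (\<lambda>\<omega>. dickman_step \<theta> (indicator {..t}) (wsum a \<omega>))\<bar>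
    \<le> (2 + \<theta> * (1 + 2 * 3 powr \<theta>)) * (weight_dev a + 2 * (d + 1 / n)) powr min 1 \<theta>"
proof -
  let ?D = "weight_dev a + 2 * (d + 1 / n)"
  let ?E = "\<bar>expectation (\<lambda>\<omega>. indicator {..t} (wsum a \<omega>)) - expectation (\<lambda>\<omega>. dickman_step \<theta> (indicator {..t}) (wsum a \<omega>))\<bar>"
  have d: "d \<ge> 0" using a[of 1] n by force
  have wd: "weight_dev a \<ge> 0" unfolding weight_dev_def by (intro sum_nonneg) auto
  have n0: "1 / real n > 0" using n by simp
  have D0: "?D > 0" using wd d n0 by (intro add_nonneg_pos mult_pos_pos) auto
  have D1: "d + 2 / n \<le> ?D" using d wd by simp
  have c0: "0 \<le> \<theta> * (1 + 2 * 3 powr \<theta>)" using theta by simp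
  show ?thesis
  proof (cases "t < ?D")
    case True
    have T: "wsum a \<omega> \<ge> 0" for \<omega> using a_nonneg by (rule wsum_nonneg)
    have step: "dickman_step \<theta> (indicator {..t}) (wsum a \<omega>) = (if wsum a \<omega> + 1 \<le> t then 1 else (t / (wsum a \<omega> + 1)) powr \<theta>)" for \<omega>
      using T[of \<omega>] t theta by (intro dickman_avg_atMost) auto
    have s0: "0 \<le> dickman_step \<theta> (indicator {..t}) (wsum a \<omega>)" for \<omega> unfolding step by simp
    \<comment> \<open>After one step the argument is at least 1, so the average
      \<open>(t / (x + 1)) powr \<theta>\<close> is small together with \<open>t\<close>.\<close>
    have s1: "dickman_step \<theta> (indicator {..t}) (wsum a \<omega>) \<le> min 1 (t powr \<theta>)" for \<omega>
    proof -
      have "t / (wsum a \<omega> + 1) \<le> t" using t T[of \<omega>] by (simp add: divide_le_eq mult_left_mono algebra_simps)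
      then have "(t / (wsum a \<omega> + 1)) powr \<theta> \<le> t powr \<theta>"
        using t T[of \<omega>] theta by (intro powr_mono2) auto
      moreover have "wsum a \<omega> + 1 \<le> t \<Longrightarrow> 1 \<le> t powr \<theta>"
        using T[of \<omega>] theta by (intro ge_one_powr_ge_zero) auto
      moreover have "\<not> wsum a \<omega> + 1 \<le> t \<Longrightarrow> (t / (wsum a \<omega> + 1)) powr \<theta> \<le> 1"
        using T[of \<omega>] t theta by (intro powr_le1) auto
      ultimately show ?thesis unfolding step by auto
    qed
    have tD: "min 1 (t powr \<theta>) \<le> min 1 ((2 * ?D) powr \<theta>)"
    proof -
      have "t powr \<theta> \<le> (2 * ?D) powr \<theta>" using True t theta D0 by (intro powr_mono2) auto
      then show ?thesis by auto
    qed
    have "expectation (\<lambda>\<omega>. dickman_step \<theta> (indicator {..t}) (wsum a \<omega>)) \<le> expectation (\<lambda>\<omega>. min 1 (t powr \<theta>))"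
    proof (rule integral_mono)
      show "integrable M (\<lambda>\<omega>. dickman_step \<theta> (indicator {..t}) (wsum a \<omega>))"
        using s0 s1 by (intro integrable_const_bound[where B=1]) (auto simp: abs_le_iff intro: order_trans[OF _ s0])
    qed (use s1 in auto)
    then have "expectation (\<lambda>\<omega>. dickman_step \<theta> (indicator {..t}) (wsum a \<omega>)) \<le> min 1 (t powr \<theta>)"
      by (simp add: prob_space)
    then have e1: "expectation (\<lambda>\<omega>. dickman_step \<theta> (indicator {..t}) (wsum a \<omega>)) \<le> min 1 ((2 * ?D) powr \<theta>)"
      using tD by linarith
    have e1': "0 \<le> expectation (\<lambda>\<omega>. dickman_step \<theta> (indicator {..t}) (wsum a \<omega>))"
      using s0 by (intro Bochner_Integration.integral_nonneg) auto
    have "expectation (\<lambda>\<omega>. indicator {..t} (wsum a \<omega>)) = expectation (indicator {\<omega> \<in> space M. wsum a \<omega> \<le> t} :: 'a \<Rightarrow> real)"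
      by (intro Bochner_Integration.integral_cong) (auto simp: indicator_def)
    also have "\<dots> = prob {\<omega> \<in> space M. wsum a \<omega> \<le> t}" by simp
    finally have p: "expectation (\<lambda>\<omega>. indicator {..t} (wsum a \<omega>)) = prob {\<omega> \<in> space M. wsum a \<omega> \<le> t}" .
    have "prob {\<omega> \<in> space M. wsum a \<omega> \<le> t} \<le> (t + d + 2 / n) powr \<theta>"
      by (intro small_wsum_prob a a_nonneg t)
    also have "\<dots> \<le> (2 * ?D) powr \<theta>"
      using D1 True t theta d by (intro powr_mono2) auto
    finally have "prob {\<omega> \<in> space M. wsum a \<omega> \<le> t} \<le> min 1 ((2 * ?D) powr \<theta>)" by simp
    with p have e2: "expectation (\<lambda>\<omega>. indicator {..t} (wsum a \<omega>)) \<le> min 1 ((2 * ?D) powr \<theta>)"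
      "0 \<le> expectation (\<lambda>\<omega>. indicator {..t} (wsum a \<omega>) :: real)" by simp_all
    have "?E \<le> min 1 ((2 * ?D) powr \<theta>)" using e1 e1' e2 by (simp only: abs_le_iff) linarith
    also have "\<dots> \<le> (2 * ?D) powr min 1 \<theta>" using D0 theta by (intro powr_min_one_cases) auto
    also have "\<dots> = 2 powr min 1 \<theta> * ?D powr min 1 \<theta>" using D0 by (subst powr_mult) auto
    also have "\<dots> \<le> 2 powr 1 * ?D powr min 1 \<theta>"
      by (intro mult_right_mono powr_mono) auto
    also have "\<dots> \<le> (2 + \<theta> * (1 + 2 * 3 powr \<theta>)) * ?D powr min 1 \<theta>"
      using c0 by (intro mult_right_mono) auto
    finally show ?thesis .
  next
    case False
    then have tD: "?D \<le> t" by simp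
    with D0 have t0: "t > 0" by linarith
    let ?P = "expectation (\<lambda>\<omega>. pareto_tail \<theta> t (wsum a \<omega>))"
    have P1: "?P \<le> 2 * (3 * t) powr \<theta>"
      by (rule pareto_tail_wsum[OF a a_nonneg]) (use tD D1 in auto)
    have "?P \<le> expectation (\<lambda>\<omega>. 1)"
      using pareto_tail_nonneg pareto_tail_le_1[OF theta] t0
      by (intro integral_mono integrable_const_bound[where B=1]) auto
    then have P2: "?P \<le> 1" by (simp add: prob_space)
    \<comment> \<open>If \<open>\<theta> \<le> 1\<close>, then \<open>t powr (\<theta> - 1)\<close>
      decreases in \<open>t\<close> and is largest at \<open>t = D\<close>, which lowers the power
      of \<open>D\<close> to \<theta>. If \<open>\<theta> > 1\<close>, it is at most 1 for
      \<open>t < 1\<close>, while for \<open>t \<ge> 1\<close> the tail is just bounded by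
      1.\<close>
    have key: "?D * (1 / t * ?P) \<le> (1 + 2 * 3 powr \<theta>) * ?D powr min 1 \<theta>"
    proof (cases "\<theta> \<le> 1")
      case True
      have "1 / t * ?P \<le> 1 / t * (2 * (3 * t) powr \<theta>)" using P1 t0 by (intro mult_left_mono) auto
      also have "\<dots> = 2 * 3 powr \<theta> * t powr (\<theta> - 1)"
        using t0 by (simp add: powr_mult powr_diff)
      also have "\<dots> \<le> 2 * 3 powr \<theta> * ?D powr (\<theta> - 1)"
        using True D0 tD by (intro mult_left_mono powr_mono2') auto
      finally have "?D * (1 / t * ?P) \<le> ?D * (2 * 3 powr \<theta> * ?D powr (\<theta> - 1))"
        using D0 by (intro mult_left_mono) auto
      also have "\<dots> = 2 * 3 powr \<theta> * (?D * ?D powr (\<theta> - 1))" by (simp only: ac_simps)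
      also have "?D * ?D powr (\<theta> - 1) = ?D powr \<theta>"
        using D0 by (subst powr_diff) simp
      also have "2 * 3 powr \<theta> * ?D powr \<theta> \<le> (1 + 2 * 3 powr \<theta>) * ?D powr \<theta>"
        by (intro mult_right_mono) auto
      finally show ?thesis using True by (simp add: min_def)
    next
      case False
      have "1 / t * ?P \<le> 1 + 2 * 3 powr \<theta>"
      proof (cases "t \<ge> 1")
        case True
        have "1 / t * ?P \<le> 1 * 1"
          using True P2 pareto_tail_nonneg by (intro mult_mono) (auto intro!: Bochner_Integration.integral_nonneg)
        also have "\<dots> \<le> 1 + 2 * 3 powr \<theta>" by simp
        finally show ?thesis .
      next
        case f: False
        have "1 / t * ?P \<le> 1 / t * (2 * (3 * t) powr \<theta>)" using P1 t0 by (intro mult_left_mono) auto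
        also have "\<dots> = 2 * 3 powr \<theta> * t powr (\<theta> - 1)"
          using t0 by (simp add: powr_mult powr_diff)
        also have "\<dots> \<le> 2 * 3 powr \<theta> * 1"
          using False t0 f by (intro mult_left_mono powr_le1) auto
        finally show ?thesis by simp
      qed
      then have "?D * (1 / t * ?P) \<le> ?D * (1 + 2 * 3 powr \<theta>)"
        using D0 by (intro mult_left_mono) auto
      then show ?thesis using False D0 by (simp add: min_def mult.commute)
    qed
    have "?E \<le> \<theta> * ?D * (1 / t * ?P)"
      by (rule defect_atMost_raw[OF a a_nonneg t0])
    also have "\<dots> = \<theta> * (?D * (1 / t * ?P))" by (simp only: ac_simps)
    also have "\<dots> \<le> \<theta> * ((1 + 2 * 3 powr \<theta>) * ?D powr min 1 \<theta>)"
      using theta key by (intro mult_left_mono) auto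
    also have "\<dots> = \<theta> * (1 + 2 * 3 powr \<theta>) * ?D powr min 1 \<theta>" by (simp only: ac_simps)
    also have "\<dots> \<le> (2 + \<theta> * (1 + 2 * 3 powr \<theta>)) * ?D powr min 1 \<theta>"
      by (intro mult_right_mono) auto
    finally show ?thesis .
  qed
qed

end

subsection \<open>Comparison with the Dickman law\<close>

lemma dickman_lawD:
  assumes "dickman_law \<theta> D"
  shows "prob_space D" "sets D = sets borel" "space D = UNIV" "AE x in D. 0 \<le> x"
    "D = distr (unif01 \<Otimes>\<^sub>M D) borel (\<lambda>(u, d). u powr (1 / \<theta>) * (d + 1))"
  using assms sets_eq_imp_space_eq[of D borel] by (auto simp: dickman_law_def)

text \<open>The fixed-point equation tested against \<open>h\<close>. Integrability of the image is
  part of the claim because the averaged function need not be bounded.\<close>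

lemma dickman_law_integral:
  fixes h :: "real \<Rightarrow> real"
  assumes D: "dickman_law \<theta> D" and [measurable]: "h \<in> borel_measurable borel" and int: "integrable D h"
  shows "(\<integral>x. h x \<partial>D) = (\<integral>x. dickman_step \<theta> h x \<partial>D)" "integrable D (dickman_step \<theta> h)"
proof -
  note D' = dickman_lawD[OF D]
  interpret prob_space D by fact
  interpret P: pair_prob_space unif01 D ..
  have [measurable_cong]: "sets D = sets borel" by fact
  let ?p = "\<lambda>(u, d). u powr (1 / \<theta>) * (d + 1)"
  have p[measurable]: "?p \<in> borel_measurable (unif01 \<Otimes>\<^sub>M D)" by measurable
  have "integrable (distr (unif01 \<Otimes>\<^sub>M D) borel ?p) h" using int D'(5) by simp
  then have i: "integrable (unif01 \<Otimes>\<^sub>M D) (case_prod (\<lambda>u d. h (u powr (1 / \<theta>) * (d + 1))))"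
    by (subst (asm) integrable_distr_eq) (simp_all add: case_prod_unfold)
  have "(\<integral>x. h x \<partial>D) = (\<integral>x. h x \<partial>distr (unif01 \<Otimes>\<^sub>M D) borel ?p)" using D'(5) by simp
  also have "\<dots> = (\<integral>p. h (?p p) \<partial>(unif01 \<Otimes>\<^sub>M D))" by (rule integral_distr) auto
  also have "\<dots> = (\<integral>p. (case_prod (\<lambda>u d. h (u powr (1 / \<theta>) * (d + 1)))) p \<partial>(unif01 \<Otimes>\<^sub>M D))"
    by (simp add: case_prod_unfold)
  also have "\<dots> = (\<integral>d. (\<integral>u. h (u powr (1 / \<theta>) * (d + 1)) \<partial>unif01) \<partial>D)"
    by (rule P.integral_snd[OF i, symmetric])
  finally show "(\<integral>x. h x \<partial>D) = (\<integral>x. dickman_step \<theta> h x \<partial>D)" by (simp add: dickman_avg_def)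
  show "integrable D (dickman_step \<theta> h)"
    using P.integrable_snd[OF i] by (simp add: dickman_avg_def)
qed

text \<open>Finiteness of the mean is not part of the definition: unrolling the fixed-point equation
  \<open>m\<close> times for \<open>min K\<close> leaves a remainder that is at most \<open>\<rho>\<^sup>m\<close>-Lipschitz and vanishes as \<open>m\<close> grows.\<close>

lemma dickman_law_mean:
  assumes \<theta>: "\<theta> > 0" and D: "dickman_law \<theta> D"
  shows "integrable D (\<lambda>x. x)"
proof -
  note D' = dickman_lawD[OF D]
  interpret prob_space D by fact
  have [measurable_cong]: "sets D = sets borel" by fact
  define \<rho> where "\<rho> = \<theta> / (\<theta> + 1)"
  have \<rho>: "0 < \<rho>" "\<rho> < 1" using \<theta> by (auto simp: \<rho>_def)
  have trunc: "expectation (\<lambda>x. min K \<bar>x\<bar>) \<le> \<theta>" if K: "K \<ge> 0" for K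
  proof -
    define q where "q m = (dickman_avg \<theta> ^^ m) (\<lambda>x. min K \<bar>x\<bar>)" for m
    have q0: "q 0 = (\<lambda>x. min K \<bar>x\<bar>)" and qS: "q (Suc m) = dickman_avg \<theta> (q m)" for m
      by (simp_all add: q_def)
    have qm[measurable]: "q m \<in> borel_measurable borel" for m
      by (induction m) (simp_all add: q0 qS dickman_avg_measurable)
    have qb: "0 \<le> q m x \<and> q m x \<le> K" for m x
    proof (induction m arbitrary: x)
      case (Suc m)
      have i: "integrable unif01 (\<lambda>u. q m (u powr (1 / \<theta>) * x))"
        by (rule integrable_unif01_bounded[where B=K]) (use Suc in auto)
      have "(\<integral>u. q m (u powr (1 / \<theta>) * x) \<partial>unif01) \<le> (\<integral>u. K \<partial>unif01)"
        by (rule integral_unif01_mono[OF i]) (use Suc in auto)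
      moreover have "(\<integral>u. 0 \<partial>unif01) \<le> (\<integral>u. q m (u powr (1 / \<theta>) * x) \<partial>unif01)"
        by (rule integral_unif01_mono[OF _ i]) (use Suc in auto)
      ultimately show ?case by (simp add: qS dickman_avg_def)
    qed (use K in \<open>simp add: q0\<close>)
    have iq: "integrable unif01 (\<lambda>u. q m (u powr (1 / \<theta>) * x))" for m x
      by (rule integrable_unif01_bounded[where B=K]) (use qb in auto)
    have ql: "\<bar>q m x - q m y\<bar> \<le> \<rho> ^ m * \<bar>x - y\<bar>" for m x y
    proof (induction m arbitrary: x y)
      case (Suc m)
      have "\<bar>q (Suc m) x - q (Suc m) y\<bar> = \<bar>\<integral>u. q m (u powr (1 / \<theta>) * x) - q m (u powr (1 / \<theta>) * y) \<partial>unif01\<bar>"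
        using iq by (simp add: qS dickman_avg_def)
      also have "\<dots> \<le> (\<integral>u. \<bar>q m (u powr (1 / \<theta>) * x) - q m (u powr (1 / \<theta>) * y)\<bar> \<partial>unif01)"
        by (rule integral_abs_bound)
      also have "\<dots> \<le> (\<integral>u. u powr (1 / \<theta>) * (\<rho> ^ m * \<bar>x - y\<bar>) \<partial>unif01)"
      proof (rule integral_unif01_mono)
        show "integrable unif01 (\<lambda>u. u powr (1 / \<theta>) * (\<rho> ^ m * \<bar>x - y\<bar>))"
          by (rule integrable_unif01_bounded[where B="\<rho> ^ m * \<bar>x - y\<bar>"])
            (use powr_inverse_bounds[OF \<theta>] \<rho> in \<open>auto simp: abs_mult intro!: mult_left_le_one_le\<close>)
        fix u :: real assume "0 < u" "u < 1"
        show "\<bar>q m (u powr (1 / \<theta>) * x) - q m (u powr (1 / \<theta>) * y)\<bar> \<le> u powr (1 / \<theta>) * (\<rho> ^ m * \<bar>x - y\<bar>)"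
        proof -
          have "\<bar>u powr (1 / \<theta>) * x - u powr (1 / \<theta>) * y\<bar> = u powr (1 / \<theta>) * \<bar>x - y\<bar>"
            by (simp add: right_diff_distrib[symmetric] abs_mult)
          then show ?thesis using Suc[of "u powr (1 / \<theta>) * x" "u powr (1 / \<theta>) * y"] by (simp only: ac_simps)
        qed
      qed (use iq in auto)
      also have "\<dots> = \<rho> ^ Suc m * \<bar>x - y\<bar>" by (simp add: integral_unif01_powr[OF \<theta>] \<rho>_def)
      finally show ?case .
    next
      case 0
      show ?case unfolding q0 power_0 mult_1 by linarith
    qed
    have q_zero: "q m 0 = 0" for m
      by (induction m) (use K in \<open>simp_all add: q0 qS dickman_avg_def\<close>)
    have iD: "integrable D (\<lambda>x. q m x)" for m
      using qb by (intro integrable_const_bound[where B=K]) auto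
    have unroll: "expectation (q m) \<le> expectation (q (Suc m)) + \<rho> ^ Suc m" for m
    proof -
      have "expectation (q m) = expectation (\<lambda>x. q (Suc m) (x + 1))"
        using dickman_law_integral(1)[OF D qm iD] by (simp add: qS)
      also have "\<dots> \<le> expectation (\<lambda>x. q (Suc m) x + \<rho> ^ Suc m)"
      proof (rule integral_mono)
        show "integrable D (\<lambda>x. q (Suc m) (x + 1))"
          using qb by (intro integrable_const_bound[where B=K]) auto
        show "q (Suc m) (x + 1) \<le> q (Suc m) x + \<rho> ^ Suc m" for x
          using ql[of "Suc m" "x + 1" x] by simp
      qed (use iD in auto)
      also have "\<dots> = expectation (q (Suc m)) + \<rho> ^ Suc m" using iD by (simp add: prob_space)
      finally show ?thesis .
    qed
    have iter: "expectation (q 0) \<le> expectation (q m) + \<theta> * (1 - \<rho> ^ m)" for m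
    proof (induction m)
      case (Suc m)
      \<comment> \<open>The costs \<rho> + \<rho>^2 + ... of the successive unit shifts add up to
        \<rho> / (1 - \<rho>) = \<theta>; this is where the bound \<theta> on the truncated means
        comes from.\<close>
      have "\<theta> * (1 - \<rho> ^ m) + \<rho> ^ Suc m = \<theta> * (1 - \<rho> ^ Suc m)"
      proof -
        have "\<theta> * (1 - \<rho>) = \<rho>" using \<theta> by (simp add: \<rho>_def field_simps)
        then have "\<rho> ^ Suc m = \<theta> * (1 - \<rho>) * \<rho> ^ m" by simp
        then show ?thesis by (simp add: algebra_simps)
      qed
      then show ?case using Suc unroll[of m] by linarith
    qed simp
    have lim: "(\<lambda>m. expectation (q m)) \<longlonglongrightarrow> expectation (\<lambda>x. 0)"
    proof (rule integral_dominated_convergence[where w="\<lambda>_. K"])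
      show "AE x in D. (\<lambda>m. q m x) \<longlonglongrightarrow> 0"
      proof (rule AE_I2)
        fix x
        have z: "(\<lambda>m. \<rho> ^ m * \<bar>x\<bar>) \<longlonglongrightarrow> 0"
          using \<rho> by (intro tendsto_mult_left_zero LIMSEQ_realpow_zero) auto
        have "norm (q m x) \<le> \<rho> ^ m * \<bar>x\<bar>" for m using ql[of m x 0] q_zero by simp
        then have "eventually (\<lambda>m. norm (q m x) \<le> \<rho> ^ m * \<bar>x\<bar>) sequentially" by simp
        then show "(\<lambda>m. q m x) \<longlonglongrightarrow> 0" by (rule Lim_null_comparison[OF _ z])
      qed
    qed (use qb in auto)
    have "expectation (q 0) \<le> expectation (q m) + \<theta>" for m
    proof -
      have "\<theta> * (1 - \<rho> ^ m) \<le> \<theta> * 1" using \<theta> \<rho> by (intro mult_left_mono) auto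
      then show ?thesis using iter[of m] by linarith
    qed
    moreover have "(\<lambda>m. expectation (q m) + \<theta>) \<longlonglongrightarrow> 0 + \<theta>"
      using tendsto_add[OF lim tendsto_const[of \<theta>]] by simp
    ultimately have "expectation (q 0) \<le> 0 + \<theta>" by (intro LIMSEQ_le_const) blast+
    then show ?thesis by (simp add: q0)
  qed
  have i: "integrable D (\<lambda>x. min (real N) \<bar>x\<bar>)" for N
    by (rule integrable_const_bound[where B="real N"]) auto
  have inc: "incseq (\<lambda>N. expectation (\<lambda>x. min (real N) \<bar>x\<bar>))"
    by (intro incseq_SucI integral_mono i) auto
  obtain L where L: "(\<lambda>N. expectation (\<lambda>x. min (real N) \<bar>x\<bar>)) \<longlonglongrightarrow> L"
    by (rule incseq_convergent[OF inc, of \<theta>]) (use trunc in auto)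
  have "integrable D (\<lambda>x. \<bar>x\<bar>)"
  proof (rule integrable_monotone_convergence[OF i _ _ L])
    show "AE x in D. mono (\<lambda>N. min (real N) \<bar>x\<bar>)" by (auto simp: mono_def)
    show "AE x in D. (\<lambda>N. min (real N) \<bar>x\<bar>) \<longlonglongrightarrow> \<bar>x\<bar>"
    proof (rule AE_I2)
      fix x :: real
      obtain N0 where "\<bar>x\<bar> \<le> real N0" using real_arch_simple by blast
      then have "eventually (\<lambda>N. min (real N) \<bar>x\<bar> = \<bar>x\<bar>) sequentially"
        by (intro eventually_sequentiallyI[of N0]) auto
      then show "(\<lambda>N. min (real N) \<bar>x\<bar>) \<longlonglongrightarrow> \<bar>x\<bar>" by (rule tendsto_eventually)
    qed
  qed measurable
  then show ?thesis by (subst integrable_abs_iff[symmetric]) auto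
qed

text \<open>The limit form of summing a geometric series of defects. The a priori bound
  \<open>B\<close> does not enter the conclusion, but it makes the supremum finite, so that the
  inequality can be solved for it.\<close>

lemma contraction_bound:
  fixes \<Delta> :: "'i \<Rightarrow> real"
  assumes bnd: "\<And>i. i \<in> C \<Longrightarrow> \<Delta> i \<le> B"
    and step: "\<And>e i. (\<And>j. j \<in> C \<Longrightarrow> \<Delta> j \<le> e) \<Longrightarrow> i \<in> C \<Longrightarrow> \<Delta> i \<le> \<kappa> + \<rho> * e"
    and \<rho>: "\<rho> < 1" and i: "i \<in> C"
  shows "\<Delta> i \<le> \<kappa> / (1 - \<rho>)"
proof -
  define S where "S = (SUP j\<in>C. \<Delta> j)"
  have le: "\<Delta> j \<le> S" if "j \<in> C" for j
    unfolding S_def using that bnd by (intro cSUP_upper bdd_aboveI2[where M=B]) auto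
  \<comment> \<open>The one-step estimate is applied with the supremum itself as uniform
    bound.\<close>
  have "S \<le> \<kappa> + \<rho> * S"
    unfolding S_def using i step[OF le] by (intro cSUP_least) (auto simp: S_def)
  then have "S * (1 - \<rho>) \<le> \<kappa>" by (simp add: algebra_simps)
  then have "S \<le> \<kappa> / (1 - \<rho>)" using \<rho> by (simp add: pos_le_divide_eq)
  with le[OF i] show ?thesis by linarith
qed

section \<open>The averaged indicator in terms of hinges\<close>

lemma dickman_avg_hinge:
  assumes \<theta>: "\<theta> > 0" and c: "c > 0" and y: "y \<ge> 0"
  shows "dickman_avg \<theta> (hinge c) y = (if y \<le> c then c - \<theta> / (\<theta> + 1) * y else c / (\<theta> + 1) * (c / y) powr \<theta>)"
proof (cases "y \<le> c")
  case True
  have i: "integrable unif01 (\<lambda>u. u powr (1 / \<theta>) * y)"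
    by (rule integrable_unif01_bounded[where B=y])
      (use powr_inverse_bounds[OF \<theta>] y in \<open>auto simp: abs_mult intro!: mult_left_le_one_le\<close>)
  have "dickman_avg \<theta> (hinge c) y = (\<integral>u. c - u powr (1 / \<theta>) * y \<partial>unif01)"
    unfolding dickman_avg_def
  proof (rule integral_unif01_cong)
    fix u :: real assume "0 < u" "u < 1"
    then have "u powr (1 / \<theta>) * y \<le> 1 * y" using powr_inverse_bounds[OF \<theta>, of u] y by (intro mult_right_mono) auto
    then show "hinge c (u powr (1 / \<theta>) * y) = c - u powr (1 / \<theta>) * y" using True by (simp add: hinge_def)
  qed measurable
  also have "\<dots> = c - \<theta> / (\<theta> + 1) * y" using i integral_unif01_powr[OF \<theta>] by simp
  finally show ?thesis using True by simp
next
  case False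
  with c have y: "y > 0" by simp
  \<comment> \<open>The value of \<open>u\<close> at which \<open>u powr (1 / \<theta>) * y\<close>
    reaches the kink \<open>c\<close>; the primitive is frozen from there on.\<close>
  define p where "p = (c / y) powr \<theta>"
  have p: "0 < p" "p \<le> 1" using c y False \<theta> by (auto simp: p_def intro!: powr_le1)
  have pc: "p powr (1 / \<theta>) = c / y" using c y \<theta> by (simp add: p_def powr_powr)
  let ?F = "\<lambda>u. c * min u p - \<theta> / (\<theta> + 1) * y * min u p powr (1 / \<theta> + 1)"
  have rho: "\<theta> / (\<theta> + 1) * (1 / \<theta> + 1) = 1" using \<theta> by (simp add: divide_simps)
  have "dickman_avg \<theta> (hinge c) y = ?F 1 - ?F 0"
    unfolding dickman_avg_def
  proof (rule integral_unif01_FTC[where B=c and S="{p}"])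
    fix u :: real assume u: "0 < u" "u < 1"
    show "\<bar>hinge c (u powr (1 / \<theta>) * y)\<bar> \<le> c" using c y by (auto simp: hinge_def)
    assume "u \<notin> {p}"
    then consider "u < p" | "u > p" by force
    then show "(?F has_real_derivative hinge c (u powr (1 / \<theta>) * y)) (at u)"
    proof cases
      case 1
      then have "u powr (1 / \<theta>) \<le> c / y" using u \<theta> unfolding pc[symmetric] by (intro powr_mono2) auto
      then have h: "hinge c (u powr (1 / \<theta>) * y) = c - u powr (1 / \<theta>) * y"
        using y by (simp add: hinge_def field_simps)
      have e: "\<theta> / (\<theta> + 1) * y * ((1 / \<theta> + 1) * u powr (1 / \<theta>)) = u powr (1 / \<theta>) * y"
      proof -
        have "\<theta> / (\<theta> + 1) * y * ((1 / \<theta> + 1) * u powr (1 / \<theta>)) = (\<theta> / (\<theta> + 1) * (1 / \<theta> + 1)) * (u powr (1 / \<theta>) * y)"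
          by (simp only: ac_simps)
        then show ?thesis unfolding rho by simp
      qed
      have "((\<lambda>u. u powr (1 / \<theta> + 1)) has_real_derivative (1 / \<theta> + 1) * u powr (1 / \<theta>)) (at u)"
        using u by (auto intro!: derivative_eq_intros)
      from DERIV_diff[OF DERIV_cmult_Id DERIV_cmult[OF this, of "\<theta> / (\<theta> + 1) * y"], of c]
      have "((\<lambda>u. c * u - \<theta> / (\<theta> + 1) * y * u powr (1 / \<theta> + 1)) has_real_derivative
          hinge c (u powr (1 / \<theta>) * y)) (at u)"
        unfolding h e .
      then show ?thesis
        by (rule has_field_derivative_transform_within_open[where S="{..<p}"]) (use 1 in auto)
    next
      case 2
      then have "c / y \<le> u powr (1 / \<theta>)" using p \<theta> unfolding pc[symmetric] by (intro powr_mono2) auto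
      then have "hinge c (u powr (1 / \<theta>) * y) = 0" using y by (simp add: hinge_def field_simps)
      then have "((\<lambda>u. c * p - \<theta> / (\<theta> + 1) * y * p powr (1 / \<theta> + 1)) has_real_derivative hinge c (u powr (1 / \<theta>) * y)) (at u)"
        by simp
      then show ?thesis
        by (rule has_field_derivative_transform_within_open[where S="{p<..}"]) (use 2 in auto)
    qed
  next
    show "continuous_on {0..1} ?F"
      using \<theta> p by (intro continuous_intros continuous_on_powr') (auto simp: add_pos_pos)
  qed measurable
  also have "\<dots> = c / (\<theta> + 1) * p"
  proof -
    have "p powr (1 / \<theta> + 1) = c / y * p" using p by (simp add: powr_add pc)
    then show ?thesis using p \<theta> y by (simp add: field_simps)
  qed
  finally show ?thesis using False by (simp add: p_def)
qed

text \<open>Beyond their thresholds the averages of an indicator and of a hinge are both multiples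
  of a power with exponent \<open>- \<theta>\<close>, so one scalar matches them. Below the
  threshold the averaged hinge is affine where 1 is wanted, and a multiple of
  \<open>hinge (t - 1)\<close> removes the slope. Taking the threshold \<open>max 1 t\<close> rather
  than \<open>t\<close> costs nothing, since arguments after a step are at least 1, and keeps the
  scalar at most \<open>\<theta> + 1\<close> as \<open>t\<close> tends to 0.\<close>

lemma dickman_step_atMost_eq_hinge:
  assumes \<theta>: "\<theta> > 0" and t: "t > 0" and x: "x \<ge> 0"
  shows "dickman_step \<theta> (indicator {..t}) x =
    (\<theta> + 1) / max 1 t * (t / max 1 t) powr \<theta> * dickman_step \<theta> (hinge (max 1 t)) x - \<theta> / t * hinge (t - 1) x"
proof (cases "x + 1 \<le> max 1 t")
  case True
  show ?thesis
  proof (cases "t > 1")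
    case t1: True
    have "(\<theta> + 1) / t * (t - r * (x + 1)) = (\<theta> + 1) - (\<theta> + 1) * r / t * (x + 1)" for r
      using t by (simp add: field_simps)
    from this[of "\<theta> / (\<theta> + 1)"]
    have "(\<theta> + 1) / t * (t - \<theta> / (\<theta> + 1) * (x + 1)) = (\<theta> + 1) - \<theta> / t * (x + 1)"
      using \<theta> by simp
    moreover have "\<theta> / t * (t - 1 - x) = \<theta> - \<theta> / t * (x + 1)" using t by (simp add: field_simps)
    ultimately show ?thesis
      using dickman_avg_atMost[OF \<theta>, of t "x + 1"] dickman_avg_hinge[OF \<theta>, of t "x + 1"] t t1 x True
      by (simp add: max_def hinge_def)
  next
    \<comment> \<open>With threshold 1 only the corner \<open>x = 0\<close> remains.\<close>
    case False
    then have x0: "x = 0" using True x by simp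
    have k: "(\<theta> + 1) * dickman_avg \<theta> (hinge 1) 1 = 1"
      using dickman_avg_hinge[OF \<theta>, of 1 1] \<theta> by (simp add: right_diff_distrib)
    have i: "dickman_avg \<theta> (indicator {..t}) 1 = t powr \<theta>"
      using dickman_avg_atMost[OF \<theta>, of t 1] t False by (cases "t = 1") auto
    have "(\<theta> + 1) / max 1 t * (t / max 1 t) powr \<theta> * dickman_avg \<theta> (hinge (max 1 t)) 1
        = ((\<theta> + 1) * dickman_avg \<theta> (hinge 1) 1) * t powr \<theta>"
      using False by (simp add: max_def)
    then show ?thesis using False by (simp add: x0 k i hinge_def)
  qed
next
  case False
  then have m: "max 1 t < x + 1" by linarith
  have "(t / max 1 t) powr \<theta> * (max 1 t / (x + 1)) powr \<theta> = (t / (x + 1)) powr \<theta>"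
    using t x by (subst powr_mult[symmetric]) auto
  then have "(\<theta> + 1) / max 1 t * (max 1 t / (\<theta> + 1)) * ((t / max 1 t) powr \<theta> * (max 1 t / (x + 1)) powr \<theta>) = (t / (x + 1)) powr \<theta>"
    using \<theta> by (simp add: max_def)
  then have "(\<theta> + 1) / max 1 t * (t / max 1 t) powr \<theta> * (max 1 t / (\<theta> + 1) * (max 1 t / (x + 1)) powr \<theta>)
      = (t / (x + 1)) powr \<theta>"
    by (simp only: ac_simps)
  moreover have "hinge (t - 1) x = 0" using m by (simp add: hinge_def)
  ultimately show ?thesis
    using dickman_avg_atMost[OF \<theta>, of t "x + 1"] dickman_avg_hinge[OF \<theta>, of "max 1 t" "x + 1"] t x m
    by simp
qed

lemma hinge_lipschitz: "\<bar>hinge s x - hinge s y\<bar> \<le> \<bar>x - y\<bar>"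
  unfolding hinge_def by linarith

section \<open>Smooth tests under the averaging step\<close>

text \<open>A quadratic remainder that is uniform in \<open>u\<close> survives integration over
  \<open>u\<close>, so this criterion does the work of differentiating under the integral
  sign.\<close>

lemma real_derivative_from_quadratic_bound:
  fixes g g' :: "real \<Rightarrow> real"
  assumes "\<And>d. \<bar>g (x + d) - g x - d * g' x\<bar> \<le> K * d\<^sup>2"
  shows "(g has_real_derivative g' x) (at x)"
proof -
  have b: "norm ((g (x + h) - g x) / h - g' x) \<le> norm (K * h)" if "h \<noteq> 0" for h
  proof -
    have "(g (x + h) - g x) / h - g' x = (g (x + h) - g x - h * g' x) / h"
      using that by (simp add: field_simps)
    also have "norm \<dots> \<le> K * h\<^sup>2 / \<bar>h\<bar>"
      using assms[of h] by (simp add: divide_right_mono)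
    also have "\<dots> = K * \<bar>h\<bar>" using that by (simp add: power2_eq_square abs_if)
    also have "\<dots> \<le> norm (K * h)" by (simp add: abs_mult mult_right_mono)
    finally show ?thesis .
  qed
  have "((\<lambda>h. (g (x + h) - g x) / h - g' x) \<longlongrightarrow> 0) (at 0)"
  proof (rule Lim_null_comparison)
    show "eventually (\<lambda>h. norm ((g (x + h) - g x) / h - g' x) \<le> norm (K * h)) (at 0)"
      using b by (auto simp: eventually_at_filter)
    have "((\<lambda>h. norm (K * h)) \<longlongrightarrow> norm (K * 0)) (at 0)" by (intro tendsto_intros)
    then show "((\<lambda>h. norm (K * h)) \<longlongrightarrow> 0) (at 0)" by simp
  qed
  then show ?thesis by (simp add: DERIV_def LIM_zero_iff)
qed

text \<open>Differentiation in \<open>x\<close> brings out one factor V for the function and a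
  second one for the derivative. Since E V^2 \<le> E V, both Lipschitz constants shrink by at least
  E V, and dividing by E V stays in the class.\<close>

lemma smooth_test_dickman_step:
  assumes \<theta>: "\<theta> > 0" and h: "smooth_test h h'"
  shows "smooth_test (\<lambda>x. dickman_step \<theta> h x / (\<theta> / (\<theta> + 1)))
     (\<lambda>x. (\<integral>u. u powr (1 / \<theta>) * h' (u powr (1 / \<theta>) * (x + 1)) \<partial>unif01) / (\<theta> / (\<theta> + 1)))"
proof -
  define \<rho> where "\<rho> = \<theta> / (\<theta> + 1)"
  have \<rho>: "\<rho> > 0" using \<theta> by (simp add: \<rho>_def)
  note hc = smooth_test_continuous[OF h]
  note [measurable] = hc(3,4)
  note v = powr_inverse_bounds[OF \<theta>]
  have h1: "\<bar>h' x\<bar> \<le> 1" "\<bar>h' x - h' y\<bar> \<le> \<bar>x - y\<bar>" "(h has_real_derivative h' x) (at x)" for x y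
    using h by (auto simp: smooth_test_def)
  let ?g = "\<lambda>x. (\<integral>u. u powr (1 / \<theta>) * h' (u powr (1 / \<theta>) * (x + 1)) \<partial>unif01)"
  have int_h: "integrable unif01 (\<lambda>u. h (u powr (1 / \<theta>) * y))" for y
  proof (rule integrable_unif01_bounded[where B="\<bar>h 0\<bar> + \<bar>y\<bar>"])
    fix u :: real assume u: "0 < u" "u < 1"
    have "\<bar>u powr (1 / \<theta>) * y\<bar> \<le> \<bar>y\<bar>" using v[OF u] by (simp add: abs_mult mult_left_le_one_le)
    then show "\<bar>h (u powr (1 / \<theta>) * y)\<bar> \<le> \<bar>h 0\<bar> + \<bar>y\<bar>" using hc(5)[of "u powr (1 / \<theta>) * y" 0] by linarith
  qed measurable
  have int_v: "integrable unif01 (\<lambda>u. u powr (1 / \<theta>) * c u)"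
    if [measurable]: "c \<in> borel_measurable borel" and "\<And>u. \<bar>c u\<bar> \<le> B" for c :: "real \<Rightarrow> real" and B
    using abs_integral_powr_le(2)[OF \<theta>, of c B] that by blast
  have v_bound: "\<bar>\<integral>u. u powr (1 / \<theta>) * c u \<partial>unif01\<bar> \<le> \<rho> * B"
    if c[measurable]: "c \<in> borel_measurable borel" and b: "\<And>u. 0 < u \<Longrightarrow> u < 1 \<Longrightarrow> \<bar>c u\<bar> \<le> B" for c :: "real \<Rightarrow> real" and B
  proof -
    note i = abs_integral_powr_le(2)[OF \<theta> c b]
    have "\<bar>c (1/2)\<bar> \<le> B" by (rule b) auto
    then have B: "B \<ge> 0" by linarith
    have "\<bar>\<integral>u. u powr (1 / \<theta>) * c u \<partial>unif01\<bar> \<le> (\<integral>u. \<bar>u powr (1 / \<theta>) * c u\<bar> \<partial>unif01)"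
      by (rule integral_abs_bound)
    also have "\<dots> \<le> (\<integral>u. u powr (1 / \<theta>) * B \<partial>unif01)"
    proof (rule integral_unif01_mono)
      show "integrable unif01 (\<lambda>u. u powr (1 / \<theta>) * B)"
        by (rule abs_integral_powr_le(2)[OF \<theta>, where K=B]) (use B in auto)
      show "integrable unif01 (\<lambda>u. \<bar>u powr (1 / \<theta>) * c u\<bar>)" by (rule integrable_abs[OF i])
      show "\<bar>u powr (1 / \<theta>) * c u\<bar> \<le> u powr (1 / \<theta>) * B" if "0 < u" "u < 1" for u
        using b[OF that] by (simp add: abs_mult mult_left_mono)
    qed
    finally show ?thesis by (simp add: integral_unif01_powr[OF \<theta>] \<rho>_def)
  qed
  \<comment> \<open>The mean value inequality for \<open>h z - z * h' y\<close>, whose derivative is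
    at most \<open>\<bar>d\<bar>\<close> between \<open>y\<close> and \<open>y + d\<close>.\<close>
  have taylor: "\<bar>h (y + d) - h y - d * h' y\<bar> \<le> d\<^sup>2" for y d
  proof -
    have "norm ((h (y + d) - (y + d) * h' y) - (h y - y * h' y)) \<le> \<bar>d\<bar> * norm ((y + d) - y)"
    proof (rule field_differentiable_bound[where S="closed_segment y (y + d)" and f'="\<lambda>z. h' z - h' y"])
      fix z assume z: "z \<in> closed_segment y (y + d)"
      show "((\<lambda>z. h z - z * h' y) has_field_derivative h' z - h' y) (at z within closed_segment y (y + d))"
        by (rule has_field_derivative_at_within, rule DERIV_diff[OF h1(3)]) (auto intro!: derivative_eq_intros)
      have "\<bar>z - y\<bar> \<le> \<bar>d\<bar>" using z by (auto simp: closed_segment_eq_real_ivl split: if_splits)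
      then show "norm (h' z - h' y) \<le> \<bar>d\<bar>" using h1(2)[of z y] by simp
    qed auto
    then show ?thesis by (simp add: algebra_simps power2_eq_square abs_mult[symmetric])
  qed
  have deriv: "((\<lambda>x. dickman_step \<theta> h x) has_real_derivative ?g x) (at x)" for x
  proof (rule real_derivative_from_quadratic_bound[where K=1])
    fix d :: real
    have i: "integrable unif01 (\<lambda>u. u powr (1 / \<theta>) * h' (u powr (1 / \<theta>) * (x + 1)))"
      by (rule int_v[where B=1]) (use h1 in auto)
    have eq: "dickman_step \<theta> h (x + d) - dickman_step \<theta> h x - d * ?g x
      = (\<integral>u. h (u powr (1 / \<theta>) * (x + d + 1)) - h (u powr (1 / \<theta>) * (x + 1))
          - d * (u powr (1 / \<theta>) * h' (u powr (1 / \<theta>) * (x + 1))) \<partial>unif01)"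
      unfolding dickman_avg_def using int_h i by simp
    have "\<bar>\<integral>u. h (u powr (1 / \<theta>) * (x + d + 1)) - h (u powr (1 / \<theta>) * (x + 1))
          - d * (u powr (1 / \<theta>) * h' (u powr (1 / \<theta>) * (x + 1))) \<partial>unif01\<bar>
        \<le> (\<integral>u. \<bar>h (u powr (1 / \<theta>) * (x + d + 1)) - h (u powr (1 / \<theta>) * (x + 1))
          - d * (u powr (1 / \<theta>) * h' (u powr (1 / \<theta>) * (x + 1)))\<bar> \<partial>unif01)"
      by (rule integral_abs_bound)
    also have "\<dots> \<le> (\<integral>u. d\<^sup>2 \<partial>unif01)"
    proof (rule integral_unif01_mono)
      show "integrable unif01 (\<lambda>u. \<bar>h (u powr (1 / \<theta>) * (x + d + 1)) - h (u powr (1 / \<theta>) * (x + 1))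
          - d * (u powr (1 / \<theta>) * h' (u powr (1 / \<theta>) * (x + 1)))\<bar>)"
        by (rule integrable_abs, rule Bochner_Integration.integrable_diff,
          rule Bochner_Integration.integrable_diff, rule int_h, rule int_h, rule integrable_mult_right, rule i)
      fix u :: real assume u: "0 < u" "u < 1"
      have "\<bar>h (u powr (1 / \<theta>) * (x + 1) + u powr (1 / \<theta>) * d) - h (u powr (1 / \<theta>) * (x + 1))
          - (u powr (1 / \<theta>) * d) * h' (u powr (1 / \<theta>) * (x + 1))\<bar> \<le> (u powr (1 / \<theta>) * d)\<^sup>2"
        by (rule taylor)
      also have "(u powr (1 / \<theta>) * d)\<^sup>2 \<le> 1 * d\<^sup>2"
        unfolding power_mult_distrib using v[OF u] by (intro mult_right_mono power_le_one) auto
      finally show "\<bar>h (u powr (1 / \<theta>) * (x + d + 1)) - h (u powr (1 / \<theta>) * (x + 1))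
          - d * (u powr (1 / \<theta>) * h' (u powr (1 / \<theta>) * (x + 1)))\<bar> \<le> d\<^sup>2"
        by (simp add: algebra_simps)
    qed auto
    finally show "\<bar>dickman_step \<theta> h (x + d) - dickman_step \<theta> h x - d * ?g x\<bar> \<le> 1 * d\<^sup>2"
      unfolding eq by simp
  qed
  have "\<bar>?g x\<bar> \<le> \<rho> * 1" for x by (rule v_bound) (use h1 in auto)
  then have b1: "\<bar>?g x / \<rho>\<bar> \<le> 1" for x using \<rho> by (simp add: divide_le_eq)
  have b2: "\<bar>?g x / \<rho> - ?g y / \<rho>\<bar> \<le> \<bar>x - y\<bar>" for x y
  proof -
    have i: "integrable unif01 (\<lambda>u. u powr (1 / \<theta>) * h' (u powr (1 / \<theta>) * (z + 1)))" for z
      by (rule int_v[where B=1]) (use h1 in auto)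
    have eq: "?g x - ?g y = (\<integral>u. u powr (1 / \<theta>) * (h' (u powr (1 / \<theta>) * (x + 1)) - h' (u powr (1 / \<theta>) * (y + 1))) \<partial>unif01)"
      unfolding right_diff_distrib using i by simp
    have "\<bar>?g x - ?g y\<bar> \<le> \<rho> * \<bar>x - y\<bar>"
      unfolding eq
    proof (rule v_bound)
      fix u :: real assume u: "0 < u" "u < 1"
      have "\<bar>h' (u powr (1 / \<theta>) * (x + 1)) - h' (u powr (1 / \<theta>) * (y + 1))\<bar>
          \<le> \<bar>u powr (1 / \<theta>) * (x + 1) - u powr (1 / \<theta>) * (y + 1)\<bar>" by (rule h1(2))
      also have "\<dots> = u powr (1 / \<theta>) * \<bar>x - y\<bar>"
        by (simp add: right_diff_distrib[symmetric] abs_mult)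
      also have "\<dots> \<le> \<bar>x - y\<bar>" using v[OF u] by (simp add: mult_left_le_one_le)
      finally show "\<bar>h' (u powr (1 / \<theta>) * (x + 1)) - h' (u powr (1 / \<theta>) * (y + 1))\<bar> \<le> \<bar>x - y\<bar>" .
    qed measurable
    then show ?thesis using \<rho> by (simp add: diff_divide_distrib[symmetric] divide_le_eq mult.commute)
  qed
  show ?thesis
    unfolding smooth_test_def \<rho>_def[symmetric] using DERIV_cdivide[OF deriv] b1 b2 by blast
qed

lemma smooth_test_test_functions_11:
  assumes "h \<in> test_functions_11"
  shows "smooth_test h (deriv h)"
proof -
  have d: "(h has_real_derivative deriv h x) (at x)" for x
    using assms by (auto simp: test_functions_11_def DERIV_deriv_iff_real_differentiable)
  have l: "\<bar>h x - h y\<bar> \<le> \<bar>x - y\<bar>" "\<bar>deriv h x - deriv h y\<bar> \<le> \<bar>x - y\<bar>" for x y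
    using assms by (auto simp: test_functions_11_def lipschitz_on_def dist_real_def)
  have "\<bar>deriv h x\<bar> \<le> 1" for x
  proof -
    have "((\<lambda>e. norm ((h (x + e) - h x) / e)) \<longlongrightarrow> norm (deriv h x)) (at 0)"
      using d[of x] by (intro tendsto_norm) (simp add: DERIV_def)
    moreover have "eventually (\<lambda>e. norm ((h (x + e) - h x) / e) \<le> 1) (at 0)"
      using l(1)[of "x + _" x] by (auto simp: eventually_at_filter divide_le_eq)
    ultimately show ?thesis by (intro tendsto_upperbound[where F="at (0::real)"]) auto
  qed
  then show ?thesis using d l by (auto simp: smooth_test_def)
qed

section \<open>From defects to distances by contraction\<close>

locale dickman_comparison =
  fixes \<theta> :: real and D \<mu> :: "real measure"
  assumes theta: "\<theta> > 0" and D: "dickman_law \<theta> D"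
    and \<mu>: "prob_space \<mu>" "sets \<mu> = sets borel" "AE x in \<mu>. 0 \<le> x" "integrable \<mu> (\<lambda>x. x)"
begin

lemma dickman_integrable_lipschitz:
  fixes h :: "real \<Rightarrow> real"
  assumes m: "h \<in> borel_measurable borel" and l: "\<And>x. \<bar>h x - h 0\<bar> \<le> \<bar>x\<bar>"
    and N: "prob_space N" "sets N = sets borel" "integrable N (\<lambda>x. x)"
  shows "integrable N h" "\<bar>(\<integral>x. h x \<partial>N) - h 0\<bar> \<le> (\<integral>x. \<bar>x\<bar> \<partial>N)"
proof -
  interpret N: prob_space N by fact
  have [measurable_cong]: "sets N = sets borel" by fact
  note [measurable] = m
  show i: "integrable N h"
  proof (rule Bochner_Integration.integrable_bound[where f="\<lambda>x. \<bar>h 0\<bar> + \<bar>x\<bar>"])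
    show "AE x in N. norm (h x) \<le> norm (\<bar>h 0\<bar> + \<bar>x\<bar>)"
    proof (rule AE_I2)
      fix x show "norm (h x) \<le> norm (\<bar>h 0\<bar> + \<bar>x\<bar>)" using l[of x] by simp
    qed
    show "integrable N (\<lambda>x. \<bar>h 0\<bar> + \<bar>x\<bar>)"
      by (intro Bochner_Integration.integrable_add N.integrable_const integrable_abs N(3))
  qed measurable
  have eq: "(\<integral>x. h x \<partial>N) - h 0 = (\<integral>x. h x - h 0 \<partial>N)" using i by (simp add: N.prob_space)
  have "\<bar>\<integral>x. h x - h 0 \<partial>N\<bar> \<le> (\<integral>x. \<bar>h x - h 0\<bar> \<partial>N)" by (rule integral_abs_bound)
  also have "\<dots> \<le> (\<integral>x. \<bar>x\<bar> \<partial>N)"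
    using i N(3) l by (intro integral_mono integrable_abs) auto
  finally show "\<bar>(\<integral>x. h x \<partial>N) - h 0\<bar> \<le> (\<integral>x. \<bar>x\<bar> \<partial>N)" unfolding eq .
qed

lemmas D_facts = dickman_lawD[OF D]

text \<open>Finite first moments supply the bound, uniform over the test class, that
  \<open>contraction_bound\<close> requires.\<close>

lemma lipschitz_difference:
  fixes h :: "real \<Rightarrow> real"
  assumes m: "h \<in> borel_measurable borel" and l: "\<And>x. \<bar>h x - h 0\<bar> \<le> \<bar>x\<bar>"
  shows "\<bar>(\<integral>x. h x \<partial>\<mu>) - (\<integral>x. h x \<partial>D)\<bar> \<le> (\<integral>x. \<bar>x\<bar> \<partial>\<mu>) + (\<integral>x. \<bar>x\<bar> \<partial>D)"
    and "integrable \<mu> h" "integrable D h"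
  using dickman_integrable_lipschitz[OF m l \<mu>(1,2,4)]
    dickman_integrable_lipschitz[OF m l D_facts(1,2) dickman_law_mean[OF theta D]] by auto

text \<open>With v the multiplier, homogeneity reads
  \<open>hinge s (v * (x + 1)) = v * hinge (s / v - 1) x\<close>. A step thus turns a hinge into a
  mixture of hinges of total mass E V, and the class of all hinges is closed up to that
  factor.\<close>

lemma integral_step_hinge:
  assumes N: "prob_space N" "sets N = sets borel" "AE x in N. 0 \<le> x"
  shows "(\<integral>x. dickman_step \<theta> (hinge s) x \<partial>N)
      = (\<integral>u. u powr (1 / \<theta>) * (\<integral>x. hinge (s / u powr (1 / \<theta>) - 1) x \<partial>N) \<partial>unif01)"
    and "integrable unif01 (\<lambda>u. u powr (1 / \<theta>) * (\<integral>x. hinge (s / u powr (1 / \<theta>) - 1) x \<partial>N))"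
proof -
  interpret N: prob_space N by fact
  have [measurable_cong]: "sets N = sets borel" by fact
  interpret P: pair_prob_space unif01 N ..
  let ?F = "\<lambda>u x. max 0 (s - u powr (1 / \<theta>) * (x + 1))"
  have ae: "AE p in unif01 \<Otimes>\<^sub>M N. norm (case_prod ?F p) \<le> \<bar>s\<bar>"
  proof (rule P.AE_pair_measure)
    show "{p \<in> space (unif01 \<Otimes>\<^sub>M N). norm (case_prod ?F p) \<le> \<bar>s\<bar>} \<in> sets (unif01 \<Otimes>\<^sub>M N)" by measurable
    show "AE u in unif01. AE x in N. norm (case_prod ?F (u, x)) \<le> \<bar>s\<bar>"
    proof (rule AE_I2)
      fix u
      show "AE x in N. norm (case_prod ?F (u, x)) \<le> \<bar>s\<bar>"
      proof (rule eventually_mono[OF N(3)])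
        fix x :: real assume "0 \<le> x"
        then have "0 \<le> u powr (1 / \<theta>) * (x + 1)" by simp
        then show "norm (case_prod ?F (u, x)) \<le> \<bar>s\<bar>" by (simp add: abs_le_iff)
      qed
    qed
  qed
  have i: "integrable (unif01 \<Otimes>\<^sub>M N) (case_prod ?F)"
    by (rule P.integrable_const_bound[OF ae]) measurable
  have inner: "(\<integral>x. ?F u x \<partial>N) = u powr (1 / \<theta>) * (\<integral>x. hinge (s / u powr (1 / \<theta>) - 1) x \<partial>N)" if "0 < u" "u < 1" for u
  proof -
    have "?F u x = u powr (1 / \<theta>) * hinge (s / u powr (1 / \<theta>) - 1) x" for x
    proof -
      have "s - u powr (1 / \<theta>) * (x + 1) = u powr (1 / \<theta>) * (s / u powr (1 / \<theta>) - 1 - x)"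
        using that by (simp add: field_simps)
      then show ?thesis unfolding hinge_def by (simp only: max_mult_distrib_left) (simp add: mult_le_0_iff)
    qed
    then show ?thesis by simp
  qed
  have m1: "(\<lambda>u. \<integral>x. ?F u x \<partial>N) \<in> borel_measurable borel" by measurable
  have m2: "(\<lambda>u. u powr (1 / \<theta>) * (\<integral>x. hinge (s / u powr (1 / \<theta>) - 1) x \<partial>N)) \<in> borel_measurable borel"
    unfolding hinge_def by measurable
  have "(\<integral>x. dickman_step \<theta> (hinge s) x \<partial>N) = (\<integral>x. (\<integral>u. ?F u x \<partial>unif01) \<partial>N)"
    by (simp add: dickman_avg_def hinge_def)
  also have "\<dots> = (\<integral>u. (\<integral>x. ?F u x \<partial>N) \<partial>unif01)" by (rule P.Fubini_integral[OF i])
  also have "\<dots> = (\<integral>u. u powr (1 / \<theta>) * (\<integral>x. hinge (s / u powr (1 / \<theta>) - 1) x \<partial>N) \<partial>unif01)"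
    by (rule integral_unif01_cong[OF m1 m2 inner])
  finally show "(\<integral>x. dickman_step \<theta> (hinge s) x \<partial>N)
      = (\<integral>u. u powr (1 / \<theta>) * (\<integral>x. hinge (s / u powr (1 / \<theta>) - 1) x \<partial>N) \<partial>unif01)" .
  have "integrable unif01 (\<lambda>u. \<integral>x. ?F u x \<partial>N)" using P.integrable_fst[OF i] by simp
  then show "integrable unif01 (\<lambda>u. u powr (1 / \<theta>) * (\<integral>x. hinge (s / u powr (1 / \<theta>) - 1) x \<partial>N))"
  proof (rule integrable_cong_AE_imp)
    show "AE u in unif01. (\<integral>x. ?F u x \<partial>N) = u powr (1 / \<theta>) * (\<integral>x. hinge (s / u powr (1 / \<theta>) - 1) x \<partial>N)"
      by (rule eventually_mono[OF AE_unif01]) (use inner in auto)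
    show "(\<lambda>u. u powr (1 / \<theta>) * (\<integral>x. hinge (s / u powr (1 / \<theta>) - 1) x \<partial>N)) \<in> borel_measurable unif01"
      by (subst measurable_cong_sets[OF sets_unif01 refl]) (rule m2)
  qed
qed

lemma step_hinge_difference:
  assumes e: "\<And>s. \<bar>(\<integral>x. hinge s x \<partial>\<mu>) - (\<integral>x. hinge s x \<partial>D)\<bar> \<le> e"
  shows "\<bar>(\<integral>x. dickman_step \<theta> (hinge s) x \<partial>\<mu>) - (\<integral>x. dickman_step \<theta> (hinge s) x \<partial>D)\<bar> \<le> \<theta> / (\<theta> + 1) * e"
proof -
  note i\<mu> = integral_step_hinge[OF \<mu>(1-3), of s]
  note iD = integral_step_hinge[OF D_facts(1,2,4), of s]
  let ?H = "\<lambda>N u. \<integral>x. hinge (s / u powr (1 / \<theta>) - 1) x \<partial>N"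
  have e0: "e \<ge> 0" using e[of 0] by linarith
  have eq: "(\<integral>x. dickman_step \<theta> (hinge s) x \<partial>\<mu>) - (\<integral>x. dickman_step \<theta> (hinge s) x \<partial>D)
    = (\<integral>u. u powr (1 / \<theta>) * ?H \<mu> u - u powr (1 / \<theta>) * ?H D u \<partial>unif01)"
    using i\<mu> iD by simp
  have "\<bar>\<integral>u. u powr (1 / \<theta>) * ?H \<mu> u - u powr (1 / \<theta>) * ?H D u \<partial>unif01\<bar>
      \<le> (\<integral>u. \<bar>u powr (1 / \<theta>) * ?H \<mu> u - u powr (1 / \<theta>) * ?H D u\<bar> \<partial>unif01)"
    by (rule integral_abs_bound)
  also have "\<dots> \<le> (\<integral>u. u powr (1 / \<theta>) * e \<partial>unif01)"
  proof (rule integral_unif01_mono)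
    show "integrable unif01 (\<lambda>u. u powr (1 / \<theta>) * e)"
      by (rule abs_integral_powr_le(2)[OF theta, where K=e]) (use e0 in auto)
    show "\<bar>u powr (1 / \<theta>) * ?H \<mu> u - u powr (1 / \<theta>) * ?H D u\<bar> \<le> u powr (1 / \<theta>) * e" for u
      unfolding right_diff_distrib[symmetric] abs_mult using e by (auto intro!: mult_left_mono)
  qed (use i\<mu> iD in auto)
  finally show ?thesis unfolding eq by (simp add: integral_unif01_powr[OF theta])
qed

lemma hinge_difference:
  assumes k: "\<And>s. \<bar>(\<integral>x. hinge s x \<partial>\<mu>) - (\<integral>x. dickman_step \<theta> (hinge s) x \<partial>\<mu>)\<bar> \<le> \<kappa>"
  shows "\<bar>(\<integral>x. hinge s x \<partial>\<mu>) - (\<integral>x. hinge s x \<partial>D)\<bar> \<le> \<kappa> * (\<theta> + 1)"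
proof -
  have l: "\<bar>hinge s x - hinge s 0\<bar> \<le> \<bar>x\<bar>" for s x using hinge_lipschitz[of s x 0] by simp
  note ld = lipschitz_difference[OF hinge_measurable l]
  have "\<bar>(\<integral>x. hinge s x \<partial>\<mu>) - (\<integral>x. hinge s x \<partial>D)\<bar> \<le> \<kappa> / (1 - \<theta> / (\<theta> + 1))"
  proof (rule contraction_bound[where C=UNIV and \<Delta>="\<lambda>s. \<bar>(\<integral>x. hinge s x \<partial>\<mu>) - (\<integral>x. hinge s x \<partial>D)\<bar>"])
    fix e s assume "\<And>j. j \<in> UNIV \<Longrightarrow> \<bar>(\<integral>x. hinge j x \<partial>\<mu>) - (\<integral>x. hinge j x \<partial>D)\<bar> \<le> e"
    then have "\<bar>(\<integral>x. dickman_step \<theta> (hinge s) x \<partial>\<mu>) - (\<integral>x. dickman_step \<theta> (hinge s) x \<partial>D)\<bar> \<le> \<theta> / (\<theta> + 1) * e"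
      by (intro step_hinge_difference) auto
    moreover have "(\<integral>x. hinge s x \<partial>D) = (\<integral>x. dickman_step \<theta> (hinge s) x \<partial>D)"
      by (rule dickman_law_integral(1)[OF D hinge_measurable ld(3)])
    ultimately show "\<bar>(\<integral>x. hinge s x \<partial>\<mu>) - (\<integral>x. hinge s x \<partial>D)\<bar> \<le> \<kappa> + \<theta> / (\<theta> + 1) * e"
      using k[of s] by linarith
  qed (use ld(1) theta in auto)
  also have "1 - \<theta> / (\<theta> + 1) = 1 / (\<theta> + 1)" using theta by (simp add: field_simps)
  finally show ?thesis by simp
qed

lemma smooth_difference:
  assumes k: "\<And>h h'. smooth_test h h' \<Longrightarrow> \<bar>(\<integral>x. h x \<partial>\<mu>) - (\<integral>x. dickman_step \<theta> h x \<partial>\<mu>)\<bar> \<le> \<kappa>"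
    and h: "smooth_test h h'"
  shows "\<bar>(\<integral>x. h x \<partial>\<mu>) - (\<integral>x. h x \<partial>D)\<bar> \<le> \<kappa> * (\<theta> + 1)"
proof -
  let ?C = "{h. \<exists>h'. smooth_test h h'}"
  let ?d = "\<lambda>h. \<bar>(\<integral>x. h x \<partial>\<mu>) - (\<integral>x. h x \<partial>D)\<bar>"
  have ld: "?d h \<le> (\<integral>x. \<bar>x\<bar> \<partial>\<mu>) + (\<integral>x. \<bar>x\<bar> \<partial>D)" "integrable \<mu> h" "integrable D h" "h \<in> borel_measurable borel"
    if C: "h \<in> ?C" for h
  proof -
    obtain h' where h': "smooth_test h h'" using C by blast
    have l: "\<bar>h x - h 0\<bar> \<le> \<bar>x\<bar>" for x using smooth_test_continuous(5)[OF h', of x 0] by simp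
    from lipschitz_difference[OF smooth_test_continuous(3)[OF h'] l] smooth_test_continuous(3)[OF h']
    show "?d h \<le> (\<integral>x. \<bar>x\<bar> \<partial>\<mu>) + (\<integral>x. \<bar>x\<bar> \<partial>D)" "integrable \<mu> h" "integrable D h" "h \<in> borel_measurable borel"
      by auto
  qed
  have "?d h \<le> \<kappa> / (1 - \<theta> / (\<theta> + 1))"
  proof (rule contraction_bound[where C="?C" and \<Delta>="?d" and i=h])
    fix e g assume e: "\<And>j. j \<in> ?C \<Longrightarrow> ?d j \<le> e" and g: "g \<in> ?C"
    then obtain g' where g': "smooth_test g g'" by auto
    let ?\<rho> = "\<theta> / (\<theta> + 1)"
    \<comment> \<open>The rescaled step is again a member of the class, so the assumed bound applies
      to it; undoing the scaling gives the factor \<rho>.\<close>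
    have "?d (\<lambda>x. dickman_step \<theta> g x / ?\<rho>) \<le> e"
      using smooth_test_dickman_step[OF theta g'] by (intro e) blast
    then have "\<bar>(\<integral>x. dickman_step \<theta> g x \<partial>\<mu>) - (\<integral>x. dickman_step \<theta> g x \<partial>D)\<bar> / ?\<rho> \<le> e"
      using theta by (simp only: integral_divide_zero diff_divide_distrib[symmetric] abs_divide) simp
    then have "\<bar>(\<integral>x. dickman_step \<theta> g x \<partial>\<mu>) - (\<integral>x. dickman_step \<theta> g x \<partial>D)\<bar> \<le> ?\<rho> * e"
      using theta by (subst (asm) pos_divide_le_eq) (auto simp: mult.commute)
    moreover have "(\<integral>x. g x \<partial>D) = (\<integral>x. dickman_step \<theta> g x \<partial>D)"
      using ld[OF g] by (intro dickman_law_integral(1)[OF D]) auto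
    ultimately show "?d g \<le> \<kappa> + ?\<rho> * e" using k[OF g'] by linarith
  qed (use ld(1) theta h in auto)
  also have "1 - \<theta> / (\<theta> + 1) = 1 / (\<theta> + 1)" using theta by (simp add: field_simps)
  finally show ?thesis by simp
qed

text \<open>One step replaces the indicator by an averaged hinge and a plain hinge. With
  \<open>e = \<kappa> * (\<theta> + 1)\<close> the former contributes at most
  \<open>(\<theta> + 1) * (\<theta> / (\<theta> + 1) * e)\<close> and the latter at most
  \<open>\<theta> * e\<close>, which is the term
  \<open>2 * \<theta> * (\<theta> + 1) * \<kappa>\<close>.\<close>

lemma cdf_difference:
  assumes k: "\<And>s. \<bar>(\<integral>x. hinge s x \<partial>\<mu>) - (\<integral>x. dickman_step \<theta> (hinge s) x \<partial>\<mu>)\<bar> \<le> \<kappa>"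
    and k1: "\<bar>(\<integral>x. indicator {..t} x \<partial>\<mu>) - (\<integral>x. dickman_step \<theta> (indicator {..t}) x \<partial>\<mu>)\<bar> \<le> \<kappa>'"
    and t: "t \<ge> 0"
  shows "\<bar>cdf \<mu> t - cdf D t\<bar> \<le> \<kappa>' + 2 * \<theta> * (\<theta> + 1) * \<kappa>"
proof -
  interpret \<mu>: prob_space \<mu> by (rule \<mu>(1))
  interpret D: prob_space D using D_facts by simp
  have [measurable_cong]: "sets \<mu> = sets borel" "sets D = sets borel" by (rule \<mu>(2), rule D_facts(2))
  have sp: "space \<mu> = UNIV" "space D = UNIV" using sets_eq_imp_space_eq[OF \<mu>(2)] D_facts(3) by auto
  define e where "e = \<kappa> * (\<theta> + 1)"
  have hd: "\<bar>(\<integral>x. hinge s x \<partial>\<mu>) - (\<integral>x. hinge s x \<partial>D)\<bar> \<le> e" for s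
    unfolding e_def by (rule hinge_difference[OF k])
  have e0: "e \<ge> 0" using hd[of 0] by linarith
  have intD: "(\<integral>x. indicator {..t} x \<partial>D) = (\<integral>x. dickman_step \<theta> (indicator {..t}) x \<partial>D)"
    by (rule dickman_law_integral(1)[OF D]) (auto intro!: D.integrable_const_bound[where B=1])
  have l: "\<bar>hinge s x - hinge s 0\<bar> \<le> \<bar>x\<bar>" for s x using hinge_lipschitz[of s x 0] by simp
  note ld = lipschitz_difference[OF hinge_measurable l]
  have step: "\<bar>(\<integral>x. dickman_step \<theta> (indicator {..t}) x \<partial>\<mu>) - (\<integral>x. dickman_step \<theta> (indicator {..t}) x \<partial>D)\<bar> \<le> 2 * \<theta> * e"
  \<comment> \<open>The hinge formula divides by \<open>t\<close>; at \<open>t = 0\<close> the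
    averaged indicator vanishes on the whole half-line anyway.\<close>
  proof (cases "t = 0")
    case True
    have z: "dickman_step \<theta> (indicator {..t}) x = 0" if "x \<ge> 0" for x
      using dickman_avg_atMost[OF theta, of 0 "x + 1"] that True by simp
    have "(\<integral>x. dickman_step \<theta> (indicator {..t}) x \<partial>\<mu>) = (\<integral>x. 0 \<partial>\<mu>)"
      by (rule integral_cong_AE) (use z \<mu>(3) in \<open>auto elim!: eventually_mono\<close>)
    moreover have "(\<integral>x. dickman_step \<theta> (indicator {..t}) x \<partial>D) = (\<integral>x. 0 \<partial>D)"
      by (rule integral_cong_AE) (use z D_facts(4) in \<open>auto elim!: eventually_mono\<close>)
    ultimately show ?thesis using theta e0 by simp
  next
    case False
    with t have t: "t > 0" by simp
    let ?c = "max 1 t"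
    let ?K = "(\<theta> + 1) / ?c * (t / ?c) powr \<theta>"
    have K: "0 \<le> ?K" "?K \<le> \<theta> + 1"
    proof -
      have "(t / ?c) powr \<theta> \<le> 1" using t theta by (intro powr_le1) auto
      moreover have "(\<theta> + 1) / ?c \<le> \<theta> + 1" using theta by (simp add: divide_le_eq)
      ultimately have "?K \<le> (\<theta> + 1) * 1" using theta by (intro mult_mono) auto
      then show "?K \<le> \<theta> + 1" by simp
    qed (use theta in auto)
    have int: "(\<integral>x. dickman_step \<theta> (indicator {..t}) x \<partial>N)
        = ?K * (\<integral>x. dickman_step \<theta> (hinge ?c) x \<partial>N) - \<theta> / t * (\<integral>x. hinge (t - 1) x \<partial>N)"
      if N: "prob_space N" "sets N = sets borel" "AE x in N. 0 \<le> x" "integrable N (hinge (t - 1))" for N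
    proof -
      interpret N: prob_space N by fact
      have [measurable_cong]: "sets N = sets borel" by fact
      have "integrable N (\<lambda>x. dickman_step \<theta> (hinge ?c) x)"
      proof (rule N.integrable_const_bound[where B="?c"])
        show "AE x in N. norm (dickman_step \<theta> (hinge ?c) x) \<le> ?c"
        proof (rule eventually_mono[OF N(3)])
          fix x :: real assume x: "0 \<le> x"
          have b: "0 \<le> hinge ?c (u powr (1 / \<theta>) * (x + 1)) \<and> hinge ?c (u powr (1 / \<theta>) * (x + 1)) \<le> ?c" for u
            using x t by (auto simp: hinge_def)
          have i: "integrable unif01 (\<lambda>u. hinge ?c (u powr (1 / \<theta>) * (x + 1)))"
            by (rule integrable_unif01_bounded[where B="?c"]) (use b in \<open>auto simp: abs_le_iff intro: order_trans[OF _ b[THEN conjunct1]]\<close>)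
          have "(\<integral>u. hinge ?c (u powr (1 / \<theta>) * (x + 1)) \<partial>unif01) \<le> (\<integral>u. ?c \<partial>unif01)"
            by (rule integral_unif01_mono[OF i]) (use b in auto)
          moreover have "0 \<le> (\<integral>u. hinge ?c (u powr (1 / \<theta>) * (x + 1)) \<partial>unif01)"
            by (rule Bochner_Integration.integral_nonneg) (use b in auto)
          ultimately show "norm (dickman_step \<theta> (hinge ?c) x) \<le> ?c" by (simp add: dickman_avg_def)
        qed
      qed measurable
      moreover have "(\<integral>x. dickman_step \<theta> (indicator {..t}) x \<partial>N)
          = (\<integral>x. ?K * dickman_step \<theta> (hinge ?c) x - \<theta> / t * hinge (t - 1) x \<partial>N)"
        by (rule integral_cong_AE)
          (use dickman_step_atMost_eq_hinge[OF theta t] in \<open>auto intro!: eventually_mono[OF N(3)]\<close>)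
      ultimately show ?thesis using N(4) by simp
    qed
    note i\<mu> = int[OF \<mu>(1-3) ld(2)] and iD = int[OF D_facts(1,2,4) ld(3)]
    have b1: "\<bar>(\<integral>x. dickman_step \<theta> (hinge ?c) x \<partial>\<mu>) - (\<integral>x. dickman_step \<theta> (hinge ?c) x \<partial>D)\<bar> \<le> \<theta> / (\<theta> + 1) * e"
      by (rule step_hinge_difference[OF hd])
    have b2: "\<bar>\<theta> / t * ((\<integral>x. hinge (t - 1) x \<partial>\<mu>) - (\<integral>x. hinge (t - 1) x \<partial>D))\<bar> \<le> \<theta> * e"
    proof (cases "t \<ge> 1")
      case True
      have "\<theta> / t \<le> \<theta>" using True theta by (simp add: divide_le_eq)
      then have "\<theta> / t * \<bar>(\<integral>x. hinge (t - 1) x \<partial>\<mu>) - (\<integral>x. hinge (t - 1) x \<partial>D)\<bar> \<le> \<theta> * e"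
        by (rule mult_mono[OF _ hd]) (use theta in auto)
      then show ?thesis using theta t by (simp only: abs_mult abs_of_nonneg[of "\<theta> / t"] zero_le_divide_iff) simp
    next
      case False
      \<comment> \<open>The large coefficient \<open>\<theta> / t\<close> is harmless for
        \<open>t < 1\<close> because its hinge vanishes on the half-line.\<close>
      have z: "hinge (t - 1) x = 0" if "x \<ge> 0" for x using that False by (simp add: hinge_def)
      have "(\<integral>x. hinge (t - 1) x \<partial>\<mu>) = (\<integral>x. 0 \<partial>\<mu>)"
        by (rule integral_cong_AE) (use z in \<open>auto intro!: eventually_mono[OF \<mu>(3)]\<close>)
      moreover have "(\<integral>x. hinge (t - 1) x \<partial>D) = (\<integral>x. 0 \<partial>D)"
        by (rule integral_cong_AE) (use z in \<open>auto intro!: eventually_mono[OF D_facts(4)]\<close>)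
      ultimately show ?thesis using theta e0 by simp
    qed
    have "\<bar>?K * ((\<integral>x. dickman_step \<theta> (hinge ?c) x \<partial>\<mu>) - (\<integral>x. dickman_step \<theta> (hinge ?c) x \<partial>D))\<bar> \<le> (\<theta> + 1) * (\<theta> / (\<theta> + 1) * e)"
      unfolding abs_mult[of ?K] abs_of_nonneg[OF K(1)] by (rule mult_mono[OF K(2) b1]) (use theta in auto)
    also have "\<dots> = \<theta> * e" using theta by simp
    finally show ?thesis using b2 unfolding i\<mu> iD by (simp only: right_diff_distrib) linarith
  qed
  have "cdf \<mu> t = (\<integral>x. indicator {..t} x \<partial>\<mu>)" "cdf D t = (\<integral>x. indicator {..t} x \<partial>D)"
    by (simp_all add: cdf_def sp)
  then have "\<bar>cdf \<mu> t - cdf D t\<bar> \<le> \<kappa>' + 2 * \<theta> * e" using step k1 intD by linarith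
  then show ?thesis by (simp add: e_def ac_simps)
qed

end

subsection \<open>Deviations of the random weights\<close>

text \<open>Starting at 0 gives the maximum of the positive parts. It depends on the past only and
  is nonnegative, as the pathwise inequality requires.\<close>

fun running_max :: "(nat \<Rightarrow> real) \<Rightarrow> nat \<Rightarrow> real" where
  "running_max s 0 = 0"
| "running_max s (Suc k) = max (running_max s k) (s (Suc k))"

lemma running_max_nonneg: "0 \<le> running_max s m"
  by (induction m) auto

lemma running_max_upper: "1 \<le> k \<Longrightarrow> k \<le> m \<Longrightarrow> s k \<le> running_max s m"
  by (induction m) (auto simp: le_Suc_eq)

lemma running_max_le_sum: "running_max s m \<le> (\<Sum>k=1..m. \<bar>s k\<bar>)"
proof (induction m)
  case (Suc m)
  have "0 \<le> (\<Sum>k=1..m. \<bar>s k\<bar>)" by (intro sum_nonneg) auto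
  moreover have "(\<Sum>k=1..Suc m. \<bar>s k\<bar>) = (\<Sum>k=1..m. \<bar>s k\<bar>) + \<bar>s (Suc m)\<bar>" by simp
  ultimately show ?case using Suc unfolding running_max.simps by linarith
qed simp

lemma running_max_cong: "(\<And>k. 1 \<le> k \<Longrightarrow> k \<le> m \<Longrightarrow> s k = t k) \<Longrightarrow> running_max s m = running_max t m"
  by (induction m) auto

lemma running_max_measurable:
  "(\<And>k. 1 \<le> k \<Longrightarrow> k \<le> m \<Longrightarrow> S k \<in> borel_measurable N) \<Longrightarrow> (\<lambda>\<omega>. running_max (\<lambda>k. S k \<omega>) m) \<in> borel_measurable N"
  by (induction m) auto

text \<open>A pathwise form of Doob's maximal inequality: for a martingale \<open>s\<close> the sum on the right
  has mean zero.\<close>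

lemma running_max_square_le:
  assumes "s 0 = 0"
  shows "(running_max s m)\<^sup>2 \<le> 4 * (s m)\<^sup>2 - 4 * (\<Sum>k<m. running_max s k * (s (Suc k) - s k))"
proof -
  have "(running_max s m)\<^sup>2 \<le> 2 * running_max s m * s m - 2 * (\<Sum>k<m. running_max s k * (s (Suc k) - s k))"
  proof (induction m)
    case (Suc m)
    define P where "P = running_max s m"
    define Q where "Q = running_max s (Suc m)"
    \<comment> \<open>The maximum increases only when it is attained at the new point, where
      \<open>Q = s (Suc m)\<close> and the gap is the square of \<open>Q - P\<close>.\<close>
    have "Q\<^sup>2 - P\<^sup>2 \<le> 2 * (Q - P) * s (Suc m)"
    proof (cases "s (Suc m) \<le> P")
      case True
      then have "Q = P" by (simp add: Q_def P_def)
      then show ?thesis by simp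
    next
      case False
      then have Q: "Q = s (Suc m)" by (simp add: Q_def P_def)
      have "2 * (Q - P) * s (Suc m) - (Q\<^sup>2 - P\<^sup>2) = (Q - P)\<^sup>2"
        unfolding Q by (simp add: power2_eq_square algebra_simps)
      then show ?thesis using zero_le_power2[of "Q - P"] by linarith
    qed
    moreover have "2 * Q * s (Suc m) = 2 * (Q - P) * s (Suc m) + 2 * P * s m + 2 * (P * (s (Suc m) - s m))"
      by (simp add: algebra_simps)
    moreover have "P\<^sup>2 \<le> 2 * P * s m - 2 * (\<Sum>k<m. running_max s k * (s (Suc k) - s k))"
      using Suc by (simp add: P_def)
    ultimately show ?case unfolding Q_def[symmetric] sum.lessThan_Suc P_def[symmetric] by (simp add: algebra_simps)
  qed (use assms in simp)
  \<comment> \<open>The square of \<open>running_max s m - 2 * s m\<close> is nonnegative; half of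
    the squared maximum is thereby absorbed on the left, which produces the constant 4.\<close>
  moreover have "2 * running_max s m * s m \<le> (running_max s m)\<^sup>2 / 2 + 2 * (s m)\<^sup>2"
    using zero_le_power2[of "running_max s m - 2 * s m"] by (simp add: power2_diff) 
  ultimately show ?thesis by linarith
qed

lemma sum_inverse_le_ln:
  assumes "m \<ge> 1"
  shows "(\<Sum>k=1..m. 1 / real k) \<le> 1 + ln (real m)"
  using assms
proof (induction m rule: nat_induct_at_least)
  case (Suc m)
  have "ln (real m / real (Suc m)) \<le> real m / real (Suc m) - 1"
    using Suc by (intro ln_le_minus_one) simp
  also have "\<dots> = - (1 / real (Suc m))" by (simp add: field_simps)
  finally have "1 / real (Suc m) \<le> ln (real (Suc m)) - ln (real m)" using Suc by (simp add: ln_div)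
  then show ?case using Suc by simp
qed simp

text \<open>Writing \<open>x\<close> for the left-hand side, \<open>x \<le> B + \<epsilon> * (1 + x)\<close> absorbs \<open>x\<close> when \<open>\<epsilon> \<le> 1 / 2\<close>; the logarithm
  only enters through the crude bound used on the event \<open>\<epsilon> > 1 / 2\<close>.\<close>

lemma ratio_weight_dev:
  fixes S :: "nat \<Rightarrow> real"
  assumes n: "n \<ge> 1" and S: "\<And>k. 1 \<le> k \<Longrightarrow> k \<le> n \<Longrightarrow> 0 \<le> S k" "\<And>k. 1 \<le> k \<Longrightarrow> k \<le> n \<Longrightarrow> S k \<le> S n"
    and Sn: "S n > 0"
  defines "B \<equiv> (\<Sum>k=1..n. \<bar>S k - k\<bar> / (real n * k))" and "\<epsilon> \<equiv> \<bar>S n - n\<bar> / n"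
  shows "(\<Sum>k=1..n. \<bar>S k / S n / k - 1 / n\<bar>) \<le> 2 * B + 2 * \<epsilon> + 12 * ln n * \<epsilon>\<^sup>2"
proof -
  define x where "x = (\<Sum>k=1..n. \<bar>S k / S n / k - 1 / n\<bar>)"
  have B0: "B \<ge> 0" unfolding B_def by (intro sum_nonneg) auto
  have e0: "\<epsilon> \<ge> 0" by (simp add: \<epsilon>_def)
  have ln0: "ln (real n) \<ge> 0" using n by simp
  have "x \<le> B + \<epsilon> * (\<Sum>k=1..n. S k / S n / k)"
  proof -
    have "\<bar>S k / S n / k - 1 / n\<bar> \<le> \<bar>S k - k\<bar> / (real n * k) + \<epsilon> * (S k / S n / k)" if k: "k \<in> {1..n}" for k
    proof -
      \<comment> \<open>Replacing the random normalizer by \<open>n\<close> changes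
        \<open>S k / S n\<close> by itself times the relative error of \<open>S n\<close>.\<close>
      have "S k / S n / k - 1 / n = (S k - k) / (real n * k) + (S k / S n / k) * ((n - S n) / n)"
        using k n Sn by (simp add: field_simps)
      then have "\<bar>S k / S n / k - 1 / n\<bar> \<le> \<bar>(S k - k) / (real n * k)\<bar> + \<bar>(S k / S n / k) * ((n - S n) / n)\<bar>"
        by (metis abs_triangle_ineq)
      also have "\<bar>(S k - k) / (real n * k)\<bar> = \<bar>S k - k\<bar> / (real n * k)" by (simp add: abs_mult)
      also have "\<bar>(S k / S n / k) * ((n - S n) / n)\<bar> = \<epsilon> * (S k / S n / k)"
        using S(1)[of k] k Sn by (simp add: \<epsilon>_def abs_mult abs_minus_commute ac_simps)
      finally show ?thesis .
    qed
    then have "x \<le> (\<Sum>k=1..n. \<bar>S k - k\<bar> / (real n * k) + \<epsilon> * (S k / S n / k))"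
      unfolding x_def by (intro sum_mono) auto
    then show ?thesis by (simp only: sum.distrib B_def sum_distrib_left)
  qed
  moreover have "(\<Sum>k=1..n. S k / S n / k) \<le> 1 + x"
  proof -
    have "(\<Sum>k=1..n. S k / S n / k) \<le> (\<Sum>k=1..n. 1 / n + \<bar>S k / S n / k - 1 / n\<bar>)"
      by (intro sum_mono) linarith
    also have "\<dots> = 1 + x" using n by (simp add: sum.distrib x_def)
    finally show ?thesis .
  qed
  ultimately have main: "x \<le> B + \<epsilon> * (1 + x)" using e0 mult_left_mono by fastforce
  have "x \<le> 2 * B + 2 * \<epsilon> + 12 * ln n * \<epsilon>\<^sup>2"
  proof (cases "\<epsilon> \<le> 1 / 2")
    case True
    have x0: "x \<ge> 0" unfolding x_def by (intro sum_nonneg) auto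
    have "\<epsilon> * x \<le> 1 / 2 * x" using True x0 by (intro mult_right_mono) auto
    with main have "x \<le> 2 * B + 2 * \<epsilon>" by (simp add: distrib_left)
    moreover have "0 \<le> 12 * ln n * \<epsilon>\<^sup>2" using ln0 by simp
    ultimately show ?thesis by linarith
  next
    case False
    show ?thesis
    proof (cases "n = 1")
      case True
      \<comment> \<open>The logarithm is 0 at \<open>n = 1\<close>, so the crude bound is of no
        help; but the only weight is then exactly 1.\<close>
      then have "x = 0" using Sn by (simp add: x_def)
      then show ?thesis using B0 e0 True by simp
    next
      case f: False
      with n have n2: "n \<ge> 2" by simp
      \<comment> \<open>Both ratios lie between 0 and 1, so each summand is at most
        \<open>1 / k\<close>. The sum is at most \<open>1 + ln n \<le> 3 * ln n\<close> for
        \<open>n \<ge> 2\<close>, and \<open>\<epsilon>\<^sup>2 \<ge> 1 / 4\<close> turns 3 into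
        12.\<close>
      have "x \<le> (\<Sum>k=1..n. 1 / real k)"
        unfolding x_def
      proof (rule sum_mono)
        fix k assume k: "k \<in> {1..n}"
        have "0 \<le> S k / S n" "S k / S n \<le> 1" using S[of k] k Sn by auto
        moreover have "0 \<le> real k / n" "real k / n \<le> 1" using k by auto
        ultimately have "\<bar>S k / S n - real k / n\<bar> \<le> 1" by linarith
        moreover have "S k / S n / k - 1 / n = (S k / S n - real k / n) / k" using k by (simp add: field_simps)
        ultimately show "\<bar>S k / S n / k - 1 / n\<bar> \<le> 1 / real k" using k by (simp add: divide_right_mono)
      qed
      also have "\<dots> \<le> 1 + ln n" using n by (rule sum_inverse_le_ln)
      finally have "x \<le> 1 + ln n" .
      moreover have "1 \<le> 2 * ln (real n)"
      proof -
        have "1 / 2 \<le> ln (2 :: real)" using ln2_ge_two_thirds by simp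
        also have "\<dots> \<le> ln (real n)" using n2 by simp
        finally show ?thesis by simp
      qed
      moreover have "3 * ln (real n) \<le> 12 * ln n * \<epsilon>\<^sup>2"
      proof -
        have "(1 / 2)\<^sup>2 \<le> \<epsilon>\<^sup>2" using False by (intro power_mono) auto
        then have "12 * ln n * (1 / 4) \<le> 12 * ln n * \<epsilon>\<^sup>2"
          using ln0 by (intro mult_left_mono) (auto simp: power2_eq_square)
        then show ?thesis by simp
      qed
      ultimately show ?thesis using B0 e0 by linarith
    qed
  qed
  then show ?thesis by (simp add: x_def)
qed

text \<open>The variance of the absolute value is nonnegative.\<close>

lemma (in prob_space) expectation_abs_le_sqrt:
  fixes Z :: "'a \<Rightarrow> real"
  assumes Z: "Z \<in> borel_measurable M" and sq: "integrable M (\<lambda>\<omega>. (Z \<omega>)\<^sup>2)"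
  shows "integrable M Z" "expectation (\<lambda>\<omega>. \<bar>Z \<omega>\<bar>) \<le> sqrt (expectation (\<lambda>\<omega>. (Z \<omega>)\<^sup>2))"
proof -
  show i: "integrable M Z" using square_integrable_imp_integrable[OF Z sq] .
  have "0 \<le> variance (\<lambda>\<omega>. \<bar>Z \<omega>\<bar>)" by (rule variance_positive)
  also have "variance (\<lambda>\<omega>. \<bar>Z \<omega>\<bar>) = expectation (\<lambda>\<omega>. \<bar>Z \<omega>\<bar>\<^sup>2) - (expectation (\<lambda>\<omega>. \<bar>Z \<omega>\<bar>))\<^sup>2"
    using i sq by (intro variance_eq) auto
  finally have "(expectation (\<lambda>\<omega>. \<bar>Z \<omega>\<bar>))\<^sup>2 \<le> expectation (\<lambda>\<omega>. (Z \<omega>)\<^sup>2)" by simp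
  then show "expectation (\<lambda>\<omega>. \<bar>Z \<omega>\<bar>) \<le> sqrt (expectation (\<lambda>\<omega>. (Z \<omega>)\<^sup>2))" by (rule real_le_rsqrt)
qed

section \<open>Partial sums as a martingale\<close>

context weighted_poisson
begin

lemma Y_measurable: "1 \<le> i \<Longrightarrow> Y i \<in> borel_measurable M"
  using indep unfolding indep_vars_def by force

lemma partial_sum_measurable [measurable]: "partial_sum Y k \<in> borel_measurable M"
  unfolding partial_sum_def[abs_def] by (intro borel_measurable_sum Y_measurable) auto

lemma Y_centered_square:
  assumes "1 \<le> i"
  shows "integrable M (\<lambda>\<omega>. (Y i \<omega> - 1)\<^sup>2)" "expectation (\<lambda>\<omega>. (Y i \<omega> - 1)\<^sup>2) = (\<sigma> i)\<^sup>2"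
proof -
  have "integrable M (\<lambda>\<omega>. (Y i \<omega>)\<^sup>2 - 2 * Y i \<omega> + 1)"
    using Y_square_integrable[OF assms] Y_integrable[OF assms] by simp
  then show "integrable M (\<lambda>\<omega>. (Y i \<omega> - 1)\<^sup>2)"
    by (rule back_subst[where P="integrable M"]) (auto simp: power2_diff fun_eq_iff)
  show "expectation (\<lambda>\<omega>. (Y i \<omega> - 1)\<^sup>2) = (\<sigma> i)\<^sup>2"
    using Y_variance[OF assms] Y_mean[OF assms] by simp
qed

text \<open>The martingale property without a filtration: a functional of the first \<open>k\<close>
  variables is independent of the next centered increment. The factorization through
  \<open>F\<close> is what shows that \<open>g\<close> depends on the past only.\<close>

lemma indep_var_past:
  assumes F: "F \<in> borel_measurable (PiM (Inl ` {1..k}) (\<lambda>_. borel))"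
    and g: "\<And>\<omega>. g \<omega> = F (\<lambda>i\<in>Inl ` {1..k}. case_sum Y (\<lambda>k \<omega>. real (X k \<omega>)) i \<omega>)"
  shows "indep_var borel g borel (\<lambda>\<omega>. Y (Suc k) \<omega> - 1)"
proof -
  have "indep_var borel (F \<circ> (\<lambda>\<omega>. \<lambda>i\<in>Inl ` {1..k}. case_sum Y (\<lambda>k \<omega>. real (X k \<omega>)) i \<omega>))
      borel ((\<lambda>v. v (Inl (Suc k)) - 1) \<circ> (\<lambda>\<omega>. \<lambda>i\<in>{Inl (Suc k)}. case_sum Y (\<lambda>k \<omega>. real (X k \<omega>)) i \<omega>))"
    by (rule indep_var_compose[OF indep_var_restrict[OF indep]]) (use F in auto)
  moreover have "F \<circ> (\<lambda>\<omega>. \<lambda>i\<in>Inl ` {1..k}. case_sum Y (\<lambda>k \<omega>. real (X k \<omega>)) i \<omega>) = g"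
    by (simp add: fun_eq_iff g)
  moreover have "(\<lambda>v. v (Inl (Suc k)) - 1) \<circ> (\<lambda>\<omega>. \<lambda>i\<in>{Inl (Suc k)}. case_sum Y (\<lambda>k \<omega>. real (X k \<omega>)) i \<omega>)
      = (\<lambda>\<omega>. Y (Suc k) \<omega> - 1)" by (simp add: fun_eq_iff)
  ultimately show ?thesis by simp
qed

lemma past_times_increment:
  assumes ind: "indep_var borel g borel (\<lambda>\<omega>. Y (Suc k) \<omega> - 1)" and g: "integrable M g"
  shows "integrable M (\<lambda>\<omega>. g \<omega> * (Y (Suc k) \<omega> - 1))" "expectation (\<lambda>\<omega>. g \<omega> * (Y (Suc k) \<omega> - 1)) = 0"
proof -
  have i: "integrable M (\<lambda>\<omega>. Y (Suc k) \<omega> - 1)" using Y_integrable[of "Suc k"] by simp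
  have e: "expectation (\<lambda>\<omega>. Y (Suc k) \<omega> - 1) = 0"
    using Y_integrable[of "Suc k"] Y_mean[of "Suc k"] by (simp add: prob_space)
  show "integrable M (\<lambda>\<omega>. g \<omega> * (Y (Suc k) \<omega> - 1))" by (rule indep_var_integrable[OF ind g i])
  show "expectation (\<lambda>\<omega>. g \<omega> * (Y (Suc k) \<omega> - 1)) = 0"
    using indep_var_lebesgue_integral[OF ind g i] e by simp
qed

definition deviation :: "nat \<Rightarrow> 'a \<Rightarrow> real" where
  "deviation k \<omega> = partial_sum Y k \<omega> - real k"

lemma deviation_0 [simp]: "deviation 0 \<omega> = 0"
  and deviation_Suc: "deviation (Suc k) \<omega> = deviation k \<omega> + (Y (Suc k) \<omega> - 1)"
  by (simp_all add: deviation_def partial_sum_def)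

lemma deviation_measurable [measurable]: "deviation k \<in> borel_measurable M"
  unfolding deviation_def[abs_def] by measurable

lemma deviation_square:
  "integrable M (\<lambda>\<omega>. (deviation k \<omega>)\<^sup>2)" "expectation (\<lambda>\<omega>. (deviation k \<omega>)\<^sup>2) = (\<Sum>i=1..k. (\<sigma> i)\<^sup>2)"
proof -
  have "integrable M (\<lambda>\<omega>. (deviation k \<omega>)\<^sup>2) \<and> expectation (\<lambda>\<omega>. (deviation k \<omega>)\<^sup>2) = (\<Sum>i=1..k. (\<sigma> i)\<^sup>2)"
  proof (induction k)
    case (Suc k)
    have i: "integrable M (deviation k)" using expectation_abs_le_sqrt(1)[of "deviation k"] Suc by auto
    have "indep_var borel (deviation k) borel (\<lambda>\<omega>. Y (Suc k) \<omega> - 1)"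
    proof (rule indep_var_past[where F="\<lambda>v. (\<Sum>i=1..k. v (Inl i)) - real k"])
      show "(\<lambda>v. (\<Sum>i=1..k. v (Inl i)) - real k) \<in> borel_measurable (PiM (Inl ` {1..k}) (\<lambda>_. borel))"
        by (intro borel_measurable_diff borel_measurable_sum measurable_component_singleton) auto
    qed (simp add: deviation_def partial_sum_def)
    note p = past_times_increment[OF this i]
    have eq: "(deviation (Suc k) \<omega>)\<^sup>2 = (deviation k \<omega>)\<^sup>2 + 2 * (deviation k \<omega> * (Y (Suc k) \<omega> - 1)) + (Y (Suc k) \<omega> - 1)\<^sup>2" for \<omega>
      unfolding deviation_Suc by (simp only: power2_sum mult.assoc)
    have "expectation (\<lambda>\<omega>. (deviation (Suc k) \<omega>)\<^sup>2) = expectation (\<lambda>\<omega>. (deviation k \<omega>)\<^sup>2)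
       + 2 * expectation (\<lambda>\<omega>. deviation k \<omega> * (Y (Suc k) \<omega> - 1)) + expectation (\<lambda>\<omega>. (Y (Suc k) \<omega> - 1)\<^sup>2)"
      unfolding eq using Suc p(1) Y_centered_square(1)[of "Suc k"] by simp
    also have "\<dots> = (\<Sum>i=1..Suc k. (\<sigma> i)\<^sup>2)" using Suc p(2) Y_centered_square(2)[of "Suc k"] by simp
    finally have "expectation (\<lambda>\<omega>. (deviation (Suc k) \<omega>)\<^sup>2) = (\<Sum>i=1..Suc k. (\<sigma> i)\<^sup>2)" .
    moreover have "integrable M (\<lambda>\<omega>. (deviation (Suc k) \<omega>)\<^sup>2)"
      unfolding eq using Suc p(1) Y_centered_square(1)[of "Suc k"] by simp
    ultimately show ?case by simp
  qed simp
  then show "integrable M (\<lambda>\<omega>. (deviation k \<omega>)\<^sup>2)" "expectation (\<lambda>\<omega>. (deviation k \<omega>)\<^sup>2) = (\<Sum>i=1..k. (\<sigma> i)\<^sup>2)"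
    by auto
qed

lemma deviation_abs:
  "integrable M (deviation k)" "expectation (\<lambda>\<omega>. \<bar>deviation k \<omega>\<bar>) \<le> sqrt (\<Sum>i=1..k. (\<sigma> i)\<^sup>2)"
  using expectation_abs_le_sqrt[OF deviation_measurable deviation_square(1), of k] deviation_square(2)[of k] by auto

text \<open>The pathwise inequality is integrated; its sum has mean 0 because each increment is
  multiplied by a maximum over its past. The signs \<open>c = 1\<close> and \<open>c = - 1\<close>
  together control the absolute deviation.\<close>

lemma running_max_deviation:
  fixes c :: real
  assumes c: "\<bar>c\<bar> = 1"
  shows "integrable M (\<lambda>\<omega>. running_max (\<lambda>k. c * deviation k \<omega>) m)"
    and "expectation (\<lambda>\<omega>. running_max (\<lambda>k. c * deviation k \<omega>) m) \<le> 2 * sqrt (\<Sum>i=1..m. (\<sigma> i)\<^sup>2)"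
proof -
  let ?P = "\<lambda>k \<omega>. running_max (\<lambda>k. c * deviation k \<omega>) k"
  have [measurable]: "?P k \<in> borel_measurable M" for k
    by (rule running_max_measurable) measurable
  have iP: "integrable M (?P k)" for k
  proof (rule Bochner_Integration.integrable_bound[where f="\<lambda>\<omega>. \<Sum>j=1..k. \<bar>c * deviation j \<omega>\<bar>"])
    show "integrable M (\<lambda>\<omega>. \<Sum>j=1..k. \<bar>c * deviation j \<omega>\<bar>)"
      by (intro Bochner_Integration.integrable_sum integrable_abs integrable_mult_right deviation_abs)
    show "AE \<omega> in M. norm (?P k \<omega>) \<le> norm (\<Sum>j=1..k. \<bar>c * deviation j \<omega>\<bar>)"
    proof (rule AE_I2)
      fix \<omega>
      have "0 \<le> ?P k \<omega>" "?P k \<omega> \<le> (\<Sum>j=1..k. \<bar>c * deviation j \<omega>\<bar>)"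
        by (rule running_max_nonneg, rule running_max_le_sum)
      then show "norm (?P k \<omega>) \<le> norm (\<Sum>j=1..k. \<bar>c * deviation j \<omega>\<bar>)" by simp
    qed
  qed measurable
  show "integrable M (?P m)" by (rule iP)
  have ind: "indep_var borel (?P k) borel (\<lambda>\<omega>. Y (Suc k) \<omega> - 1)" for k
  proof (rule indep_var_past[where F="\<lambda>v. running_max (\<lambda>j. c * ((\<Sum>i=1..j. v (Inl i)) - real j)) k"])
    show "(\<lambda>v. running_max (\<lambda>j. c * ((\<Sum>i=1..j. v (Inl i)) - real j)) k) \<in> borel_measurable (PiM (Inl ` {1..k}) (\<lambda>_. borel))"
      by (intro running_max_measurable borel_measurable_times borel_measurable_const borel_measurable_diff
        borel_measurable_sum measurable_component_singleton) auto
  qed (auto simp: deviation_def partial_sum_def intro!: running_max_cong sum.cong)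
  note p = past_times_increment[OF ind iP]
  have le: "(?P m \<omega>)\<^sup>2 \<le> 4 * (deviation m \<omega>)\<^sup>2 - 4 * (\<Sum>k<m. c * (?P k \<omega> * (Y (Suc k) \<omega> - 1)))" for \<omega>
  proof -
    have "c\<^sup>2 = 1" using c by (metis power2_abs power_one)
    then have "(c * deviation m \<omega>)\<^sup>2 = (deviation m \<omega>)\<^sup>2" by (simp add: power_mult_distrib)
    moreover have "(\<Sum>k<m. ?P k \<omega> * (c * deviation (Suc k) \<omega> - c * deviation k \<omega>)) = (\<Sum>k<m. c * (?P k \<omega> * (Y (Suc k) \<omega> - 1)))"
      by (intro sum.cong) (simp_all add: deviation_Suc algebra_simps)
    ultimately show ?thesis using running_max_square_le[of "\<lambda>k. c * deviation k \<omega>" m] by simp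
  qed
  have iR: "integrable M (\<lambda>\<omega>. 4 * (deviation m \<omega>)\<^sup>2 - 4 * (\<Sum>k<m. c * (?P k \<omega> * (Y (Suc k) \<omega> - 1))))"
    by (intro Bochner_Integration.integrable_diff integrable_mult_right deviation_square
      Bochner_Integration.integrable_sum p(1))
  \<comment> \<open>Square integrability of the maximum comes from the pathwise bound
    itself.\<close>
  have sq: "integrable M (\<lambda>\<omega>. (?P m \<omega>)\<^sup>2)"
    by (rule Bochner_Integration.integrable_bound[OF iR])
      (use le in \<open>auto intro!: AE_I2 order_trans[OF _ abs_ge_self]\<close>)
  have "expectation (\<lambda>\<omega>. (?P m \<omega>)\<^sup>2) \<le> expectation (\<lambda>\<omega>. 4 * (deviation m \<omega>)\<^sup>2 - 4 * (\<Sum>k<m. c * (?P k \<omega> * (Y (Suc k) \<omega> - 1))))"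
    by (rule integral_mono[OF sq iR le])
  also have "\<dots> = 4 * (\<Sum>i=1..m. (\<sigma> i)\<^sup>2) - 4 * (\<Sum>k<m. c * expectation (\<lambda>\<omega>. ?P k \<omega> * (Y (Suc k) \<omega> - 1)))"
    by (subst Bochner_Integration.integral_diff)
      (simp_all add: deviation_square p(1) Bochner_Integration.integral_sum)
  also have "\<dots> = 4 * (\<Sum>i=1..m. (\<sigma> i)\<^sup>2)" by (simp add: p(2))
  finally have "sqrt (expectation (\<lambda>\<omega>. (?P m \<omega>)\<^sup>2)) \<le> sqrt (4 * (\<Sum>i=1..m. (\<sigma> i)\<^sup>2))" by simp
  also have "\<dots> = 2 * sqrt (\<Sum>i=1..m. (\<sigma> i)\<^sup>2)" by (simp add: real_sqrt_mult)
  finally have "sqrt (expectation (\<lambda>\<omega>. (?P m \<omega>)\<^sup>2)) \<le> 2 * sqrt (\<Sum>i=1..m. (\<sigma> i)\<^sup>2)" .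
  moreover have "expectation (?P m) = expectation (\<lambda>\<omega>. \<bar>?P m \<omega>\<bar>)"
    by (simp add: running_max_nonneg)
  ultimately show "expectation (?P m) \<le> 2 * sqrt (\<Sum>i=1..m. (\<sigma> i)\<^sup>2)"
    using expectation_abs_le_sqrt(2)[OF _ sq] by simp
qed

end

section \<open>Averaging over the random weights\<close>

text \<open>Serves to remove the tag \<open>Inr\<close> from the counts within the jointly
  independent family.\<close>

lemma (in prob_space) indep_vars_reindex:
  assumes inj: "inj_on f I" and ind: "indep_vars N Z (f ` I)"
  shows "indep_vars (\<lambda>i. N (f i)) (\<lambda>i. Z (f i)) I"
  unfolding indep_vars_def2
proof (intro conjI ballI)
  show "random_variable (N (f i)) (Z (f i))" if "i \<in> I" for i
    using ind that by (auto simp: indep_vars_def2)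
  have ind': "indep_sets (\<lambda>i. {Z i -` A \<inter> space M |A. A \<in> sets (N i)}) (f ` I)"
    using ind by (simp add: indep_vars_def2)
  show "indep_sets (\<lambda>i. {Z (f i) -` A \<inter> space M |A. A \<in> sets (N (f i))}) I"
  proof (rule indep_setsI)
    show "{Z (f i) -` A \<inter> space M |A. A \<in> sets (N (f i))} \<subseteq> events" if "i \<in> I" for i
      using ind' that unfolding indep_sets_def by blast
    fix A J assume J: "J \<noteq> {}" "J \<subseteq> I" "finite J"
      and A: "\<forall>j\<in>J. A j \<in> {Z (f j) -` A \<inter> space M |A. A \<in> sets (N (f j))}"
    define A' where "A' i = A (inv_into I f i)" for i
    have A': "A' (f j) = A j" if "j \<in> J" for j
      using that J inj by (auto simp: A'_def inv_into_f_f)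
    have injJ: "inj_on f J" using inj J by (rule_tac inj_on_subset)
    have "prob (\<Inter>i\<in>f ` J. A' i) = (\<Prod>i\<in>f ` J. prob (A' i))"
    proof (rule indep_setsD[OF ind'])
      show "\<forall>i\<in>f ` J. A' i \<in> {Z i -` A \<inter> space M |A. A \<in> sets (N i)}" using A A' by auto
    qed (use J in auto)
    moreover have "(\<Inter>i\<in>f ` J. A' i) = (\<Inter>j\<in>J. A j)" using A' by auto
    moreover have "(\<Prod>i\<in>f ` J. prob (A' i)) = (\<Prod>j\<in>J. prob (A j))"
      using A' by (subst prod.reindex[OF injJ]) auto
    ultimately show "prob (\<Inter>j\<in>J. A j) = (\<Prod>j\<in>J. prob (A j))" by simp
  qed
qed

text \<open>A substitute for Jensen's inequality at the price of a factor 2: for an exponent at most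
  1, \<open>(R / c) powr p \<le> 1 + R / c\<close>, and the mean of the right-hand side is at most
  2.\<close>

lemma powr_expectation_le:
  fixes R :: "'a \<Rightarrow> real" and p c :: real
  assumes "prob_space M" and R: "R \<in> borel_measurable M" "\<And>\<omega>. 0 < R \<omega>" "integrable M R"
    and p: "0 < p" "p \<le> 1" and c: "(\<integral>\<omega>. R \<omega> \<partial>M) \<le> c" "0 < c"
  shows "integrable M (\<lambda>\<omega>. R \<omega> powr p)" "(\<integral>\<omega>. R \<omega> powr p \<partial>M) \<le> 2 * c powr p"
proof -
  interpret prob_space M by fact
  note [measurable] = R(1)
  have le: "R \<omega> powr p \<le> c powr p * (1 + R \<omega> / c)" for \<omega>
  proof -
    have "(R \<omega> / c) powr p \<le> 1 + R \<omega> / c"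
    proof (cases "R \<omega> / c \<le> 1")
      case True
      then have "(R \<omega> / c) powr p \<le> 1" using R(2)[of \<omega>] c p by (intro powr_le1) auto
      moreover have "0 \<le> R \<omega> / c" using R(2)[of \<omega>] c by simp
      ultimately show ?thesis by linarith
    next
      case False
      then have "(R \<omega> / c) powr p \<le> (R \<omega> / c) powr 1" using p by (intro powr_mono) auto
      then show ?thesis using R(2)[of \<omega>] c by simp
    qed
    then have "c powr p * (R \<omega> / c) powr p \<le> c powr p * (1 + R \<omega> / c)" by (intro mult_left_mono) auto
    then show ?thesis using R(2)[of \<omega>] c by (simp add: powr_divide)
  qed
  have i: "integrable M (\<lambda>\<omega>. c powr p * (1 + R \<omega> / c))" using R(3) by simp
  show iR: "integrable M (\<lambda>\<omega>. R \<omega> powr p)"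
    by (rule Bochner_Integration.integrable_bound[OF i])
      (use le in \<open>auto intro!: AE_I2 order_trans[OF _ abs_ge_self]\<close>)
  have "(\<integral>\<omega>. R \<omega> powr p \<partial>M) \<le> (\<integral>\<omega>. c powr p * (1 + R \<omega> / c) \<partial>M)"
    by (rule integral_mono[OF iR i le])
  also have "\<dots> = c powr p * (1 + (\<integral>\<omega>. R \<omega> \<partial>M) / c)" using R(3) by (simp add: prob_space)
  also have "\<dots> \<le> c powr p * 2" using c by (intro mult_left_mono) (auto simp: divide_le_eq)
  finally show "(\<integral>\<omega>. R \<omega> powr p \<partial>M) \<le> 2 * c powr p" by simp
qed

lemma weight_measurable:
  assumes "\<And>i. 1 \<le> i \<Longrightarrow> i \<le> n \<Longrightarrow> Y i \<in> borel_measurable N" "k \<le> n"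
  shows "weight m Y n k \<in> borel_measurable N"
proof -
  have ps: "partial_sum Y j \<in> borel_measurable N" if "j \<le> n" for j
    unfolding partial_sum_def[abs_def] using that by (intro borel_measurable_sum assms(1)) auto
  have "normalizer m Y n \<in> borel_measurable N"
    unfolding normalizer_def[abs_def] using ps by (cases m) auto
  then show ?thesis
    unfolding weight_def[abs_def] using ps[OF assms(2)]
    by (intro borel_measurable_times borel_measurable_divide borel_measurable_const)
qed

text \<open>The two families may live on different sample spaces. With coordinate projections as the
  second family, the weights become functionals of the vector of the first \<open>n\<close>
  variables.\<close>

lemma weight_cong:
  assumes "\<And>i. 1 \<le> i \<Longrightarrow> i \<le> n \<Longrightarrow> Y i \<omega> = Y' i \<omega>'" "k \<le> n"
  shows "weight m Y n k \<omega> = weight m Y' n k \<omega>'"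
proof -
  have "partial_sum Y j \<omega> = partial_sum Y' j \<omega>'" if "j \<le> n" for j
    unfolding partial_sum_def using assms(1) that by (intro sum.cong) auto
  then show ?thesis using assms(2) by (cases m) (simp_all add: weight_def normalizer_def)
qed

context weighted_poisson
begin

lemma X_indep_vars: "indep_vars (\<lambda>_. borel) (\<lambda>k \<omega>. real (X k \<omega>)) {1..n}"
proof -
  have "indep_vars (\<lambda>_. borel) (case_sum Y (\<lambda>k \<omega>. real (X k \<omega>))) (Inr ` {1..n})"
    by (rule indep_vars_subset[OF indep]) auto
  from indep_vars_reindex[OF _ this] show ?thesis by simp
qed

lemma poisson_array: "\<theta> > 0 \<Longrightarrow> n \<ge> 1 \<Longrightarrow> poisson_array M \<theta> n X"
  by unfold_locales (use X_indep_vars X_poisson in auto)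

lemma X_real_measurable: "1 \<le> k \<Longrightarrow> (\<lambda>\<omega>. real (X k \<omega>)) \<in> borel_measurable M"
  using X_indep_vars[of k] by (auto simp: indep_vars_def)

lemma weight_borel_measurable: "k \<le> n \<Longrightarrow> weight m Y n k \<in> borel_measurable M"
  by (rule weight_measurable[OF Y_measurable])

lemma weighted_sum_measurable: "weighted_sum m Y X n \<in> borel_measurable M"
  unfolding weighted_sum_def[abs_def]
  by (intro borel_measurable_sum borel_measurable_times weight_borel_measurable X_real_measurable) auto

lemma indep_weights_counts:
  fixes F :: "(nat + nat \<Rightarrow> real) \<times> (nat + nat \<Rightarrow> real) \<Rightarrow> real"
  assumes F: "F \<in> borel_measurable (PiM (Inr ` {1..n}) (\<lambda>_. borel) \<Otimes>\<^sub>M PiM (Inl ` {1..n}) (\<lambda>_. borel))"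
    and g: "\<And>\<omega> \<omega>'. g \<omega> \<omega>' = F (\<lambda>i\<in>Inr ` {1..n}. case_sum Y (\<lambda>k \<omega>. real (X k \<omega>)) i \<omega>,
        \<lambda>i\<in>Inl ` {1..n}. case_sum Y (\<lambda>k \<omega>. real (X k \<omega>)) i \<omega>')"
    and int: "integrable M (\<lambda>\<omega>. g \<omega> \<omega>)"
  shows "expectation (\<lambda>\<omega>. g \<omega> \<omega>) = expectation (\<lambda>\<omega>'. expectation (\<lambda>\<omega>. g \<omega> \<omega>'))"
    and "integrable M (\<lambda>\<omega>'. expectation (\<lambda>\<omega>. g \<omega> \<omega>'))"
proof -
  have ind: "indep_var (PiM (Inr ` {1..n}) (\<lambda>_. borel)) (\<lambda>\<omega>. \<lambda>i\<in>Inr ` {1..n}. case_sum Y (\<lambda>k \<omega>. real (X k \<omega>)) i \<omega>)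
      (PiM (Inl ` {1..n}) (\<lambda>_. borel)) (\<lambda>\<omega>. \<lambda>i\<in>Inl ` {1..n}. case_sum Y (\<lambda>k \<omega>. real (X k \<omega>)) i \<omega>)"
    by (rule indep_var_restrict[OF indep]) auto
  from expectation_indep_var[OF ind F] int
  show "expectation (\<lambda>\<omega>. g \<omega> \<omega>) = expectation (\<lambda>\<omega>'. expectation (\<lambda>\<omega>. g \<omega> \<omega>'))"
    and "integrable M (\<lambda>\<omega>'. expectation (\<lambda>\<omega>. g \<omega> \<omega>'))"
    by (simp_all only: g)
qed

text \<open>Conditioning on the weights: the inner expectation freezes them at \<omega>' and is
  taken over the counts, so the estimates for fixed weights apply to it.\<close>

lemma weighted_sum_mixture:
  fixes \<phi> :: "real \<Rightarrow> real"
  assumes [measurable]: "\<phi> \<in> borel_measurable borel" and int: "integrable M (\<lambda>\<omega>. \<phi> (weighted_sum m Y X n \<omega>))"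
  shows "expectation (\<lambda>\<omega>. \<phi> (weighted_sum m Y X n \<omega>))
      = expectation (\<lambda>\<omega>'. expectation (\<lambda>\<omega>. \<phi> (\<Sum>k=1..n. weight m Y n k \<omega>' * real (X k \<omega>))))"
    and "integrable M (\<lambda>\<omega>'. expectation (\<lambda>\<omega>. \<phi> (\<Sum>k=1..n. weight m Y n k \<omega>' * real (X k \<omega>))))"
proof -
  let ?F = "\<lambda>(xv, yv :: nat + nat \<Rightarrow> real). \<phi> (\<Sum>k=1..n. weight m (\<lambda>i v. v (Inl i)) n k yv * (xv :: nat + nat \<Rightarrow> real) (Inr k))"
  let ?g = "\<lambda>\<omega> \<omega>'. \<phi> (\<Sum>k=1..n. weight m Y n k \<omega>' * real (X k \<omega>))"
  have w[measurable]: "weight m (\<lambda>i (v :: nat + nat \<Rightarrow> real). v (Inl i)) n k \<in> borel_measurable (PiM (Inl ` {1..n}) (\<lambda>_. borel))" if "k \<le> n" for k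
    using that by (intro weight_measurable measurable_component_singleton) auto
  have F: "?F \<in> borel_measurable (PiM (Inr ` {1..n}) (\<lambda>_. borel) \<Otimes>\<^sub>M PiM (Inl ` {1..n}) (\<lambda>_. borel))"
    unfolding case_prod_beta
  proof (rule measurable_compose[OF _ assms(1)], rule borel_measurable_sum, rule borel_measurable_times)
    fix k assume k: "k \<in> {1..n}"
    show "(\<lambda>p :: (nat + nat \<Rightarrow> real) \<times> (nat + nat \<Rightarrow> real). weight m (\<lambda>i v. v (Inl i)) n k (snd p)) \<in> borel_measurable (PiM (Inr ` {1..n}) (\<lambda>_. borel) \<Otimes>\<^sub>M PiM (Inl ` {1..n}) (\<lambda>_. borel))"
      using k by (intro measurable_compose[OF measurable_snd w]) auto
    show "(\<lambda>p :: (nat + nat \<Rightarrow> real) \<times> (nat + nat \<Rightarrow> real). fst p (Inr k)) \<in> borel_measurable (PiM (Inr ` {1..n}) (\<lambda>_. borel) \<Otimes>\<^sub>M PiM (Inl ` {1..n}) (\<lambda>_. borel))"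
      using k by (intro measurable_compose[OF measurable_fst measurable_component_singleton]) auto
  qed
  have g: "?g \<omega> \<omega>' = ?F (\<lambda>i\<in>Inr ` {1..n}. case_sum Y (\<lambda>k \<omega>. real (X k \<omega>)) i \<omega>,
        \<lambda>i\<in>Inl ` {1..n}. case_sum Y (\<lambda>k \<omega>. real (X k \<omega>)) i \<omega>')" for \<omega> \<omega>'
  proof -
    have "weight m Y n k \<omega>' = weight m (\<lambda>i v. v (Inl i)) n k (\<lambda>i\<in>Inl ` {1..n}. case_sum Y (\<lambda>k \<omega>. real (X k \<omega>)) i \<omega>')"
      if "k \<in> {1..n}" for k
      using that by (intro weight_cong) auto
    then show ?thesis by (auto intro!: arg_cong[where f=\<phi>] sum.cong)
  qed
  from indep_weights_counts[OF F g] int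
  show "expectation (\<lambda>\<omega>. \<phi> (weighted_sum m Y X n \<omega>))
      = expectation (\<lambda>\<omega>'. expectation (\<lambda>\<omega>. \<phi> (\<Sum>k=1..n. weight m Y n k \<omega>' * real (X k \<omega>))))"
    and "integrable M (\<lambda>\<omega>'. expectation (\<lambda>\<omega>. \<phi> (\<Sum>k=1..n. weight m Y n k \<omega>' * real (X k \<omega>))))"
    by (simp_all only: weighted_sum_def)
qed

text \<open>The sum of both one-sided maxima dominates the maximal absolute deviation at the cost of
  a factor 2. The products with 1 and -1 match the two signs in
  \<open>running_max_deviation\<close>.\<close>

definition max_deviation :: "nat \<Rightarrow> 'a \<Rightarrow> real" where
  "max_deviation n \<omega> = running_max (\<lambda>k. 1 * deviation k \<omega>) n + running_max (\<lambda>k. (-1) * deviation k \<omega>) n"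

lemma max_deviation_upper: "1 \<le> k \<Longrightarrow> k \<le> n \<Longrightarrow> \<bar>deviation k \<omega>\<bar> \<le> max_deviation n \<omega>"
  using running_max_upper[of k n "\<lambda>k. 1 * deviation k \<omega>"] running_max_upper[of k n "\<lambda>k. (-1) * deviation k \<omega>"]
    running_max_nonneg[of "\<lambda>k. 1 * deviation k \<omega>" n] running_max_nonneg[of "\<lambda>k. (-1) * deviation k \<omega>" n]
  unfolding max_deviation_def by linarith

lemma max_deviation_nonneg: "0 \<le> max_deviation n \<omega>"
  unfolding max_deviation_def by (intro add_nonneg_nonneg running_max_nonneg)

lemma max_deviation_expectation:
  "integrable M (max_deviation n)" "expectation (max_deviation n) \<le> 4 * sqrt (\<Sum>i=1..n. (\<sigma> i)\<^sup>2)"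
  unfolding max_deviation_def[abs_def]
  using running_max_deviation[of 1 n] running_max_deviation[of "-1" n] by simp_all

text \<open>A random bound, valid in both models, for the error
  \<open>weight_dev + 2 * (d + 1 / n)\<close> with \<open>d = 2 * max_deviation / n\<close>. The
  first three terms are the bound of \<open>ratio_weight_dev\<close>.\<close>

definition weight_error :: "nat \<Rightarrow> 'a \<Rightarrow> real" where
  "weight_error n \<omega> = 2 * (\<Sum>k=1..n. \<bar>deviation k \<omega>\<bar> / (real n * real k)) + 2 * (\<bar>deviation n \<omega>\<bar> / real n)
     + 12 * ln (real n) * (\<bar>deviation n \<omega>\<bar> / real n)\<^sup>2 + 2 * (2 * max_deviation n \<omega> / real n + 1 / real n)"

lemma weight_error_pos: "n \<ge> 1 \<Longrightarrow> 0 < weight_error n \<omega>"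
  unfolding weight_error_def using max_deviation_nonneg[of n \<omega>]
  by (intro add_nonneg_pos add_nonneg_nonneg mult_nonneg_nonneg mult_pos_pos sum_nonneg) auto

lemma weight_error_expectation:
  assumes n: "n \<ge> 1"
  shows "integrable M (weight_error n)" "expectation (weight_error n) \<le> 20 * error_term \<sigma> n"
proof -
  let ?V = "\<lambda>k. \<Sum>i=1..k. (\<sigma> i)\<^sup>2"
  have V0: "0 \<le> ?V k" for k by (intro sum_nonneg) auto
  have i1: "integrable M (\<lambda>\<omega>. \<Sum>k=1..n. \<bar>deviation k \<omega>\<bar> / (real n * real k))"
    by (intro Bochner_Integration.integrable_sum integrable_divide integrable_abs deviation_abs(1))
  have i2: "integrable M (\<lambda>\<omega>. \<bar>deviation n \<omega>\<bar> / real n)"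
    by (intro integrable_divide integrable_abs deviation_abs(1))
  have i3: "integrable M (\<lambda>\<omega>. (\<bar>deviation n \<omega>\<bar> / real n)\<^sup>2)"
    using deviation_square(1)[of n] by (simp add: power_divide)
  note i4 = max_deviation_expectation(1)[of n]
  define f1 where "f1 \<omega> = (\<Sum>k=1..n. \<bar>deviation k \<omega>\<bar> / (real n * real k))" for \<omega>
  define f2 where "f2 \<omega> = \<bar>deviation n \<omega>\<bar> / real n" for \<omega>
  define f3 where "f3 \<omega> = (\<bar>deviation n \<omega>\<bar> / real n)\<^sup>2" for \<omega>
  have i: "integrable M f1" "integrable M f2" "integrable M f3" "integrable M (max_deviation n)"
    using i1 i2 i3 i4 by (simp_all only: f1_def[abs_def] f2_def[abs_def] f3_def[abs_def])
  have we: "weight_error n = (\<lambda>\<omega>. 2 * f1 \<omega> + 2 * f2 \<omega> + 12 * ln (real n) * f3 \<omega> + 2 * (2 * max_deviation n \<omega> / real n + 1 / real n))"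
    by (simp only: weight_error_def[abs_def] f1_def f2_def f3_def)
  show "integrable M (weight_error n)" unfolding we using i by simp
  have e1: "expectation f1 = (\<Sum>k=1..n. expectation (\<lambda>\<omega>. \<bar>deviation k \<omega>\<bar>) / (real n * real k))"
    unfolding f1_def[abs_def]
    by (subst Bochner_Integration.integral_sum) (auto intro!: integrable_divide integrable_abs deviation_abs(1))
  have e2: "expectation f2 = expectation (\<lambda>\<omega>. \<bar>deviation n \<omega>\<bar>) / real n"
    unfolding f2_def[abs_def] by simp
  have e3: "expectation f3 = ?V n / (real n)\<^sup>2"
    unfolding f3_def[abs_def] using deviation_square(2)[of n] by (simp add: power_divide)
  have "expectation (weight_error n) = 2 * expectation f1 + 2 * expectation f2 + 12 * ln (real n) * expectation f3
     + 2 * (2 * expectation (max_deviation n) / real n + 1 / real n)"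
    unfolding we using i by (simp add: prob_space)
  also have "\<dots> = 2 * (\<Sum>k=1..n. expectation (\<lambda>\<omega>. \<bar>deviation k \<omega>\<bar>) / (real n * real k))
     + 2 * (expectation (\<lambda>\<omega>. \<bar>deviation n \<omega>\<bar>) / real n) + 12 * ln (real n) * (?V n / (real n)\<^sup>2)
     + 2 * (2 * expectation (max_deviation n) / real n + 1 / real n)"
    by (simp only: e1 e2 e3)
  also have "\<dots> \<le> 2 * (\<Sum>k=1..n. sqrt (?V k) / (real n * real k)) + 2 * (sqrt (?V n) / real n)
     + 12 * ln (real n) * (?V n / (real n)\<^sup>2) + 2 * (2 * (4 * sqrt (?V n)) / real n + 1 / real n)"
    using deviation_abs(2) max_deviation_expectation(2)[of n] n
    by (intro add_mono mult_left_mono sum_mono divide_right_mono) auto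
  also have "\<dots> \<le> 20 * error_term \<sigma> n"
  proof -
    define A where "A = ln (real n) / (real n)\<^sup>2 * ?V n"
    define C where "C = 1 / real n * (\<Sum>j=1..n. 1 / real j * sqrt (?V j))"
    define s where "s = sqrt (?V n) / real n"
    define w where "w = sqrt (1 + ?V n) / real n"
    have A0: "A \<ge> 0" unfolding A_def using V0 n by (intro mult_nonneg_nonneg) auto
    have C0: "C \<ge> 0" unfolding C_def using V0 by (intro mult_nonneg_nonneg sum_nonneg) auto
    have sw: "s \<le> w" unfolding s_def w_def by (intro divide_right_mono) auto
    have "1 \<le> sqrt (1 + ?V n)" using V0[of n] by simp
    then have w1: "1 / real n \<le> w" unfolding w_def by (intro divide_right_mono) auto
    have "(\<Sum>k=1..n. sqrt (?V k) / (real n * real k)) = C"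
      unfolding C_def sum_distrib_left by (intro sum.cong) auto
    \<comment> \<open>The worst coefficient is that of \<open>w\<close>: 2 from the final deviation,
      16 from the maximal deviation and 2 from \<open>1 / n\<close> add up to 20.\<close>
    then have "2 * (\<Sum>k=1..n. sqrt (?V k) / (real n * real k)) + 2 * (sqrt (?V n) / real n)
      + 12 * ln (real n) * (?V n / (real n)\<^sup>2) + 2 * (2 * (4 * sqrt (?V n)) / real n + 1 / real n)
      = 2 * C + 2 * s + 12 * A + 2 * (8 * s + 1 / real n)"
      by (simp add: A_def s_def)
    also have "\<dots> \<le> 20 * (A + w + C)" using A0 C0 sw w1 by simp
    also have "A + w + C = error_term \<sigma> n" by (simp add: error_term_def A_def C_def w_def)
    finally show ?thesis .
  qed
  finally show "expectation (weight_error n) \<le> 20 * error_term \<sigma> n" .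
qed

lemma weight_bounds:
  assumes n: "n \<ge> 1" and Y: "\<And>i. 1 \<le> i \<Longrightarrow> i \<le> n \<Longrightarrow> 0 \<le> Y i \<omega>"
    and pos: "m = Model_B \<Longrightarrow> 0 < partial_sum Y n \<omega>"
  shows "\<And>k. k \<in> {1..n} \<Longrightarrow> 0 \<le> weight m Y n k \<omega>"
    and "\<And>k. k \<in> {1..n} \<Longrightarrow> \<bar>weight m Y n k \<omega> - real k / n\<bar> \<le> 2 * max_deviation n \<omega> / n"
    and "(\<Sum>k=1..n. \<bar>weight m Y n k \<omega> / k - 1 / n\<bar>) + 2 * (2 * max_deviation n \<omega> / n + 1 / n) \<le> weight_error n \<omega>"
    and "\<And>k. k \<in> {1..n} \<Longrightarrow> m = Model_B \<Longrightarrow> weight m Y n k \<omega> \<le> 1"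
proof -
  let ?S = "\<lambda>k. partial_sum Y k \<omega>"
  let ?x = "max_deviation n \<omega>"
  have S0: "0 \<le> ?S k" if "k \<le> n" for k
    unfolding partial_sum_def using that by (intro sum_nonneg Y) auto
  have Sn: "?S k \<le> ?S n" if "k \<le> n" for k
    unfolding partial_sum_def using that by (intro sum_mono2 Y) auto
  have ln0: "0 \<le> ln (real n)" using n by simp
  have dev: "\<bar>?S k - real k\<bar> \<le> ?x" if "k \<in> {1..n}" for k
    using max_deviation_upper[of k n \<omega>] that by (simp add: deviation_def)
  let ?B = "\<Sum>k=1..n. \<bar>deviation k \<omega>\<bar> / (real n * real k)"
  have B0: "0 \<le> ?B" by (intro sum_nonneg) auto
  have A: "\<bar>?S k / n - real k / n\<bar> \<le> ?x / n" if "k \<in> {1..n}" for k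
    using dev[OF that] n by (simp add: diff_divide_distrib[symmetric] divide_right_mono)
  have "(\<forall>k\<in>{1..n}. 0 \<le> weight m Y n k \<omega>) \<and> (\<forall>k\<in>{1..n}. \<bar>weight m Y n k \<omega> - real k / n\<bar> \<le> 2 * ?x / n)
     \<and> (\<Sum>k=1..n. \<bar>weight m Y n k \<omega> / k - 1 / n\<bar>) + 2 * (2 * ?x / n + 1 / n) \<le> weight_error n \<omega>
     \<and> (m = Model_B \<longrightarrow> (\<forall>k\<in>{1..n}. weight m Y n k \<omega> \<le> 1))"
  proof (cases m)
    case Model_A
    have w: "weight m Y n k \<omega> = ?S k / n" for k by (simp add: weight_def normalizer_def Model_A)
    have "\<bar>?S k / n - real k / n\<bar> \<le> 2 * ?x / n" if "k \<in> {1..n}" for k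
    proof -
      have "?x / n \<le> 2 * ?x / n" using max_deviation_nonneg[of n \<omega>] by (intro divide_right_mono) auto
      then show ?thesis using A[OF that] by linarith
    qed
    moreover have "(\<Sum>k=1..n. \<bar>?S k / n / k - 1 / n\<bar>) = ?B"
    proof (intro sum.cong refl)
      fix k assume k: "k \<in> {1..n}"
      have "?S k / n / k - 1 / n = (?S k - k) / (real n * k)" using k n by (simp add: field_simps)
      then show "\<bar>?S k / n / k - 1 / n\<bar> = \<bar>deviation k \<omega>\<bar> / (real n * real k)"
        by (simp add: deviation_def abs_mult)
    qed
    moreover have "0 \<le> 2 * (\<bar>deviation n \<omega>\<bar> / real n) + 12 * ln (real n) * (\<bar>deviation n \<omega>\<bar> / real n)\<^sup>2"
      using ln0 by (intro add_nonneg_nonneg mult_nonneg_nonneg) auto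
    ultimately show ?thesis
      unfolding w weight_error_def using S0 B0 Model_A by (auto simp: field_simps)
  next
    case Model_B
    have p: "0 < ?S n" using pos Model_B by simp
    have w: "weight m Y n k \<omega> = ?S k / ?S n" for k by (simp add: weight_def normalizer_def Model_B)
    have "\<bar>?S k / ?S n - real k / n\<bar> \<le> 2 * ?x / n" if k: "k \<in> {1..n}" for k
    proof -
      have q: "0 \<le> ?S k / ?S n" "?S k / ?S n \<le> 1" using S0[of k] Sn[of k] p k by auto
      \<comment> \<open>Both the partial sum and the normalizer are compared with their means; each
        costs one maximal deviation over \<open>n\<close>, hence the factor 2.\<close>
      have "?S k / ?S n - real k / n = (?S k / n - real k / n) + (?S k / ?S n) * (real n / n - ?S n / n)"
        using p n by (simp add: field_simps)
      then have "\<bar>?S k / ?S n - real k / n\<bar> \<le> \<bar>?S k / n - real k / n\<bar> + \<bar>(?S k / ?S n) * (real n / n - ?S n / n)\<bar>"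
        by (metis abs_triangle_ineq)
      also have "\<bar>(?S k / ?S n) * (real n / n - ?S n / n)\<bar> \<le> 1 * (?x / n)"
        unfolding abs_mult using q A[of n] n by (intro mult_mono) (auto simp: abs_minus_commute)
      finally show ?thesis using A[OF k] by simp
    qed
    moreover have "(\<Sum>k=1..n. \<bar>?S k / ?S n / k - 1 / n\<bar>)
       \<le> 2 * ?B + 2 * (\<bar>deviation n \<omega>\<bar> / n) + 12 * ln n * (\<bar>deviation n \<omega>\<bar> / n)\<^sup>2"
      unfolding deviation_def by (rule ratio_weight_dev[OF n]) (use S0 Sn p in auto)
    ultimately show ?thesis
      unfolding w weight_error_def using S0 Sn p by auto
  qed
  then show "\<And>k. k \<in> {1..n} \<Longrightarrow> 0 \<le> weight m Y n k \<omega>"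
    and "\<And>k. k \<in> {1..n} \<Longrightarrow> \<bar>weight m Y n k \<omega> - real k / n\<bar> \<le> 2 * ?x / n"
    and "(\<Sum>k=1..n. \<bar>weight m Y n k \<omega> / k - 1 / n\<bar>) + 2 * (2 * ?x / n + 1 / n) \<le> weight_error n \<omega>"
    and "\<And>k. k \<in> {1..n} \<Longrightarrow> m = Model_B \<Longrightarrow> weight m Y n k \<omega> \<le> 1" by auto
qed

end

lemma dickman_step_lipschitz:
  assumes \<theta>: "\<theta> > 0" and [measurable]: "h \<in> borel_measurable borel"
    and l: "\<And>x y. \<bar>h x - h y\<bar> \<le> \<bar>x - y\<bar>"
  shows "\<bar>dickman_step \<theta> h x - dickman_step \<theta> h y\<bar> \<le> \<bar>x - y\<bar>"
proof -
  note v = powr_inverse_bounds[OF \<theta>]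
  have i: "integrable unif01 (\<lambda>u. h (u powr (1 / \<theta>) * z))" for z
  proof (rule integrable_unif01_bounded[where B="\<bar>h 0\<bar> + \<bar>z\<bar>"])
    fix u :: real assume u: "0 < u" "u < 1"
    have "\<bar>u powr (1 / \<theta>) * z\<bar> \<le> \<bar>z\<bar>" using v[OF u] by (simp add: abs_mult mult_left_le_one_le)
    then show "\<bar>h (u powr (1 / \<theta>) * z)\<bar> \<le> \<bar>h 0\<bar> + \<bar>z\<bar>" using l[of "u powr (1 / \<theta>) * z" 0] by linarith
  qed measurable
  have eq: "dickman_step \<theta> h x - dickman_step \<theta> h y = (\<integral>u. h (u powr (1 / \<theta>) * (x + 1)) - h (u powr (1 / \<theta>) * (y + 1)) \<partial>unif01)"
    unfolding dickman_avg_def using i by simp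
  have "\<bar>\<integral>u. h (u powr (1 / \<theta>) * (x + 1)) - h (u powr (1 / \<theta>) * (y + 1)) \<partial>unif01\<bar>
      \<le> (\<integral>u. \<bar>h (u powr (1 / \<theta>) * (x + 1)) - h (u powr (1 / \<theta>) * (y + 1))\<bar> \<partial>unif01)"
    by (rule integral_abs_bound)
  also have "\<dots> \<le> (\<integral>u. \<bar>x - y\<bar> \<partial>unif01)"
  proof (rule integral_unif01_mono)
    fix u :: real assume u: "0 < u" "u < 1"
    have "\<bar>h (u powr (1 / \<theta>) * (x + 1)) - h (u powr (1 / \<theta>) * (y + 1))\<bar> \<le> \<bar>u powr (1 / \<theta>) * (x + 1) - u powr (1 / \<theta>) * (y + 1)\<bar>"
      by (rule l)
    also have "\<dots> = u powr (1 / \<theta>) * \<bar>x - y\<bar>" by (simp add: right_diff_distrib[symmetric] abs_mult)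
    also have "\<dots> \<le> \<bar>x - y\<bar>" using v[OF u] by (simp add: mult_left_le_one_le)
    finally show "\<bar>h (u powr (1 / \<theta>) * (x + 1)) - h (u powr (1 / \<theta>) * (y + 1))\<bar> \<le> \<bar>x - y\<bar>" .
  qed (use i in auto)
  finally show ?thesis unfolding eq by simp
qed

subsection \<open>Rates of convergence\<close>

lemma error_term_pos:
  assumes "n \<ge> 1"
  shows "0 < error_term \<sigma> n"
proof -
  have V0: "0 \<le> (\<Sum>i=1..k. (\<sigma> i)\<^sup>2)" for k by (intro sum_nonneg) auto
  have "0 \<le> ln (real n) / (real n)\<^sup>2 * (\<Sum>i=1..n. (\<sigma> i)\<^sup>2)"
    using assms V0 by (intro mult_nonneg_nonneg) auto
  moreover have "0 < 1 / real n * sqrt (1 + (\<Sum>i=1..n. (\<sigma> i)\<^sup>2))"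
    using assms V0[of n] by (intro mult_pos_pos) (auto intro: add_pos_nonneg)
  moreover have "0 \<le> 1 / real n * (\<Sum>j=1..n. 1 / real j * sqrt (\<Sum>i=1..j. (\<sigma> i)\<^sup>2))"
    using V0 by (intro mult_nonneg_nonneg sum_nonneg) auto
  ultimately show ?thesis unfolding error_term_def by linarith
qed

context weighted_poisson
begin

lemma AE_good:
  assumes "m = Model_B \<longrightarrow> (AE \<omega> in M. 0 < partial_sum Y n \<omega>)"
  shows "AE \<omega> in M. (\<forall>i\<in>{1..n}. 0 \<le> Y i \<omega>) \<and> (m = Model_B \<longrightarrow> 0 < partial_sum Y n \<omega>)"
proof -
  have 1: "AE \<omega> in M. \<forall>i\<in>{1..n}. 0 \<le> Y i \<omega>"
    using Y_nonneg by (intro AE_finite_allI) auto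
  have 2: "AE \<omega> in M. m = Model_B \<longrightarrow> 0 < partial_sum Y n \<omega>" using assms by auto
  from 1 2 show ?thesis by eventually_elim auto
qed

lemma weighted_sum_nonneg:
  assumes n: "n \<ge> 1" and pos: "m = Model_B \<longrightarrow> (AE \<omega> in M. 0 < partial_sum Y n \<omega>)"
  shows "AE \<omega> in M. 0 \<le> weighted_sum m Y X n \<omega>"
  using AE_good[OF pos]
proof eventually_elim
  case (elim \<omega>)
  then show ?case
    unfolding weighted_sum_def using weight_bounds(1)[OF n, of \<omega> m] by (intro sum_nonneg mult_nonneg_nonneg) auto
qed

text \<open>A weight is independent of its count, so integrability of both suffices. In Model B the
  weight is almost surely between 0 and 1.\<close>

lemma weighted_sum_integrable:
  assumes n: "n \<ge> 1" and \<theta>: "\<theta> > 0" and pos: "m = Model_B \<longrightarrow> (AE \<omega> in M. 0 < partial_sum Y n \<omega>)"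
  shows "integrable M (weighted_sum m Y X n)"
  unfolding weighted_sum_def[abs_def]
proof (intro Bochner_Integration.integrable_sum)
  fix k assume k: "k \<in> {1..n}"
  interpret PA: poisson_array M \<theta> n X by (rule poisson_array[OF \<theta> n])
  let ?cs = "case_sum Y (\<lambda>k \<omega>. real (X k \<omega>))"
  have w: "weight m (\<lambda>i (v :: nat + nat \<Rightarrow> real). v (Inl i)) n k \<in> borel_measurable (PiM (Inl ` {1..n}) (\<lambda>_. borel))"
    using k by (intro weight_measurable measurable_component_singleton) auto
  have "indep_var borel (weight m (\<lambda>i v. v (Inl i)) n k \<circ> (\<lambda>\<omega>. \<lambda>i\<in>Inl ` {1..n}. ?cs i \<omega>))
      borel ((\<lambda>v. v (Inr k)) \<circ> (\<lambda>\<omega>. \<lambda>i\<in>Inr ` {1..n}. ?cs i \<omega>))"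
    using k by (intro indep_var_compose[OF indep_var_restrict[OF indep]] w measurable_component_singleton) auto
  moreover have "weight m (\<lambda>i v. v (Inl i)) n k \<circ> (\<lambda>\<omega>. \<lambda>i\<in>Inl ` {1..n}. ?cs i \<omega>) = weight m Y n k"
  proof
    fix \<omega>
    have "weight m Y n k \<omega> = weight m (\<lambda>i v. v (Inl i)) n k (\<lambda>i\<in>Inl ` {1..n}. ?cs i \<omega>)"
      using k by (intro weight_cong) auto
    then show "(weight m (\<lambda>i v. v (Inl i)) n k \<circ> (\<lambda>\<omega>. \<lambda>i\<in>Inl ` {1..n}. ?cs i \<omega>)) \<omega> = weight m Y n k \<omega>" by simp
  qed
  moreover have "(\<lambda>v. v (Inr k)) \<circ> (\<lambda>\<omega>. \<lambda>i\<in>Inr ` {1..n}. ?cs i \<omega>) = (\<lambda>\<omega>. real (X k \<omega>))"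
    using k by (auto simp: fun_eq_iff)
  ultimately have ind: "indep_var borel (weight m Y n k) borel (\<lambda>\<omega>. real (X k \<omega>))" by simp
  have "integrable M (weight m Y n k)"
  proof (cases m)
    case Model_A
    have "integrable M (partial_sum Y k)"
      unfolding partial_sum_def[abs_def] by (intro Bochner_Integration.integrable_sum Y_integrable) auto
    then show ?thesis unfolding weight_def[abs_def] normalizer_def Model_A by simp
  next
    case Model_B
    show ?thesis
    proof (rule integrable_const_bound[where B=1])
      show "AE \<omega> in M. norm (weight m Y n k \<omega>) \<le> 1"
        using AE_good[OF pos]
      proof eventually_elim
        case (elim \<omega>)
        then have "0 \<le> weight m Y n k \<omega>" "weight m Y n k \<omega> \<le> 1"
          using weight_bounds(1,4)[OF n, of \<omega> m k] k Model_B by auto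
        then show ?case by simp
      qed
    qed (use k in \<open>auto intro: weight_borel_measurable\<close>)
  qed
  then show "integrable M (\<lambda>\<omega>. weight m Y n k \<omega> * real (X k \<omega>))"
    by (rule indep_var_integrable[OF ind _ PA.X_integrable[OF k]])
qed

text \<open>The function \<psi> turns the error of fixed weights into a bound on the defect; it is
  linear for Lipschitz tests and a multiple of the power \<open>min 1 \<theta>\<close> for
  indicators. Monotonicity lets \<open>weight_error\<close> replace the actual error before
  averaging.\<close>

lemma random_defect:
  fixes h :: "real \<Rightarrow> real" and \<psi> :: "real \<Rightarrow> real"
  assumes n: "n \<ge> 1" and pos: "m = Model_B \<longrightarrow> (AE \<omega> in M. 0 < partial_sum Y n \<omega>)"
    and h[measurable]: "h \<in> borel_measurable borel"
    and int: "integrable M (\<lambda>\<omega>. h (weighted_sum m Y X n \<omega>))"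
      "integrable M (\<lambda>\<omega>. dickman_step \<theta> h (weighted_sum m Y X n \<omega>))"
    and bound: "\<And>(a :: nat \<Rightarrow> real) d. (\<And>k. k \<in> {1..n} \<Longrightarrow> \<bar>a k - real k / n\<bar> \<le> d) \<Longrightarrow> (\<And>k. k \<in> {1..n} \<Longrightarrow> 0 \<le> a k) \<Longrightarrow>
      \<bar>expectation (\<lambda>\<omega>. h (\<Sum>k=1..n. a k * real (X k \<omega>))) - expectation (\<lambda>\<omega>. dickman_step \<theta> h (\<Sum>k=1..n. a k * real (X k \<omega>)))\<bar>
        \<le> \<psi> ((\<Sum>k=1..n. \<bar>a k / k - 1 / n\<bar>) + 2 * (d + 1 / n))"
    and mono: "\<And>x y. 0 \<le> x \<Longrightarrow> x \<le> y \<Longrightarrow> \<psi> x \<le> \<psi> y"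
    and \<psi>: "integrable M (\<lambda>\<omega>. \<psi> (weight_error n \<omega>))"
  shows "\<bar>expectation (\<lambda>\<omega>. h (weighted_sum m Y X n \<omega>)) - expectation (\<lambda>\<omega>. dickman_step \<theta> h (weighted_sum m Y X n \<omega>))\<bar>
    \<le> expectation (\<lambda>\<omega>. \<psi> (weight_error n \<omega>))"
proof -
  let ?T = "\<lambda>\<omega>' \<omega>. \<Sum>k=1..n. weight m Y n k \<omega>' * real (X k \<omega>)"
  define e where "e \<omega>' = expectation (\<lambda>\<omega>. h (?T \<omega>' \<omega>)) - expectation (\<lambda>\<omega>. dickman_step \<theta> h (?T \<omega>' \<omega>))" for \<omega>'
  note m1 = weighted_sum_mixture[OF h int(1)]
  have "dickman_step \<theta> h \<in> borel_measurable borel" by measurable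
  note m2 = weighted_sum_mixture[OF this int(2)]
  have ie: "integrable M e" unfolding e_def[abs_def] using m1(2) m2(2) by (rule Bochner_Integration.integrable_diff)
  have eq: "expectation (\<lambda>\<omega>. h (weighted_sum m Y X n \<omega>)) - expectation (\<lambda>\<omega>. dickman_step \<theta> h (weighted_sum m Y X n \<omega>)) = expectation e"
    unfolding e_def[abs_def] m1(1) m2(1) using m1(2) m2(2) by (rule Bochner_Integration.integral_diff[symmetric])
  have "\<bar>expectation e\<bar> \<le> expectation (\<lambda>\<omega>. \<bar>e \<omega>\<bar>)" by (rule integral_abs_bound)
  also have "\<dots> \<le> expectation (\<lambda>\<omega>. \<psi> (weight_error n \<omega>))"
  proof (rule integral_mono_AE)
    show "AE \<omega> in M. \<bar>e \<omega>\<bar> \<le> \<psi> (weight_error n \<omega>)"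
      using AE_good[OF pos]
    proof eventually_elim
      case (elim \<omega>)
      have Y0: "\<And>i. 1 \<le> i \<Longrightarrow> i \<le> n \<Longrightarrow> 0 \<le> Y i \<omega>" and p: "m = Model_B \<Longrightarrow> 0 < partial_sum Y n \<omega>"
        using elim by auto
      note wb = weight_bounds[OF n Y0 p]
      let ?x = "(\<Sum>k=1..n. \<bar>weight m Y n k \<omega> / k - 1 / n\<bar>) + 2 * (2 * max_deviation n \<omega> / n + 1 / n)"
      have "\<bar>e \<omega>\<bar> \<le> \<psi> ?x" unfolding e_def
        by (rule bound[of "\<lambda>k. weight m Y n k \<omega>" "2 * max_deviation n \<omega> / n"]) (use wb in auto)
      also have "\<psi> ?x \<le> \<psi> (weight_error n \<omega>)"
        using wb(3) max_deviation_nonneg[of n \<omega>] by (intro mono add_nonneg_nonneg mult_nonneg_nonneg sum_nonneg) auto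
      finally show ?case .
    qed
  qed (use ie \<psi> in auto)
  finally show ?thesis unfolding eq .
qed

text \<open>The factor 20 is that of \<open>weight_error_expectation\<close>. For indicators the
  power of the error costs another 2, giving 40; the second term is
  \<open>2 * \<theta> * (\<theta> + 1)\<close> times the hinge defect
  \<open>20 * \<theta> * error_term \<sigma> n\<close>.\<close>

lemma distance_bounds:
  assumes n: "n \<ge> 1" and \<theta>: "\<theta> > 0" and pos: "m = Model_B \<longrightarrow> (AE \<omega> in M. 0 < partial_sum Y n \<omega>)"
    and D: "dickman_law \<theta> D"
  defines "\<mu> \<equiv> distr M borel (weighted_sum m Y X n)"
  shows "t \<ge> 0 \<Longrightarrow> \<bar>cdf \<mu> t - cdf D t\<bar> \<le> 40 * (2 + \<theta> * (1 + 2 * 3 powr \<theta>)) * error_term \<sigma> n powr min 1 \<theta>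
      + 40 * \<theta>\<^sup>2 * (\<theta> + 1) * error_term \<sigma> n"
    and "smooth_test h h' \<Longrightarrow> \<bar>(\<integral>x. h x \<partial>\<mu>) - (\<integral>x. h x \<partial>D)\<bar> \<le> 20 * \<theta> * (\<theta> + 1) * error_term \<sigma> n"
proof -
  interpret PA: poisson_array M \<theta> n X by (rule poisson_array[OF \<theta> n])
  let ?S = "weighted_sum m Y X n"
  have S[measurable]: "?S \<in> borel_measurable M" by (rule weighted_sum_measurable)
  have \<mu>1: "prob_space \<mu>" unfolding \<mu>_def by (rule prob_space_distr) measurable
  have \<mu>2: "sets \<mu> = sets borel" by (simp add: \<mu>_def)
  have \<mu>3: "AE x in \<mu>. 0 \<le> x"
    unfolding \<mu>_def using weighted_sum_nonneg[OF n pos] by (subst AE_distr_iff) auto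
  have \<mu>4: "integrable \<mu> (\<lambda>x. x)"
    unfolding \<mu>_def using weighted_sum_integrable[OF n \<theta> pos] by (subst integrable_distr_eq) auto
  interpret C: dickman_comparison \<theta> D \<mu> by (rule dickman_comparison.intro[OF \<theta> D \<mu>1 \<mu>2 \<mu>3 \<mu>4])
  have int\<mu>: "(\<integral>x. g x \<partial>\<mu>) = expectation (\<lambda>\<omega>. g (?S \<omega>))" if "g \<in> borel_measurable borel" for g :: "real \<Rightarrow> real"
    unfolding \<mu>_def using that by (intro integral_distr) auto
  have integ: "integrable M (\<lambda>\<omega>. g (?S \<omega>)) \<longleftrightarrow> integrable \<mu> g" if "g \<in> borel_measurable borel" for g :: "real \<Rightarrow> real"
    unfolding \<mu>_def using that by (intro integrable_distr_eq[symmetric]) auto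
  let ?E = "error_term \<sigma> n"
  let ?R = "weight_error n"
  note R = weight_error_expectation[OF n]
  have wd: "PA.weight_dev a = (\<Sum>k=1..n. \<bar>a k / k - 1 / n\<bar>)" for a by (rule PA.weight_dev_def)
  have ws: "PA.wsum a \<omega> = (\<Sum>k=1..n. a k * real (X k \<omega>))" for a \<omega> by (rule PA.wsum_def)
  have lip: "\<bar>(\<integral>x. g x \<partial>\<mu>) - (\<integral>x. dickman_step \<theta> g x \<partial>\<mu>)\<bar> \<le> 20 * \<theta> * ?E"
    if g: "g \<in> borel_measurable borel" and l: "\<And>x y. \<bar>g x - g y\<bar> \<le> \<bar>x - y\<bar>"
      and b: "\<And>(a :: nat \<Rightarrow> real) d. (\<And>k. k \<in> {1..n} \<Longrightarrow> \<bar>a k - real k / n\<bar> \<le> d) \<Longrightarrow> (\<And>k. k \<in> {1..n} \<Longrightarrow> 0 \<le> a k) \<Longrightarrow>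
        \<bar>expectation (\<lambda>\<omega>. g (PA.wsum a \<omega>)) - expectation (\<lambda>\<omega>. dickman_step \<theta> g (PA.wsum a \<omega>))\<bar>
          \<le> \<theta> * (PA.weight_dev a + (d + 1 / n))" for g
  proof -
    note [measurable] = g
    have sm: "dickman_step \<theta> g \<in> borel_measurable borel" by measurable
    have sl: "\<bar>dickman_step \<theta> g x - dickman_step \<theta> g y\<bar> \<le> \<bar>x - y\<bar>" for x y by (rule dickman_step_lipschitz[OF \<theta> g l])
    have l0: "\<bar>g x - g 0\<bar> \<le> \<bar>x\<bar>" "\<bar>dickman_step \<theta> g x - dickman_step \<theta> g 0\<bar> \<le> \<bar>x\<bar>" for x
      using l[of x 0] sl[of x 0] by simp_all
    have i1: "integrable M (\<lambda>\<omega>. g (?S \<omega>))"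
      unfolding integ[OF g] by (rule C.lipschitz_difference(2)[OF g l0(1)])
    have i2: "integrable M (\<lambda>\<omega>. dickman_step \<theta> g (?S \<omega>))"
      unfolding integ[OF sm] by (rule C.lipschitz_difference(2)[OF sm l0(2)])
    have "\<bar>expectation (\<lambda>\<omega>. g (?S \<omega>)) - expectation (\<lambda>\<omega>. dickman_step \<theta> g (?S \<omega>))\<bar> \<le> expectation (\<lambda>\<omega>. \<theta> * ?R \<omega>)"
    proof (rule random_defect[OF n pos g i1 i2, where \<psi>="\<lambda>x. \<theta> * x"])
      fix a :: "nat \<Rightarrow> real" and d
      assume a: "\<And>k. k \<in> {1..n} \<Longrightarrow> \<bar>a k - real k / n\<bar> \<le> d" "\<And>k. k \<in> {1..n} \<Longrightarrow> 0 \<le> a k"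
      have "0 \<le> d" using a(1)[of 1] n by force
      \<comment> \<open>The quadrature term is doubled so that the same \<open>weight_error\<close>
        serves Lipschitz tests and indicators.\<close>
      then have "1 * (d + 1 / n) \<le> 2 * (d + 1 / n)" by (intro mult_right_mono) auto
      then have "\<theta> * (PA.weight_dev a + (d + 1 / n)) \<le> \<theta> * (PA.weight_dev a + 2 * (d + 1 / n))"
        using \<theta> unfolding mult_1 by (intro mult_left_mono add_left_mono) auto
      with b[OF a] show "\<bar>expectation (\<lambda>\<omega>. g (\<Sum>k=1..n. a k * real (X k \<omega>))) - expectation (\<lambda>\<omega>. dickman_step \<theta> g (\<Sum>k=1..n. a k * real (X k \<omega>)))\<bar>
        \<le> \<theta> * ((\<Sum>k=1..n. \<bar>a k / k - 1 / n\<bar>) + 2 * (d + 1 / n))"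
        unfolding wd ws by linarith
    qed (use \<theta> R(1) in auto)
    also have "expectation (\<lambda>\<omega>. \<theta> * ?R \<omega>) = \<theta> * expectation ?R" by simp
    also have "\<dots> \<le> \<theta> * (20 * ?E)" using \<theta> R(2) by (intro mult_left_mono) auto
    finally show ?thesis unfolding int\<mu>[OF g] int\<mu>[OF sm] by simp
  qed
  have hinge_d: "\<bar>(\<integral>x. hinge s x \<partial>\<mu>) - (\<integral>x. dickman_step \<theta> (hinge s) x \<partial>\<mu>)\<bar> \<le> 20 * \<theta> * ?E" for s
    by (rule lip[OF hinge_measurable hinge_lipschitz PA.defect_hinge])
  have smooth_d: "\<bar>(\<integral>x. h x \<partial>\<mu>) - (\<integral>x. dickman_step \<theta> h x \<partial>\<mu>)\<bar> \<le> 20 * \<theta> * ?E" if "smooth_test h h'" for h h'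
    by (rule lip[OF smooth_test_continuous(3)[OF that] smooth_test_continuous(5)[OF that] PA.defect_smooth[OF _ _ that]])
  show "\<bar>(\<integral>x. h x \<partial>\<mu>) - (\<integral>x. h x \<partial>D)\<bar> \<le> 20 * \<theta> * (\<theta> + 1) * ?E" if "smooth_test h h'"
    using C.smooth_difference[OF smooth_d that] by (simp add: ac_simps)
  show "\<bar>cdf \<mu> t - cdf D t\<bar> \<le> 40 * (2 + \<theta> * (1 + 2 * 3 powr \<theta>)) * ?E powr min 1 \<theta> + 40 * \<theta>\<^sup>2 * (\<theta> + 1) * ?E"
    if t: "t \<ge> 0"
  proof -
    let ?C = "2 + \<theta> * (1 + 2 * 3 powr \<theta>)"
    let ?p = "min 1 \<theta>"
    have C0: "0 \<le> ?C" using \<theta> by (intro add_nonneg_nonneg mult_nonneg_nonneg) auto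
    have p: "0 < ?p" "?p \<le> 1" using \<theta> by auto
    have E0: "0 < ?E" by (rule error_term_pos[OF n])
    note Rp = powr_expectation_le[OF prob_space_axioms borel_measurable_integrable[OF R(1)] weight_error_pos[OF n] R(1) p R(2)]
    let ?h = "indicator {..t} :: real \<Rightarrow> real"
    have hm: "?h \<in> borel_measurable borel" by measurable
    have sm: "dickman_step \<theta> ?h \<in> borel_measurable borel" by measurable
    have i1: "integrable M (\<lambda>\<omega>. ?h (?S \<omega>))"
      by (rule integrable_const_bound[where B=1]) auto
    have sb: "\<bar>dickman_step \<theta> ?h x\<bar> \<le> 1" for x
    proof -
      have "\<bar>dickman_step \<theta> ?h x\<bar> \<le> (\<integral>u. \<bar>?h (u powr (1 / \<theta>) * (x + 1))\<bar> \<partial>unif01)"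
        unfolding dickman_avg_def by (rule integral_abs_bound)
      also have "\<dots> \<le> (\<integral>u. 1 \<partial>unif01)"
        by (intro integral_unif01_mono integrable_unif01_bounded[where B=1]) auto
      finally show ?thesis by simp
    qed
    have i2: "integrable M (\<lambda>\<omega>. dickman_step \<theta> ?h (?S \<omega>))"
      using sb by (intro integrable_const_bound[where B=1]) auto
    have "\<bar>expectation (\<lambda>\<omega>. ?h (?S \<omega>)) - expectation (\<lambda>\<omega>. dickman_step \<theta> ?h (?S \<omega>))\<bar> \<le> expectation (\<lambda>\<omega>. ?C * ?R \<omega> powr ?p)"
    proof (rule random_defect[OF n pos hm i1 i2, where \<psi>="\<lambda>x. ?C * x powr ?p"])
      fix a :: "nat \<Rightarrow> real" and d
      assume a: "\<And>k. k \<in> {1..n} \<Longrightarrow> \<bar>a k - real k / n\<bar> \<le> d" "\<And>k. k \<in> {1..n} \<Longrightarrow> 0 \<le> a k"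
      show "\<bar>expectation (\<lambda>\<omega>. ?h (\<Sum>k=1..n. a k * real (X k \<omega>))) - expectation (\<lambda>\<omega>. dickman_step \<theta> ?h (\<Sum>k=1..n. a k * real (X k \<omega>)))\<bar>
        \<le> ?C * ((\<Sum>k=1..n. \<bar>a k / k - 1 / n\<bar>) + 2 * (d + 1 / n)) powr ?p"
        using PA.defect_atMost[OF a t] unfolding wd ws .
    next
      show "?C * x powr ?p \<le> ?C * y powr ?p" if "0 \<le> x" "x \<le> y" for x y
        using that C0 p by (intro mult_left_mono powr_mono2) auto
      show "integrable M (\<lambda>\<omega>. ?C * ?R \<omega> powr ?p)" using Rp(1) E0 by (intro integrable_mult_right) auto
    qed
    also have "expectation (\<lambda>\<omega>. ?C * ?R \<omega> powr ?p) = ?C * expectation (\<lambda>\<omega>. ?R \<omega> powr ?p)" by simp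
    also have "\<dots> \<le> ?C * (2 * (20 * ?E) powr ?p)" using Rp(2) E0 C0 by (intro mult_left_mono) auto
    also have "(20 * ?E) powr ?p = 20 powr ?p * ?E powr ?p" using E0 by (subst powr_mult) auto
    also have "?C * (2 * (20 powr ?p * ?E powr ?p)) \<le> ?C * (2 * (20 * ?E powr ?p))"
    proof -
      have "(20 :: real) powr ?p \<le> 20 powr 1" using p by (intro powr_mono) auto
      then show ?thesis using C0 by (intro mult_left_mono mult_right_mono) auto
    qed
    finally have k1: "\<bar>(\<integral>x. ?h x \<partial>\<mu>) - (\<integral>x. dickman_step \<theta> ?h x \<partial>\<mu>)\<bar> \<le> 40 * ?C * ?E powr ?p"
      unfolding int\<mu>[OF hm] int\<mu>[OF sm] by (simp only: ac_simps)
    have "\<bar>cdf \<mu> t - cdf D t\<bar> \<le> 40 * ?C * ?E powr ?p + 2 * \<theta> * (\<theta> + 1) * (20 * \<theta> * ?E)"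
      by (rule C.cdf_difference[OF hinge_d k1 t])
    also have "2 * \<theta> * (\<theta> + 1) * (20 * \<theta> * ?E) = 40 * \<theta>\<^sup>2 * (\<theta> + 1) * ?E"
      by (simp add: power2_eq_square)
    finally show ?thesis .
  qed
qed

end

section \<open>Choice of the constants\<close>

text \<open>An error term at most 1 is bounded by its power with exponent
  \<open>min 1 \<theta>\<close>, which merges the two contributions. An error term above 1 makes the
  claim trivial, since the distance is at most 1; the summand 1 in the constant guarantees
  this.\<close>

lemma kolmogorov_rate_exists:
  assumes \<theta>: "\<theta> > 0"
  shows "\<exists>C>0. kolmogorov_rate (T :: 'a itself) \<theta> C"
proof -
  define C1 where "C1 = 40 * (2 + \<theta> * (1 + 2 * 3 powr \<theta>))"
  define C2 where "C2 = 40 * \<theta>\<^sup>2 * (\<theta> + 1)"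
  have C1: "C1 \<ge> 0" unfolding C1_def using \<theta> by (intro mult_nonneg_nonneg add_nonneg_nonneg) auto
  have C2: "C2 \<ge> 0" unfolding C2_def using \<theta> by (intro mult_nonneg_nonneg) auto
  have "kolmogorov_rate T \<theta> (C1 + C2 + 1)"
    unfolding kolmogorov_rate_def
  proof (intro allI impI)
    fix M :: "'a measure" and Y X \<sigma> D m n
    assume wp: "weighted_poisson M \<theta> Y X \<sigma>" and D: "dickman_law \<theta> D" and n: "1 \<le> n"
      and pos: "m = Model_B \<longrightarrow> (AE \<omega> in M. 0 < partial_sum Y n \<omega>)"
    interpret weighted_poisson M \<theta> Y X \<sigma> by fact
    let ?\<mu> = "distr M borel (weighted_sum m Y X n)"
    let ?E = "error_term \<sigma> n"
    interpret \<mu>: prob_space ?\<mu> by (rule prob_space_distr) (rule weighted_sum_measurable)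
    interpret D: prob_space D using dickman_lawD[OF D] by simp
    have E0: "0 < ?E" by (rule error_term_pos[OF n])
    have "\<bar>cdf ?\<mu> t - cdf D t\<bar> \<le> (C1 + C2 + 1) * ?E powr min 1 \<theta>" if t: "t \<ge> 0" for t
    proof (cases "?E \<le> 1")
      case True
      have "?E powr 1 \<le> ?E powr min 1 \<theta>" using E0 True by (intro powr_mono') auto
      then have le: "?E \<le> ?E powr min 1 \<theta>" using E0 by simp
      have "\<bar>cdf ?\<mu> t - cdf D t\<bar> \<le> C1 * ?E powr min 1 \<theta> + C2 * ?E"
        using distance_bounds(1)[OF n \<theta> pos D t] by (simp only: C1_def C2_def)
      also have "\<dots> \<le> C1 * ?E powr min 1 \<theta> + C2 * ?E powr min 1 \<theta> + ?E powr min 1 \<theta>"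
        using mult_left_mono[OF le C2] powr_ge_zero[of ?E "min 1 \<theta>"] by linarith
      also have "\<dots> = (C1 + C2 + 1) * ?E powr min 1 \<theta>" by (simp add: distrib_right)
      finally show ?thesis .
    next
      case False
      have "0 \<le> cdf ?\<mu> t" "cdf ?\<mu> t \<le> 1" "0 \<le> cdf D t" "cdf D t \<le> 1"
        by (auto simp: cdf_def)
      then have "\<bar>cdf ?\<mu> t - cdf D t\<bar> \<le> 1" by linarith
      moreover have "1 * 1 \<le> (C1 + C2 + 1) * ?E powr min 1 \<theta>"
        using C1 C2 False \<theta> by (intro mult_mono ge_one_powr_ge_zero) auto
      ultimately show ?thesis by linarith
    qed
    then show "kolmogorov_dist ?\<mu> D \<le> (C1 + C2 + 1) * ?E powr min 1 \<theta>"
      unfolding kolmogorov_dist_def by (intro cSUP_least) auto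
  qed
  then show ?thesis using C1 C2 by (intro exI[of _ "C1 + C2 + 1"]) auto
qed

lemma d11_rate_exists:
  assumes \<theta>: "\<theta> > 0"
  shows "\<exists>C>0. d11_rate (T :: 'a itself) \<theta> C"
proof -
  let ?C = "20 * \<theta> * (\<theta> + 1)"
  have C: "?C > 0" using \<theta> by simp
  have "d11_rate T \<theta> ?C"
    unfolding d11_rate_def
  proof (intro allI impI)
    fix M :: "'a measure" and Y X \<sigma> D m n
    assume wp: "weighted_poisson M \<theta> Y X \<sigma>" and D: "dickman_law \<theta> D" and n: "1 \<le> n"
      and pos: "m = Model_B \<longrightarrow> (AE \<omega> in M. 0 < partial_sum Y n \<omega>)"
    interpret weighted_poisson M \<theta> Y X \<sigma> by fact
    let ?E = "error_term \<sigma> n"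
    have E0: "0 < ?E" by (rule error_term_pos[OF n])
    \<comment> \<open>The factor involving the standard deviation is at least 1, so the bound by a
      multiple of the error term implies the stated one.\<close>
    have "?C * 1 * ?E \<le> ?C * (1 + 1 / real n * sqrt (\<Sum>i=1..n. (\<sigma> i)\<^sup>2)) * ?E"
      using C E0 by (intro mult_right_mono mult_left_mono) (auto intro!: divide_nonneg_nonneg sum_nonneg)
    then show "d11_dist (distr M borel (weighted_sum m Y X n)) D
        \<le> ereal (?C * (1 + 1 / real n * sqrt (\<Sum>i=1..n. (\<sigma> i)\<^sup>2)) * ?E)"
      unfolding d11_dist_def
      using order_trans[OF distance_bounds(2)[OF n \<theta> pos D smooth_test_test_functions_11]]
      by (intro SUP_least) simp
  qed
  with C show ?thesis by blast
qed

section \<open>Independence of the constants from the sample space\<close>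

text \<open>The pair of sequences is coded as a single point of \<open>nat \<Rightarrow> real\<close>, with the
  \<open>Y\<close>s at the even and the \<open>X\<close>s at the odd positions.\<close>

lemma weighted_poisson_canonical:
  fixes M :: "'a measure"
  assumes wp: "weighted_poisson M \<theta> Y X \<sigma>"
  obtains N :: "(nat \<Rightarrow> real) measure" and Y' X' where "weighted_poisson N \<theta> Y' X' \<sigma>"
    "\<forall>m n. distr N borel (weighted_sum m Y' X' n) = distr M borel (weighted_sum m Y X n)"
    "\<forall>n. (AE \<omega> in M. 0 < partial_sum Y n \<omega>) \<longrightarrow> (AE f in N. 0 < partial_sum Y' n f)"
proof -
  interpret weighted_poisson M \<theta> Y X \<sigma> by fact
  let ?L = "PiM UNIV (\<lambda>_ :: nat. borel :: real measure)"
  define \<Phi> where "\<Phi> \<omega> j = (if even j then Y (Suc (j div 2)) \<omega> else real (X (Suc (j div 2)) \<omega>))" for \<omega> and j :: nat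
  define Y' where "Y' i f = f (2 * (i - 1))" for i :: nat and f :: "nat \<Rightarrow> real"
  define X' where "X' k f = nat \<lfloor>f (2 * (k - 1) + 1)\<rfloor>" for k :: nat and f :: "nat \<Rightarrow> real"
  \<comment> \<open>Subtraction on naturals sends the indices 0 and 1 to the same position, so
    decoding is correct only from index 1 on.\<close>
  have Y': "Y' i (\<Phi> \<omega>) = Y i \<omega>" and X': "X' i (\<Phi> \<omega>) = X i \<omega>" if "1 \<le> i" for i \<omega>
    using that by (auto simp: Y'_def X'_def \<Phi>_def)
  have \<Phi>[measurable]: "\<Phi> \<in> measurable M ?L"
  proof (rule measurable_PiM_single')
    show "(\<lambda>\<omega>. \<Phi> \<omega> j) \<in> borel_measurable M" for j
      unfolding \<Phi>_def using Y_measurable[of "Suc (j div 2)"] X_real_measurable[of "Suc (j div 2)"] by simp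
  qed auto
  have Y'm[measurable]: "Y' i \<in> borel_measurable ?L" for i
    unfolding Y'_def[abs_def] by (intro measurable_component_singleton) simp
  have X'm: "X' k \<in> measurable ?L (count_space UNIV)" for k
  proof -
    have [measurable]: "(\<lambda>f. f (2 * (k - 1) + 1)) \<in> borel_measurable ?L"
      by (intro measurable_component_singleton) simp
    show ?thesis unfolding X'_def[abs_def] by measurable
  qed
  have X'r[measurable]: "(\<lambda>f. real (X' k f)) \<in> borel_measurable ?L" for k
    using X'm[of k] by measurable
  define N where "N = distr M ?L \<Phi>"
  interpret N: prob_space N unfolding N_def by (rule prob_space_distr) measurable
  have sN[measurable_cong]: "sets N = sets ?L" by (simp add: N_def)
  let ?Z = "case_sum Y (\<lambda>k \<omega>. real (X k \<omega>))"
  let ?Z' = "case_sum Y' (\<lambda>k f. real (X' k f))"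
  let ?I = "({1..} <+> {1..}) :: (nat + nat) set"
  have Z': "?Z' i (\<Phi> \<omega>) = ?Z i \<omega>" if "i \<in> ?I" for i \<omega> using that Y' X' by auto
  have Z'm: "?Z' i \<in> borel_measurable N" for i by (cases i) simp_all
  have Zm: "?Z i \<in> borel_measurable M" if "i \<in> ?I" for i
    using that Y_measurable X_real_measurable by auto
  have I: "?I \<noteq> {}" by auto
  \<comment> \<open>Independence is transported as a statement about laws: the joint law is the
    product of the marginals, and \<Phi> preserves all of them.\<close>
  have "N.indep_vars (\<lambda>_. borel) ?Z' ?I"
  proof (subst N.indep_vars_iff_distr_eq_PiM'[OF I Z'm])
    have "distr N (PiM ?I (\<lambda>_. borel)) (\<lambda>f. \<lambda>i\<in>?I. ?Z' i f) = distr M (PiM ?I (\<lambda>_. borel)) (\<lambda>\<omega>. \<lambda>i\<in>?I. ?Z' i (\<Phi> \<omega>))"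
      unfolding N_def using Z'm by (subst distr_distr) (auto simp: comp_def N_def intro!: measurable_restrict)
    also have "\<dots> = distr M (PiM ?I (\<lambda>_. borel)) (\<lambda>\<omega>. \<lambda>i\<in>?I. ?Z i \<omega>)"
      using Z' by (intro distr_cong refl restrict_ext) auto
    also have "\<dots> = PiM ?I (\<lambda>i. distr M borel (?Z i))"
      using indep indep_vars_iff_distr_eq_PiM'[OF I, of ?Z "\<lambda>_. borel"] Zm by blast
    also have "\<dots> = PiM ?I (\<lambda>i. distr N borel (?Z' i))"
    proof (rule PiM_cong[OF refl])
      fix i assume i: "i \<in> ?I"
      have "distr N borel (?Z' i) = distr M borel (\<lambda>\<omega>. ?Z' i (\<Phi> \<omega>))"
        unfolding N_def using Z'm[of i] by (subst distr_distr) (auto simp: comp_def N_def)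
      then show "distr M borel (?Z i) = distr N borel (?Z' i)" using Z'[OF i] by simp
    qed
    finally show "distr N (PiM ?I (\<lambda>_. borel)) (\<lambda>f. \<lambda>i\<in>?I. ?Z' i f) = PiM ?I (\<lambda>i. distr N borel (?Z' i))" .
  qed
  then have "weighted_poisson N \<theta> Y' X' \<sigma>"
  proof (unfold_locales)
    fix i :: nat assume i: "1 \<le> i"
    note Yi = Y'[OF i]
    show "AE f in N. 0 \<le> Y' i f" unfolding N_def using Y_nonneg[OF i] by (subst AE_distr_iff) (auto simp: Yi)
    show "integrable N (Y' i)" unfolding N_def using Y_integrable[OF i] by (subst integrable_distr_eq) (auto simp: Yi)
    show e: "N.expectation (Y' i) = 1" unfolding N_def using Y_mean[OF i] by (subst integral_distr) (auto simp: Yi)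
    show "integrable N (\<lambda>f. (Y' i f)\<^sup>2)"
      unfolding N_def using Y_square_integrable[OF i] by (subst integrable_distr_eq) (auto simp: Yi)
    have "N.expectation (\<lambda>f. (Y' i f - 1)\<^sup>2) = (\<sigma> i)\<^sup>2"
      unfolding N_def using Y_centered_square(2)[OF i] by (subst integral_distr) (auto simp: Yi)
    then show "N.variance (Y' i) = (\<sigma> i)\<^sup>2" unfolding e .
    show "distr N (count_space UNIV) (X' i) = measure_pmf (poisson_pmf (\<theta> / real i))"
      unfolding N_def using X_poisson[OF i] X'm by (subst distr_distr) (auto simp: comp_def X'[OF i])
  qed
  moreover have "distr N borel (weighted_sum m Y' X' n) = distr M borel (weighted_sum m Y X n)" for m n
  proof -
    have "weight m Y' n k \<in> borel_measurable ?L" if "k \<le> n" for k using that by (intro weight_measurable Y'm)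
    then have "weighted_sum m Y' X' n \<in> borel_measurable ?L"
      unfolding weighted_sum_def[abs_def] by (intro borel_measurable_sum borel_measurable_times X'r) auto
    moreover have "weighted_sum m Y' X' n (\<Phi> \<omega>) = weighted_sum m Y X n \<omega>" for \<omega>
      unfolding weighted_sum_def
    proof (intro sum.cong refl)
      fix k assume k: "k \<in> {1..n}"
      have "weight m Y' n k (\<Phi> \<omega>) = weight m Y n k \<omega>" using k Y' by (intro weight_cong) auto
      then show "weight m Y' n k (\<Phi> \<omega>) * real (X' k (\<Phi> \<omega>)) = weight m Y n k \<omega> * real (X k \<omega>)" using k X' by simp
    qed
    ultimately show ?thesis unfolding N_def by (subst distr_distr) (auto simp: comp_def)
  qed
  moreover have "AE f in N. 0 < partial_sum Y' n f" if "AE \<omega> in M. 0 < partial_sum Y n \<omega>" for n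
  proof -
    have "partial_sum Y' n (\<Phi> \<omega>) = partial_sum Y n \<omega>" for \<omega>
      unfolding partial_sum_def using Y' by (intro sum.cong) auto
    moreover have "partial_sum Y' n \<in> borel_measurable ?L"
      unfolding partial_sum_def[abs_def] by (intro borel_measurable_sum Y'm)
    ultimately show ?thesis unfolding N_def using that by (subst AE_distr_iff) auto
  qed
  ultimately show ?thesis by (intro that[of N Y' X']) auto
qed

text \<open>The estimate sees the sample space only through the law of the weighted sum, and the
  canonical copy inherits the hypotheses, including positivity of the partial sum.\<close>

lemma kolmogorov_rate_transfer:
  assumes "kolmogorov_rate TYPE(nat \<Rightarrow> real) \<theta> C"
  shows "kolmogorov_rate (T :: 'a itself) \<theta> C"
  unfolding kolmogorov_rate_def
proof (intro allI impI)
  fix M :: "'a measure" and Y X \<sigma> D m n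
  assume wp: "weighted_poisson M \<theta> Y X \<sigma>" and *: "dickman_law \<theta> D" "1 \<le> n"
    and pos: "m = Model_B \<longrightarrow> (AE \<omega> in M. 0 < partial_sum Y n \<omega>)"
  obtain N :: "(nat \<Rightarrow> real) measure" and Y' X' where N: "weighted_poisson N \<theta> Y' X' \<sigma>"
    "\<forall>m n. distr N borel (weighted_sum m Y' X' n) = distr M borel (weighted_sum m Y X n)"
    "\<forall>n. (AE \<omega> in M. 0 < partial_sum Y n \<omega>) \<longrightarrow> (AE f in N. 0 < partial_sum Y' n f)"
    using weighted_poisson_canonical[OF wp] by metis
  have "m = Model_B \<longrightarrow> (AE f in N. 0 < partial_sum Y' n f)" using pos N(3) by blast
  then have "kolmogorov_dist (distr N borel (weighted_sum m Y' X' n)) D \<le> C * error_term \<sigma> n powr min 1 \<theta>"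
    using assms N(1) * unfolding kolmogorov_rate_def by blast
  then show "kolmogorov_dist (distr M borel (weighted_sum m Y X n)) D \<le> C * error_term \<sigma> n powr min 1 \<theta>"
    by (simp only: N(2)[rule_format])
qed

lemma d11_rate_transfer:
  assumes "d11_rate TYPE(nat \<Rightarrow> real) \<theta> C"
  shows "d11_rate (T :: 'a itself) \<theta> C"
  unfolding d11_rate_def
proof (intro allI impI)
  fix M :: "'a measure" and Y X \<sigma> D m n
  assume wp: "weighted_poisson M \<theta> Y X \<sigma>" and *: "dickman_law \<theta> D" "1 \<le> n"
    and pos: "m = Model_B \<longrightarrow> (AE \<omega> in M. 0 < partial_sum Y n \<omega>)"
  obtain N :: "(nat \<Rightarrow> real) measure" and Y' X' where N: "weighted_poisson N \<theta> Y' X' \<sigma>"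
    "\<forall>m n. distr N borel (weighted_sum m Y' X' n) = distr M borel (weighted_sum m Y X n)"
    "\<forall>n. (AE \<omega> in M. 0 < partial_sum Y n \<omega>) \<longrightarrow> (AE f in N. 0 < partial_sum Y' n f)"
    using weighted_poisson_canonical[OF wp] by metis
  have "m = Model_B \<longrightarrow> (AE f in N. 0 < partial_sum Y' n f)" using pos N(3) by blast
  then have "d11_dist (distr N borel (weighted_sum m Y' X' n)) D
      \<le> ereal (C * (1 + 1 / real n * sqrt (\<Sum>i=1..n. (\<sigma> i)\<^sup>2)) * error_term \<sigma> n)"
    using assms N(1) * unfolding d11_rate_def by blast
  then show "d11_dist (distr M borel (weighted_sum m Y X n)) D
      \<le> ereal (C * (1 + 1 / real n * sqrt (\<Sum>i=1..n. (\<sigma> i)\<^sup>2)) * error_term \<sigma> n)"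
    by (simp only: N(2)[rule_format])
qed

theorem theorem2p2:
  fixes \<theta> :: real
  assumes "\<theta> > 0"
  shows "(\<exists>C>0. kolmogorov_rate TYPE(nat \<Rightarrow> real) \<theta> C)
       \<and> (\<forall>C>0. kolmogorov_rate TYPE(nat \<Rightarrow> real) \<theta> C \<longrightarrow> kolmogorov_rate TYPE('a) \<theta> C)
       \<and> (\<exists>C'>0. d11_rate TYPE(nat \<Rightarrow> real) \<theta> C')
       \<and> (\<forall>C'>0. d11_rate TYPE(nat \<Rightarrow> real) \<theta> C' \<longrightarrow> d11_rate TYPE('a) \<theta> C')"
  using kolmogorov_rate_exists[OF assms] d11_rate_exists[OF assms]
    kolmogorov_rate_transfer d11_rate_transfer by blast

end
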